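(* Let $1<p<\infty$, $w\in A_p$, and $\lambda=(\lambda_1,\lambda_2)\in\mathbb{R}^2$. Assume that $0\le \lambda_2\le n$ and $\lambda_1\sigma_w'+\lambda_2> 0$. Suppose that $$\lambda_1\sigma_w'+\lambda_2<n .$$ Let $\theta\ge 0$ be such that $\lambda_1+\lambda_2\theta>0$ and, for some constant $c$, $$\frac{w(B(0, r))}{ w(B(0, R)) }\le c \left(\frac rR\right)^{n\theta}\qquad \text{for all } 0<r<R,$$ and let $\alpha$ satisfy $0\le\alpha<\frac{n}{n-\lambda_2 }\left(\lambda_1+ \lambda_2 \theta\right)$ if $\lambda_2<n$, and $0\le\alpha<\infty$ if $\lambda_2= n$. Then the Hardy–Littlewood maximal operator $M$ is bounded on $\mathcal L^{p,\lambda}(|x|^\alpha w)$. If $p=1$ and $w\in A_1$, then under the same conditions on $\lambda_1,\lambda_2,\theta,\alpha$ the operator $M$ is bounded from $\mathcal L^{1,\lambda}(|x|^\alpha w)$ to $W\mathcal L^{1,\lambda}(|x|^\alpha w)$.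
   Context: For a weight (locally integrable, a.e. positive function) $v$ on $\mathbb{R}^n$, $v(E)=\int_E v$; $|E|$ is Lebesgue measure and $B(x,r)$ the Euclidean ball. For $0<p<\infty$ and $\lambda=(\lambda_1,\lambda_2)$, $\mathcal L^{p,\lambda}(v)$ and $W\mathcal L^{p,\lambda}(v)$ are the spaces of measurable $f$ for which, respectively, $$\|f\|_{\mathcal L^{p,\lambda}(v)} := \sup_{x\in \mathbb{R}^n,\, r>0}\left(\frac 1{r^{\lambda_1}\, v(B(x,r))^{\lambda_2/n}}\int_{B(x,r)}|f|^p v\right)^{1/p}<\infty,$$ $$\|f\|_{W\mathcal L^{p,\lambda}(v)}:=\sup_{x\in \mathbb{R}^n,\, r>0,\, t>0}\left(\frac {t^p\,v(\{y\in B(x,r): |f(y)|>t\})}{|B(x,r)|^{\lambda_1/n}\, v(B(x,r))^{\lambda_2/n}}\right)^{1/p}<\infty.$$ $|x|^\alpha w$ denotes the weight $x\mapsto|x|^\alpha w(x)$. $Mf(x)=\sup_{B\ni x}\frac1{|B|}\int_B|f|$ over balls $B$ containing $x$. $w\in A_p$ ($1<p<\infty$) means $\sup_B \frac{w(B)}{|B|}\left(\frac{w^{1-p'}(B)}{|B|}\right)^{p-1}<\infty$ over all balls; $w\in A_1$ means $w(B)/|B|\le c\,w(x)$ for a.e. $x\in B$, for all balls $B$. For $1<\sigma<\infty$, $w\in RH_\sigma$ means $\left(\frac{1}{|B|}\int_{B} w^\sigma \right)^{1/\sigma}\le \frac{C}{|B|} \int_{B} w$ with $C$ independent of the ball $B$.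 Every $A_p$ weight is in some $RH_\sigma$. Define $\sigma_w=\sup\{\sigma: w\in RH_\sigma\}\in(1,\infty]$, and $\sigma'=\sigma/(\sigma-1)$ is the conjugate exponent, with $\sigma_w'=1$ if $\sigma_w=\infty$. *)

theory Defs
  imports "HOL-Analysis.Analysis"
begin

text \<open>
  The space is an arbitrary \<open>'a::euclidean_space\<close>, with \<open>n = DIM('a)\<close>. Functions \<open>f\<close>
  take values in \<^typ>\<open>ereal\<close>, since \<open>M f\<close> may be infinite; averages, weighted measures and
  (quasi-)norms are \<^typ>\<open>ennreal\<close>-valued, so that no integrability is needed to write them down.
\<close>

text \<open>
  Real powers on \<open>[0, \<infinity>]\<close>, with \<open>x\<^sup>0 = 1\<close>, \<open>0\<^sup>a = 0\<close>, \<open>\<infinity>\<^sup>a = \<infinity>\<close> for \<open>a > 0\<close>,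
  and \<open>0\<^sup>a = \<infinity>\<close>, \<open>\<infinity>\<^sup>a = 0\<close> for \<open>a < 0\<close>.
\<close>
definition epowr :: "ennreal \<Rightarrow> real \<Rightarrow> ennreal" where
  "epowr x a =
    (if a = 0 then 1
     else if x = top then (if a > 0 then top else 0)
     else if x = 0 then (if a > 0 then 0 else top)
     else ennreal (enn2real x powr a))"

definition eabs :: "ereal \<Rightarrow> ennreal" where
  "eabs y = e2ennreal \<bar>y\<bar>"

definition weight :: "('a::euclidean_space \<Rightarrow> real) \<Rightarrow> bool" where
  "weight v \<longleftrightarrow>
    v \<in> borel_measurable lebesgue \<and>
    (\<forall>K. compact K \<longrightarrow> set_integrable lebesgue K v) \<and>
    (AE x in lebesgue. v x > 0)"

definition wmeas :: "('a::euclidean_space \<Rightarrow> real) \<Rightarrow> 'a set \<Rightarrow> ennreal" where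
  "wmeas v E = (\<integral>\<^sup>+y\<in>E. ennreal (v y) \<partial>lebesgue)"

definition morrey_norm ::
  "real \<Rightarrow> real \<Rightarrow> real \<Rightarrow> ('a::euclidean_space \<Rightarrow> real) \<Rightarrow> ('a \<Rightarrow> ereal) \<Rightarrow> ennreal" where
  "morrey_norm p lam1 lam2 v f =
    (SUP x. SUP r\<in>{0<..}.
      epowr ((\<integral>\<^sup>+y\<in>ball x r. epowr (eabs (f y)) p * ennreal (v y) \<partial>lebesgue) /
             (ennreal (r powr lam1) * epowr (wmeas v (ball x r)) (lam2 / real DIM('a))))
            (1 / p))"

definition weak_morrey_norm ::
  "real \<Rightarrow> real \<Rightarrow> real \<Rightarrow> ('a::euclidean_space \<Rightarrow> real) \<Rightarrow> ('a \<Rightarrow> ereal) \<Rightarrow> ennreal" where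
  "weak_morrey_norm p lam1 lam2 v f =
    (SUP x. SUP r\<in>{0<..}. SUP t\<in>{0<..}.
      epowr ((ennreal (t powr p) * wmeas v {y \<in> ball x r. eabs (f y) > ennreal t}) /
             (epowr (emeasure lebesgue (ball x r)) (lam1 / real DIM('a)) *
              epowr (wmeas v (ball x r)) (lam2 / real DIM('a))))
            (1 / p))"

definition morrey_space ::
  "real \<Rightarrow> real \<Rightarrow> real \<Rightarrow> ('a::euclidean_space \<Rightarrow> real) \<Rightarrow> ('a \<Rightarrow> ereal) set" where
  "morrey_space p lam1 lam2 v =
    {f. f \<in> borel_measurable lebesgue \<and> morrey_norm p lam1 lam2 v f < top}"

definition weak_morrey_space ::
  "real \<Rightarrow> real \<Rightarrow> real \<Rightarrow> ('a::euclidean_space \<Rightarrow> real) \<Rightarrow> ('a \<Rightarrow> ereal) set" where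
  "weak_morrey_space p lam1 lam2 v =
    {f. f \<in> borel_measurable lebesgue \<and> weak_morrey_norm p lam1 lam2 v f < top}"

text \<open>
  The weight \<open>|x|\<^sup>\<alpha> w\<close>. For \<open>\<alpha> = 0\<close> it differs from \<open>w\<close> at the origin only, because
  \<open>0 powr 0 = 0\<close>; this is a null set.
\<close>
definition power_weight :: "real \<Rightarrow> ('a::euclidean_space \<Rightarrow> real) \<Rightarrow> 'a \<Rightarrow> real" where
  "power_weight \<alpha> w = (\<lambda>x. norm x powr \<alpha> * w x)"

definition maximal :: "('a::euclidean_space \<Rightarrow> ereal) \<Rightarrow> 'a \<Rightarrow> ereal" where
  "maximal f x =
    enn2ereal (SUP (z, r)\<in>{(z, r). r > 0 \<and> x \<in> ball z r}.
      (\<integral>\<^sup>+y\<in>ball z r. eabs (f y) \<partial>lebesgue) / emeasure lebesgue (ball z r))"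

definition bounded_operator ::
  "('f \<Rightarrow> 'g) \<Rightarrow> 'f set \<Rightarrow> ('f \<Rightarrow> ennreal) \<Rightarrow> 'g set \<Rightarrow> ('g \<Rightarrow> ennreal) \<Rightarrow> bool" where
  "bounded_operator T X nX Y nY \<longleftrightarrow>
    (\<exists>C::real. \<forall>f\<in>X. T f \<in> Y \<and> nY (T f) \<le> ennreal C * nX f)"

definition conj_exp :: "real \<Rightarrow> real" where
  "conj_exp p = p / (p - 1)"

text \<open>The class \<open>A\<^sub>p\<close> for \<open>1 < p < \<infinity>\<close>.\<close>
definition Ap :: "real \<Rightarrow> ('a::euclidean_space \<Rightarrow> real) \<Rightarrow> bool" where
  "Ap p w \<longleftrightarrow> weight w \<and>
    (SUP x. SUP r\<in>{0<..}.
      wmeas w (ball x r) / emeasure lebesgue (ball x r) *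
      epowr (wmeas (\<lambda>y. w y powr (1 - conj_exp p)) (ball x r) / emeasure lebesgue (ball x r))
        (p - 1)) < top"

definition A1 :: "('a::euclidean_space \<Rightarrow> real) \<Rightarrow> bool" where
  "A1 w \<longleftrightarrow> weight w \<and>
    (\<exists>c::real. \<forall>x. \<forall>r>0. AE y in lebesgue. y \<in> ball x r \<longrightarrow>
      wmeas w (ball x r) / emeasure lebesgue (ball x r) \<le> ennreal (c * w y))"

text \<open>The reverse Hoelder class, for \<open>1 < \<sigma> < \<infinity>\<close>.\<close>
definition RH :: "real \<Rightarrow> ('a::euclidean_space \<Rightarrow> real) \<Rightarrow> bool" where
  "RH \<sigma> w \<longleftrightarrow>
    (\<exists>C::real. \<forall>x. \<forall>r>0.
      epowr (wmeas (\<lambda>y. w y powr \<sigma>) (ball x r) / emeasure lebesgue (ball x r)) (1 / \<sigma>)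
      \<le> ennreal C * (wmeas w (ball x r) / emeasure lebesgue (ball x r)))"

definition rh_index :: "('a::euclidean_space \<Rightarrow> real) \<Rightarrow> ereal" where
  "rh_index w = Sup {ereal \<sigma> |\<sigma>. 1 < \<sigma> \<and> RH \<sigma> w}"

definition rh_index_conj :: "('a::euclidean_space \<Rightarrow> real) \<Rightarrow> real" where
  "rh_index_conj w = (if rh_index w = \<infinity> then 1 else conj_exp (real_of_ereal (rh_index w)))"

end

theory Submission
  imports Defs
begin

text \<open>
  All that is used of \<open>w\<close> is the inequality \<open>(avg\<^sub>B g)\<^sup>p w(B) \<le> C \<integral>\<^sub>B g\<^sup>p w\<close> for all balls,
  which for \<open>p > 1\<close> follows from \<open>A\<^sub>p\<close> by duality and for \<open>p = 1\<close> is \<open>A\<^sub>1\<close> integrated. It gives doubling,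
  the weak type \<open>(p, p)\<close> of \<open>M\<close> by a Vitali covering, and a reverse Hoelder inequality; applied to the
  dual weight, the latter lowers \<open>p\<close>, and interpolation with \<open>L\<^sup>\<infinity>\<close> yields the strong type.

  The mass of \<open>v = |x|\<^sup>\<alpha> w\<close> on \<open>B(x, r)\<close> is comparable to \<open>U(x, r) = max(|x|, r)\<^sup>\<alpha> w(B(x, r))\<close>. If \<open>f\<close> has
  Morrey norm 1, then its average over any ball is at most a constant times \<open>\<phi>\<^sup>1\<^sup>/\<^sup>p\<close>, where
  \<open>\<phi> = r\<^bsup>lam1\<^esup> U\<^bsup>lam2/n - 1\<^esup>\<close>: for balls far from the origin \<open>v\<close> is a multiple of \<open>w\<close>, and a ball around
  the origin is split into dyadic annuli, the bound on \<open>\<alpha>\<close> making the series converge. Since \<open>\<phi>\<close> is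
  almost decreasing in \<open>r\<close>, by the reverse Hoelder inequality and \<open>lam1 \<sigma>'\<^sub>w + lam2 < n\<close>, \<open>M f\<close> exceeds
  \<open>M (f 1\<^bsub>2B\<^esub>)\<close> on \<open>B\<close> by at most a multiple of \<open>\<phi>\<^sup>1\<^sup>/\<^sup>p\<close>. This settles the far balls; the others are again
  decomposed dyadically, with convergence from \<open>lam1 + lam2 \<theta> > 0\<close>.
\<close>

section \<open>Powers and integrals of extended nonnegative functions\<close>

text \<open>The obstacle is that \<open>v\<close> need not be an \<open>A\<^sub>p\<close> weight:
  for \<open>lam2 = n\<close> the exponent \<alpha> is arbitrary, and already for
  \<open>w = 1\<close> a large \<alpha> leaves \<open>A\<^sub>p\<close>. Hence weighted estimates
  are proved for \<open>w\<close> and carried over to \<open>v\<close> only on sets where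
  \<open>norm\<close> is comparable to a constant. The averages of \<open>f\<close> over annuli
  shrinking to the origin are summable if \<open>\<alpha> * \<kappa> < lam1 + lam2 * p\<close> with
  \<open>\<kappa> = 1 - lam2 / n\<close>. The hypothesis on \<alpha> is the same inequality with
  \<theta> in place of \<open>p\<close>, and \<open>\<theta> \<le> p\<close> because doubling limits
  how fast \<open>w(B(0, r))\<close> can decay. Balls replace dyadic cubes throughout. The stopping
  time of the reverse Hoelder inequality therefore runs over radii growing by the factor 5, and its
  estimate has a larger ball on the right. The integral over that ball cannot be absorbed on the
  left; a small exponent \<epsilon> makes its coefficient small enough to beat the doubling
  constants when the estimate is iterated outwards.\<close>

lemma epowr_ennreal: "0 < a \<Longrightarrow> 0 \<le> x \<Longrightarrow> epowr (ennreal x) a = ennreal (x powr a)"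
  by (auto simp: epowr_def)

lemma epowr_ennreal_pos: "0 < x \<Longrightarrow> epowr (ennreal x) a = ennreal (x powr a)"
  by (auto simp: epowr_def)

lemma epowr_0 [simp]: "0 < a \<Longrightarrow> epowr 0 a = 0"
  and epowr_top [simp]: "0 < a \<Longrightarrow> epowr top a = top"
  and epowr_1_left [simp]: "epowr 1 a = 1"
  by (auto simp: epowr_def)

lemma epowr_1_right [simp]: "epowr x 1 = x"
  by (cases x) (auto simp: epowr_def)

lemma epowr_mono: "0 < a \<Longrightarrow> x \<le> y \<Longrightarrow> epowr x a \<le> epowr y a"
  by (cases x; cases y) (auto simp: epowr_ennreal ennreal_leI powr_mono2 top_unique simp flip: ennreal_1)

lemma epowr_mult: "0 < a \<Longrightarrow> epowr (x * y) a = epowr x a * epowr y a"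
proof (cases x; cases y)
  fix r s assume "0 < a" "0 \<le> r" "x = ennreal r" "0 \<le> s" "y = ennreal s"
  then show ?thesis
    by (simp add: epowr_ennreal powr_mult flip: ennreal_mult)
qed (auto simp: epowr_def ennreal_mult_top ennreal_top_mult ennreal_mult_eq_top_iff)

lemma epowr_epowr: "0 < a \<Longrightarrow> 0 < b \<Longrightarrow> epowr (epowr x a) b = epowr x (a * b)"
  by (cases x) (auto simp: epowr_ennreal powr_powr)

lemma epowr_add: "0 < a \<Longrightarrow> 0 < b \<Longrightarrow> epowr x (a + b) = epowr x a * epowr x b"
  by (cases x) (auto simp: epowr_ennreal powr_add ennreal_mult_top simp flip: ennreal_mult)

lemma epowr_eq_0_iff: "0 < a \<Longrightarrow> epowr x a = 0 \<longleftrightarrow> x = 0"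
  by (cases x) (auto simp: epowr_ennreal ennreal_eq_0_iff)

lemma epowr_inverse_le_iff:
  assumes "0 < p" "0 \<le> y"
  shows "epowr x (1 / p) \<le> ennreal y \<longleftrightarrow> x \<le> ennreal (y powr p)"
proof
  assume "epowr x (1 / p) \<le> ennreal y"
  then have "epowr (epowr x (1 / p)) p \<le> epowr (ennreal y) p"
    using assms by (intro epowr_mono) auto
  then show "x \<le> ennreal (y powr p)"
    using assms by (simp add: epowr_epowr epowr_ennreal)
next
  assume "x \<le> ennreal (y powr p)"
  then have "epowr x (1 / p) \<le> epowr (ennreal (y powr p)) (1 / p)"
    using assms by (intro epowr_mono) auto
  then show "epowr x (1 / p) \<le> ennreal y"
    using assms by (simp add: epowr_ennreal powr_powr)
qed

lemma epowr_add_le: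
  assumes "0 < p"
  shows "epowr (x + y) p \<le> ennreal (2 powr p) * (epowr x p + epowr y p)"
proof -
  have *: "epowr (x + y) p \<le> ennreal (2 powr p) * (epowr x p + epowr y p)" if "x \<le> y" for x y
  proof -
    have "epowr (x + y) p \<le> epowr (2 * y) p"
      using that assms by (intro epowr_mono) (auto simp: mult_2 add_right_mono)
    also have "\<dots> = ennreal (2 powr p) * epowr y p"
      using assms epowr_ennreal[of p 2] by (simp add: epowr_mult)
    finally show ?thesis
      by (rule order_trans) (auto intro: mult_left_mono)
  qed
  show ?thesis
    using *[of x y] *[of y x] by (cases "x \<le> y") (auto simp: add.commute)
qed

lemma epowr_measurable [measurable (raw)]:
  assumes [measurable]: "f \<in> borel_measurable M"
  shows "(\<lambda>x. epowr (f x) a) \<in> borel_measurable M"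
  unfolding epowr_def by measurable

lemma eabs_measurable [measurable (raw)]:
  assumes [measurable]: "f \<in> borel_measurable M"
  shows "(\<lambda>x. eabs (f x)) \<in> borel_measurable M"
  unfolding eabs_def by measurable

lemma ennreal_Youngs_inequality:
  assumes "1 < p" "1 < q" "1 / p + 1 / q = 1"
  shows "x * y \<le> ennreal (1 / p) * epowr x p + ennreal (1 / q) * epowr y q"
proof (cases x; cases y)
  fix r s assume "0 \<le> r" "x = ennreal r" "0 \<le> s" "y = ennreal s"
  then show ?thesis
    using Youngs_inequality[of p q r s] assms
    by (simp add: epowr_ennreal flip: ennreal_mult ennreal_plus)
qed (use assms in \<open>auto simp: ennreal_mult_top ennreal_eq_0_iff\<close>)

text \<open>Young's inequality for \<open>f x / a\<close> and \<open>g x / b\<close>, where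
  \<open>a\<close> and \<open>b\<close> are the two norms. Vanishing and infinite norms are split
  off first: if one norm is 0, the product vanishes almost everywhere, which agrees with
  \<open>0 * top = 0\<close> on the right.\<close>

lemma nn_integral_Hoelder:
  assumes [measurable]: "f \<in> borel_measurable M" "g \<in> borel_measurable M"
    and pq: "1 < p" "1 < q" "1 / p + 1 / q = 1"
  shows "(\<integral>\<^sup>+x. f x * g x \<partial>M) \<le>
    epowr (\<integral>\<^sup>+x. epowr (f x) p \<partial>M) (1 / p) * epowr (\<integral>\<^sup>+x. epowr (g x) q \<partial>M) (1 / q)"
    (is "?I \<le> epowr ?F _ * epowr ?G _")
proof -
  have z: "?I = 0" if "?F = 0 \<or> ?G = 0"
    using that
  proof
    assume "?F = 0"
    then have "AE x in M. epowr (f x) p = 0"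
      by (subst (asm) nn_integral_0_iff_AE) auto
    then have "AE x in M. f x * g x = 0"
      by eventually_elim (use pq in \<open>simp add: epowr_eq_0_iff\<close>)
    then show "?I = 0"
      by (subst nn_integral_0_iff_AE) auto
  next
    assume "?G = 0"
    then have "AE x in M. epowr (g x) q = 0"
      by (subst (asm) nn_integral_0_iff_AE) auto
    then have "AE x in M. f x * g x = 0"
      by eventually_elim (use pq in \<open>simp add: epowr_eq_0_iff\<close>)
    then show "?I = 0"
      by (subst nn_integral_0_iff_AE) auto
  qed
  consider "?F = 0 \<or> ?G = 0" | "?F \<noteq> 0" "?G \<noteq> 0" "?F = top \<or> ?G = top"
    | F G where "0 < F" "0 < G" "?F = ennreal F" "?G = ennreal G"
    by (cases ?F; cases ?G) (auto simp: ennreal_eq_0_iff less_le)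
  then show ?thesis
  proof cases
    case 1
    then show ?thesis using z by simp
  next
    case 2
    then show ?thesis
      using pq epowr_eq_0_iff[of "1/p" ?F] epowr_eq_0_iff[of "1/q" ?G]
      by (auto simp: ennreal_mult_top ennreal_top_mult)
  next
    case (3 F G)
    define a where "a = F powr (1 / p)"
    define b where "b = G powr (1 / q)"
    have ab: "0 < a" "0 < b" "a powr p = F" "b powr q = G"
      using 3 pq by (auto simp: a_def b_def powr_powr)
    have inv: "ennreal a * ennreal (1 / a) = 1" "ennreal b * ennreal (1 / b) = 1"
      using ab by (auto simp flip: ennreal_mult)
    have "f x * g x \<le> ennreal (a * b) *
        (ennreal (1 / (p * F)) * epowr (f x) p + ennreal (1 / (q * G)) * epowr (g x) q)" for x
    proof -
      have "f x * g x = (ennreal a * ennreal (1 / a)) * f x * ((ennreal b * ennreal (1 / b)) * g x)"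
        using inv by simp
      also have "\<dots> = ennreal (a * b) * ((ennreal (1 / a) * f x) * (ennreal (1 / b) * g x))"
        using ab by (simp add: ennreal_mult ac_simps)
      also have "\<dots> \<le> ennreal (a * b) * (ennreal (1 / p) * epowr (ennreal (1 / a) * f x) p +
          ennreal (1 / q) * epowr (ennreal (1 / b) * g x) q)"
        using pq by (intro mult_left_mono ennreal_Youngs_inequality) auto
      also have "\<dots> = ennreal (a * b) *
        (ennreal (1 / (p * F)) * epowr (f x) p + ennreal (1 / (q * G)) * epowr (g x) q)"
        using pq ab 3(1,2)
        by (simp add: epowr_mult epowr_ennreal powr_divide mult.assoc[symmetric] flip: ennreal_mult)
      finally show ?thesis .
    qed
    then have "?I \<le> (\<integral>\<^sup>+x. ennreal (a * b) *
        (ennreal (1 / (p * F)) * epowr (f x) p + ennreal (1 / (q * G)) * epowr (g x) q) \<partial>M)"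
      by (intro nn_integral_mono)
    also have "\<dots> = ennreal (a * b) * (ennreal (1 / (p * F)) * ?F + ennreal (1 / (q * G)) * ?G)"
      by (simp add: nn_integral_cmult nn_integral_add)
    also have "\<dots> = ennreal (a * b) * (ennreal (1 / p) + ennreal (1 / q))"
      using 3 pq by (simp flip: ennreal_mult)
    also have "\<dots> = ennreal a * ennreal b"
      using pq ab by (simp add: ennreal_mult flip: ennreal_plus)
    finally show ?thesis
      using 3 pq by (simp add: a_def b_def epowr_ennreal)
  qed
qed

section \<open>Lebesgue measure of balls and the layer-cake formula\<close>

lemma emeasure_lebesgue_ball:
  "0 \<le> r \<Longrightarrow> emeasure lebesgue (ball (x::'a::euclidean_space) r) =
    ennreal (unit_ball_vol (real DIM('a)) * r ^ DIM('a))"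
  by (simp add: emeasure_ball)

lemma sigma_finite_lebesgue: "sigma_finite_measure (lebesgue :: 'a::euclidean_space measure)"
proof
  show "\<exists>A::'a set set. countable A \<and> A \<subseteq> sets lebesgue \<and> \<Union> A = space lebesgue \<and>
      (\<forall>a\<in>A. emeasure lebesgue a \<noteq> \<infinity>)"
    by (intro exI[of _ "range (\<lambda>n::nat. ball 0 (real n))"])
       (use reals_Archimedean2 in \<open>auto simp: emeasure_ball\<close>)
qed

text \<open>For \<open>a < 1\<close> the integrand is unbounded at 0, so the fundamental theorem is
  applied with a derivative in the open interval only. The reverse Hoelder argument uses small
  \<open>a\<close>.\<close>

lemma nn_integral_powr_Ioo:
  assumes "0 < a" "0 \<le> r"
  shows "(\<integral>\<^sup>+t. ennreal (t powr (a - 1)) * indicator {0<..<r} t \<partial>lborel) = ennreal (r powr a / a)"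
proof -
  have d: "((\<lambda>t. t powr a / a) has_real_derivative t powr (a - 1)) (at t)" if "t \<in> {0<..<r}" for t
    using that assms by (auto intro!: derivative_eq_intros)
  have "continuous_on {0..r} (\<lambda>t. t powr a / a)"
    using assms by (intro continuous_on_divide continuous_on_powr' continuous_on_id continuous_on_const) auto
  then have "((\<lambda>t. t powr (a - 1)) has_integral r powr a / a - 0 powr a / a) {0..r}"
    using assms d
    by (intro fundamental_theorem_of_calculus_interior)
       (auto simp: has_real_derivative_iff_has_vector_derivative[symmetric])
  then have "((\<lambda>t. t powr (a - 1)) has_integral r powr a / a) {0..r}"
    using assms by simp
  then have "((\<lambda>t. t powr (a - 1)) has_integral r powr a / a) {0<..<r}"
    by (metis box_real(1) cbox_interval has_integral_open_interval)
  then show ?thesis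
    by (intro nn_integral_has_integral_lebesgue') auto
qed

lemma nn_integral_powr_less:
  assumes "0 < a"
  shows "(\<integral>\<^sup>+t. ennreal (t powr (a - 1)) * indicator {t. 0 < t \<and> ennreal t < y} t \<partial>lborel) =
    ennreal (1 / a) * epowr y a"
proof (cases y)
  case (real r)
  have "{t. 0 < t \<and> ennreal t < y} = {0<..<r}"
    using real by (auto simp: ennreal_less_iff)
  then show ?thesis
    using real assms nn_integral_powr_Ioo[of a r] by (simp add: epowr_ennreal flip: ennreal_mult)
next
  case top
  have "ennreal (1 / a) * ennreal (real n powr a) \<le>
      (\<integral>\<^sup>+t. ennreal (t powr (a - 1)) * indicator {t. 0 < t \<and> ennreal t < top} t \<partial>lborel)" for n :: nat
  proof -
    have "ennreal (1 / a) * ennreal (real n powr a) = 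
        (\<integral>\<^sup>+t. ennreal (t powr (a - 1)) * indicator {0<..<real n} t \<partial>lborel)"
      using assms nn_integral_powr_Ioo[of a "real n"] by (simp flip: ennreal_mult)
    also have "\<dots> \<le>
      (\<integral>\<^sup>+t. ennreal (t powr (a - 1)) * indicator {t. 0 < t \<and> ennreal t < top} t \<partial>lborel)"
      by (intro nn_integral_mono) (auto simp: indicator_def)
    finally show ?thesis .
  qed
  moreover have "(\<lambda>n. ennreal (1 / a) * ennreal (real n powr a)) \<longlonglongrightarrow> top"
  proof -
    have "filterlim (\<lambda>n. 1 / a * real n powr a) at_top sequentially"
      using assms by (intro filterlim_tendsto_pos_mult_at_top[OF tendsto_const]
        filterlim_compose[OF _ filterlim_real_sequentially] real_powr_at_top) auto
    then have "(\<lambda>n. ennreal (1 / a * real n powr a)) \<longlonglongrightarrow> top"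
      by (simp only: ennreal_tendsto_top_eq_at_top)
    then show ?thesis
      using assms by (simp flip: ennreal_mult)
  qed
  ultimately have "top \<le> (\<integral>\<^sup>+t. ennreal (t powr (a - 1)) * indicator {t. 0 < t \<and> ennreal t < top} t \<partial>lborel)"
    by (intro LIMSEQ_le_const2) auto
  then show ?thesis
    using top assms by (simp add: top_unique ennreal_mult_top ennreal_eq_0_iff)
qed

text \<open>Tonelli on the region below the graph of \<open>h\<close>. Both the reverse Hoelder and
  the strong type estimate start from it; in the former, the factor \<open>1 / a\<close> is the
  source of the small coefficient \<epsilon>.\<close>

lemma nn_integral_layer_cake:
  assumes "sigma_finite_measure M" and [measurable]: "h \<in> borel_measurable M" and "0 < a"
  shows "ennreal (1 / a) * (\<integral>\<^sup>+x. epowr (h x) a \<partial>M) =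
    (\<integral>\<^sup>+t. ennreal (t powr (a - 1)) * indicator {0<..} t * emeasure M {x\<in>space M. ennreal t < h x} \<partial>lborel)"
proof -
  interpret pair_sigma_finite M lborel
    using assms(1) by (simp add: pair_sigma_finite_def sigma_finite_lborel)
  have "ennreal (1 / a) * (\<integral>\<^sup>+x. epowr (h x) a \<partial>M) = (\<integral>\<^sup>+x. ennreal (1 / a) * epowr (h x) a \<partial>M)"
    by (simp add: nn_integral_cmult)
  also have "\<dots> = (\<integral>\<^sup>+x. \<integral>\<^sup>+t. ennreal (t powr (a - 1)) * indicator {t. 0 < t \<and> ennreal t < h x} t \<partial>lborel \<partial>M)"
    using assms by (simp add: nn_integral_powr_less)
  also have "\<dots> = (\<integral>\<^sup>+t. \<integral>\<^sup>+x. ennreal (t powr (a - 1)) * indicator {t. 0 < t \<and> ennreal t < h x} t \<partial>M \<partial>lborel)"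
    by (intro Fubini'[symmetric]) (simp add: indicator_def case_prod_beta)
  also have "\<dots> = (\<integral>\<^sup>+t. ennreal (t powr (a - 1)) * indicator {0<..} t * emeasure M {x\<in>space M. ennreal t < h x} \<partial>lborel)"
  proof (intro nn_integral_cong)
    fix t
    have "(\<integral>\<^sup>+x. ennreal (t powr (a - 1)) * indicator {t. 0 < t \<and> ennreal t < h x} t \<partial>M) =
      (\<integral>\<^sup>+x. ennreal (t powr (a - 1)) * indicator {0<..} t * indicator {x\<in>space M. ennreal t < h x} x \<partial>M)"
      by (intro nn_integral_cong) (auto simp: indicator_def)
    also have "\<dots> = ennreal (t powr (a - 1)) * indicator {0<..} t * emeasure M {x\<in>space M. ennreal t < h x}"
      by (subst nn_integral_cmult) auto
    finally show "(\<integral>\<^sup>+x. ennreal (t powr (a - 1)) * indicator {t. 0 < t \<and> ennreal t < h x} t \<partial>M) = \<dots>" .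
  qed
  finally show ?thesis .
qed

section \<open>Weights and the maximal function\<close>

definition wm :: "('a::euclidean_space \<Rightarrow> real) \<Rightarrow> 'a measure" where
  "wm w = density lebesgue (\<lambda>y. ennreal (w y))"

definition avg :: "('a::euclidean_space \<Rightarrow> ennreal) \<Rightarrow> 'a \<Rightarrow> real \<Rightarrow> ennreal" where
  "avg g x r = (\<integral>\<^sup>+y\<in>ball x r. g y \<partial>lebesgue) / emeasure lebesgue (ball x r)"

definition hl :: "('a::euclidean_space \<Rightarrow> ennreal) \<Rightarrow> 'a \<Rightarrow> ennreal" where
  "hl g x = (SUP (z, r)\<in>{(z, r). r > 0 \<and> x \<in> ball z r}. avg g z r)"

text \<open>Real-valued, because balls have finite weighted measure; quotients and real powers of
  masses can then be treated by \<open>powr\<close>.\<close>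

definition mass :: "('a::euclidean_space \<Rightarrow> real) \<Rightarrow> 'a \<Rightarrow> real \<Rightarrow> real" where
  "mass w x r = measure (wm w) (ball x r)"

text \<open>
  For \<open>1 < p\<close> this is implied by \<open>Ap p w\<close>, and for \<open>p = 1\<close> by \<open>A1 w\<close>, so that both parts of
  the theorem are treated at once.
\<close>
definition muckenhoupt :: "real \<Rightarrow> real \<Rightarrow> ('a::euclidean_space \<Rightarrow> real) \<Rightarrow> bool" where
  "muckenhoupt p C w \<longleftrightarrow> weight w \<and> 1 \<le> p \<and> 0 < C \<and>
    (\<forall>x r g. 0 < r \<longrightarrow> g \<in> borel_measurable lebesgue \<longrightarrow>
      epowr (avg g x r) p * emeasure (wm w) (ball x r) \<le> ennreal C * (\<integral>\<^sup>+y\<in>ball x r. epowr (g y) p \<partial>wm w))"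

lemma sets_wm [simp, measurable_cong]: "sets (wm w) = sets lebesgue"
  and space_wm [simp]: "space (wm w) = UNIV"
  by (simp_all add: wm_def)

lemma measurable_wm [simp]: "measurable (wm w) N = measurable lebesgue N"
  by (rule measurable_cong_sets) simp_all

lemma weight_measurable [measurable_dest]: "weight w \<Longrightarrow> w \<in> borel_measurable lebesgue"
  by (simp add: weight_def)

lemma wmeas_eq: "w \<in> borel_measurable lebesgue \<Longrightarrow> E \<in> sets lebesgue \<Longrightarrow> wmeas w E = emeasure (wm w) E"
  by (simp add: wmeas_def wm_def emeasure_density)

lemma ball_sets_lebesgue [measurable]: "ball x r \<in> sets lebesgue"
  by simp

lemma set_nn_integral_wm:
  assumes [measurable]: "w \<in> borel_measurable lebesgue" "h \<in> borel_measurable lebesgue" "E \<in> sets lebesgue"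
  shows "(\<integral>\<^sup>+y\<in>E. h y \<partial>wm w) = (\<integral>\<^sup>+y\<in>E. h y * ennreal (w y) \<partial>lebesgue)"
  unfolding wm_def by (subst nn_integral_density) (auto intro!: nn_integral_cong simp: ac_simps)

lemma weight_ball_finite:
  assumes "weight w"
  shows "emeasure (wm w) (ball x r) < top"
proof -
  have "set_integrable lebesgue (cball x r) w"
    using assms by (auto simp: weight_def)
  then have "(\<integral>\<^sup>+y. ennreal (norm (indicator (cball x r) y *\<^sub>R w y)) \<partial>lebesgue) < top"
    unfolding set_integrable_def integrable_iff_bounded by simp
  moreover have "(\<integral>\<^sup>+y\<in>ball x r. ennreal (w y) \<partial>lebesgue)
      \<le> (\<integral>\<^sup>+y. ennreal (norm (indicator (cball x r) y *\<^sub>R w y)) \<partial>lebesgue)"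
    by (intro nn_integral_mono) (auto simp: indicator_def intro!: ennreal_leI)
  ultimately show ?thesis
    using assms by (auto simp: wm_def emeasure_density weight_def)
qed

text \<open>Positivity almost everywhere makes the two measures mutually absolutely continuous, so
  exceptional sets of Lebesgue coverings can be discarded for \<open>w\<close> too.\<close>

lemma weight_null_iff:
  assumes "weight w" "E \<in> sets lebesgue"
  shows "emeasure (wm w) E = 0 \<longleftrightarrow> emeasure lebesgue E = 0"
proof -
  have [measurable]: "w \<in> borel_measurable lebesgue" "E \<in> sets lebesgue"
    using assms by (auto simp: weight_def)
  have pos: "AE y in lebesgue. 0 < w y"
    using assms by (simp add: weight_def)
  have "emeasure (wm w) E = 0 \<longleftrightarrow> (AE y in lebesgue. ennreal (w y) * indicator E y = 0)"
    unfolding wm_def by (subst emeasure_density) (auto simp: nn_integral_0_iff_AE)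
  also have "\<dots> \<longleftrightarrow> (AE y in lebesgue. indicator E y = (0::ennreal))"
  proof
    assume "AE y in lebesgue. ennreal (w y) * indicator E y = 0"
    then show "AE y in lebesgue. indicator E y = (0::ennreal)"
      using pos by eventually_elim (auto simp: indicator_def ennreal_eq_0_iff split: if_splits)
  qed auto
  also have "\<dots> \<longleftrightarrow> emeasure lebesgue E = 0"
    by (subst AE_iff_measurable[of E]) (auto simp: indicator_def)
  finally show ?thesis .
qed

lemma weight_ball_pos:
  assumes "weight w" "0 < r"
  shows "emeasure (wm w) (ball x r) > 0"
proof -
  have "emeasure lebesgue (ball x r) \<noteq> 0"
    using assms by (simp add: emeasure_ball ennreal_eq_0_iff not_le)
  then show ?thesis
    using weight_null_iff[OF assms(1), of "ball x r"] by (auto simp: zero_less_iff_neq_zero)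
qed

lemma emeasure_wm_ball: "weight w \<Longrightarrow> emeasure (wm w) (ball x r) = ennreal (mass w x r)"
  unfolding mass_def by (intro emeasure_eq_ennreal_measure) (use weight_ball_finite in \<open>auto simp: less_top\<close>)

lemma mass_pos: "weight w \<Longrightarrow> 0 < r \<Longrightarrow> 0 < mass w x r"
  using weight_ball_pos[of w r x] by (simp add: emeasure_wm_ball)

lemma mass_mono: "weight w \<Longrightarrow> ball x r \<subseteq> ball y s \<Longrightarrow> mass w x r \<le> mass w y s"
proof -
  assume "weight w" "ball x r \<subseteq> ball y s"
  then have "emeasure (wm w) (ball x r) \<le> emeasure (wm w) (ball y s)"
    by (intro emeasure_mono) auto
  then show ?thesis
    using \<open>weight w\<close> by (simp add: emeasure_wm_ball mass_def ennreal_le_iff)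
qed

lemma sigma_finite_wm: "weight w \<Longrightarrow> sigma_finite_measure (wm w)"
proof -
  assume w: "weight w"
  show ?thesis
  proof
    show "\<exists>A. countable A \<and> A \<subseteq> sets (wm w) \<and> \<Union> A = space (wm w) \<and>
        (\<forall>a\<in>A. emeasure (wm w) a \<noteq> \<infinity>)"
      by (intro exI[of _ "range (\<lambda>n::nat. ball 0 (real n))"])
         (use reals_Archimedean2 weight_ball_finite[OF w] in \<open>auto simp: less_top\<close>)
  qed
qed

text \<open>Countable subadditivity for a family indexed by an arbitrary countable set, the form in
  which the Vitali covering results deliver their balls.\<close>

lemma emeasure_UN_le_count_space:
  assumes "countable I" "\<And>i. i \<in> I \<Longrightarrow> X i \<in> sets M"
  shows "emeasure M (\<Union>i\<in>I. X i) \<le> (\<integral>\<^sup>+i. emeasure M (X i) \<partial>count_space I)"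
proof -
  have [measurable]: "(\<Union>i\<in>I. X i) \<in> sets M"
    using assms by auto
  have "emeasure M (\<Union>i\<in>I. X i) = (\<integral>\<^sup>+x. indicator (\<Union>i\<in>I. X i) x \<partial>M)"
    by simp
  also have "\<dots> \<le> (\<integral>\<^sup>+x. \<integral>\<^sup>+i. indicator (X i) x \<partial>count_space I \<partial>M)"
  proof (intro nn_integral_mono)
    fix x
    show "indicator (\<Union>i\<in>I. X i) x \<le> (\<integral>\<^sup>+i. indicator (X i) x \<partial>count_space I)"
    proof (cases "x \<in> (\<Union>i\<in>I. X i)")
      case True
      then obtain j where j: "j \<in> I" "x \<in> X j" by auto
      have "(1::ennreal) = (\<integral>\<^sup>+i. indicator {j} i \<partial>count_space I)"
        using j by (simp add: one_ennreal_def)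
      also have "\<dots> \<le> (\<integral>\<^sup>+i. indicator (X i) x \<partial>count_space I)"
        using j by (intro nn_integral_mono) (auto simp: indicator_def)
      finally show ?thesis using True by simp
    qed simp
  qed
  also have "\<dots> = (\<integral>\<^sup>+i. \<integral>\<^sup>+x. indicator (X i) x \<partial>M \<partial>count_space I)"
    using assms by (intro nn_integral_count_space_nn_integral) auto
  also have "\<dots> = (\<integral>\<^sup>+i. emeasure M (X i) \<partial>count_space I)"
    using assms by (intro nn_integral_cong) auto
  finally show ?thesis .
qed

lemma set_nn_integral_disjoint_le:
  assumes "countable I" "disjoint_family_on X I" "\<And>i. i \<in> I \<Longrightarrow> X i \<in> sets M" "h \<in> borel_measurable M"
    "(\<Union>i\<in>I. X i) \<subseteq> A" "A \<in> sets M"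
  shows "(\<integral>\<^sup>+i. (\<integral>\<^sup>+x\<in>X i. h x \<partial>M) \<partial>count_space I) \<le> (\<integral>\<^sup>+x\<in>A. h x \<partial>M)"
proof -
  have "(\<integral>\<^sup>+i. (\<integral>\<^sup>+x\<in>X i. h x \<partial>M) \<partial>count_space I) = (\<integral>\<^sup>+i. emeasure (density M h) (X i) \<partial>count_space I)"
    using assms by (intro nn_integral_cong) (auto simp: emeasure_density)
  also have "\<dots> = emeasure (density M h) (\<Union>i\<in>I. X i)"
    using assms by (subst emeasure_UN_countable) auto
  also have "\<dots> \<le> emeasure (density M h) A"
    using assms by (intro emeasure_mono) auto
  finally show ?thesis
    using assms by (simp add: emeasure_density)
qed

section \<open>Averages over balls and the uncentred maximal function\<close>

lemma avg_mono: "(\<And>y. y \<in> ball x r \<Longrightarrow> g y \<le> h y) \<Longrightarrow> avg g x r \<le> avg h x r"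
  unfolding avg_def by (intro divide_right_mono_ennreal nn_integral_mono) (auto simp: indicator_def)

lemma avg_cong: "(\<And>y. y \<in> ball x r \<Longrightarrow> g y = h y) \<Longrightarrow> avg g x r = avg h x r"
  by (intro antisym avg_mono) auto

lemma avg_add:
  assumes [measurable]: "g \<in> borel_measurable lebesgue" "h \<in> borel_measurable lebesgue"
  shows "avg (\<lambda>y. g y + h y) x r = avg g x r + avg h x r"
proof -
  have "(\<integral>\<^sup>+y\<in>ball x r. g y + h y \<partial>lebesgue) = (\<integral>\<^sup>+y\<in>ball x r. g y \<partial>lebesgue) + (\<integral>\<^sup>+y\<in>ball x r. h y \<partial>lebesgue)"
    by (subst nn_integral_add[symmetric]) (auto simp: distrib_right)
  then show ?thesis
    unfolding avg_def by (simp add: add_divide_distrib_ennreal)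
qed

lemma avg_const: "0 < r \<Longrightarrow> avg (\<lambda>y. c) x r = c"
  unfolding avg_def
  by (subst nn_integral_cmult_indicator)
     (auto simp: emeasure_ball ennreal_mult_divide_eq ennreal_eq_0_iff not_le)

lemma avg_subset_le:
  assumes "ball x r \<subseteq> ball y s" "0 < r" "0 < s"
  shows "avg g x r \<le> ennreal ((s / r) ^ DIM('a)) * avg g (y::'a::euclidean_space) s"
proof -
  let ?k = "unit_ball_vol (real DIM('a))"
  have k: "0 < ?k" by simp
  have "(\<integral>\<^sup>+z\<in>ball x r. g z \<partial>lebesgue) \<le> (\<integral>\<^sup>+z\<in>ball y s. g z \<partial>lebesgue)"
    using assms by (intro nn_integral_mono) (auto simp: indicator_def)
  then have "avg g x r \<le> (\<integral>\<^sup>+z\<in>ball y s. g z \<partial>lebesgue) * ennreal (inverse (?k * r ^ DIM('a)))"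
    using assms k unfolding avg_def
    by (simp add: emeasure_ball divide_ennreal_def inverse_ennreal mult_right_mono)
  also have "inverse (?k * r ^ DIM('a)) = (s / r) ^ DIM('a) * inverse (?k * s ^ DIM('a))"
    using assms k by (simp add: field_simps)
  also have "ennreal \<dots> = ennreal ((s / r) ^ DIM('a)) * ennreal (inverse (?k * s ^ DIM('a)))"
    using assms k by (intro ennreal_mult) auto
  also have "ennreal (inverse (?k * s ^ DIM('a))) = inverse (emeasure lebesgue (ball y s))"
    using assms k by (subst inverse_ennreal[symmetric]) (auto simp: emeasure_ball)
  finally show ?thesis
    unfolding avg_def by (simp add: divide_ennreal_def ac_simps)
qed

lemma avg_le_hl: "0 < r \<Longrightarrow> x \<in> ball z r \<Longrightarrow> avg g z r \<le> hl g x"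
  unfolding hl_def by (intro SUP_upper2[of "(z, r)"]) auto

lemma hl_leI: "(\<And>z r. 0 < r \<Longrightarrow> x \<in> ball z r \<Longrightarrow> avg g z r \<le> c) \<Longrightarrow> hl g x \<le> c"
  unfolding hl_def by (intro SUP_least) auto

lemma hl_mono: "(\<And>y. g y \<le> h y) \<Longrightarrow> hl g x \<le> hl h x"
  by (rule hl_leI) (meson avg_le_hl avg_mono order_trans)

lemma hl_add_le:
  assumes "g \<in> borel_measurable lebesgue" "h \<in> borel_measurable lebesgue"
  shows "hl (\<lambda>y. g y + h y) x \<le> hl g x + hl h x"
  by (rule hl_leI) (simp add: avg_add[OF assms] add_mono avg_le_hl)

lemma hl_const: "hl (\<lambda>y. c) x = c"
  by (intro antisym hl_leI) (use avg_le_hl[of 1 x x "\<lambda>y. c"] in \<open>auto simp: avg_const\<close>)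

text \<open>Since the maximal function is uncentred, its superlevel sets are unions of open balls.
  This yields measurability, and it is already a cover to which Vitali's lemma applies.\<close>

lemma hl_greater_eq: "{x. c < hl g x} = (\<Union>(z, r)\<in>{(z, r). 0 < r \<and> c < avg g z r}. ball z r)"
  unfolding hl_def less_SUP_iff by (auto simp: case_prod_beta) (metis fst_conv snd_conv)+

lemma open_hl_greater: "open {x. c < hl g x}"
  unfolding hl_greater_eq by auto

lemma hl_measurable [measurable]: "hl g \<in> borel_measurable lebesgue"
proof -
  have "hl g \<in> borel_measurable borel"
    by (rule borel_measurableI_greater) (simp add: open_hl_greater borel_open)
  then show ?thesis
    by (simp add: measurable_completion)
qed

lemma eabs_maximal: "eabs (maximal f x) = hl (\<lambda>y. eabs (f y)) x"
  unfolding maximal_def eabs_def hl_def avg_def by simp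

lemma maximal_measurable: "maximal f \<in> borel_measurable lebesgue"
proof -
  have "maximal f = (\<lambda>x. enn2ereal (hl (\<lambda>y. eabs (f y)) x))"
    unfolding maximal_def hl_def avg_def by (simp add: fun_eq_iff)
  then show ?thesis by simp
qed

section \<open>Doubling and the weak type estimate\<close>

lemma muckenhouptD:
  assumes "muckenhoupt p C w"
  shows "weight w" "1 \<le> p" "0 < C"
    "0 < r \<Longrightarrow> g \<in> borel_measurable lebesgue \<Longrightarrow>
      epowr (avg g x r) p * emeasure (wm w) (ball x r) \<le> ennreal C * (\<integral>\<^sup>+y\<in>ball x r. epowr (g y) p \<partial>wm w)"
  using assms by (auto simp: muckenhoupt_def)

text \<open>The defining inequality tested with \<open>g = indicator E\<close>: a set filling a
  fixed proportion of a ball carries a fixed proportion of its weighted mass.\<close>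

lemma muckenhoupt_subset:
  assumes mu: "muckenhoupt p C w" and E [measurable]: "E \<in> sets lebesgue" "E \<subseteq> ball x r" and "0 < r"
  shows "epowr (emeasure lebesgue E / emeasure lebesgue (ball x r)) p * emeasure (wm w) (ball x r)
    \<le> ennreal C * emeasure (wm w) E"
proof -
  have p: "0 < p" using muckenhouptD(2)[OF mu] by simp
  have "avg (indicator E) x r = emeasure lebesgue E / emeasure lebesgue (ball x r)"
  proof -
    have "(\<integral>\<^sup>+y\<in>ball x r. indicator E y \<partial>lebesgue) = (\<integral>\<^sup>+y. indicator E y \<partial>lebesgue)"
      using E by (intro nn_integral_cong) (auto simp: indicator_def)
    then show ?thesis by (simp add: avg_def)
  qed
  moreover have "(\<integral>\<^sup>+y\<in>ball x r. epowr (indicator E y) p \<partial>wm w) = emeasure (wm w) E"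
  proof -
    have "(\<integral>\<^sup>+y\<in>ball x r. epowr (indicator E y) p \<partial>wm w) = (\<integral>\<^sup>+y. indicator E y \<partial>wm w)"
      using E p by (intro nn_integral_cong) (auto simp: indicator_def)
    then show ?thesis by simp
  qed
  ultimately show ?thesis
    using muckenhouptD(4)[OF mu \<open>0 < r\<close>, of "indicator E" x] by simp
qed

text \<open>\<open>muckenhoupt_subset\<close> with the small ball as \<open>E\<close>. The constant
  \<open>C\<close> appears once whatever the ratio \<open>s / r\<close> is; iterating a doubling
  inequality would produce powers of \<open>C\<close> and spoil the exponents in the dyadic
  sums.\<close>

lemma muckenhoupt_doubling:
  fixes x :: "'a::euclidean_space"
  assumes mu: "muckenhoupt p C w" and "ball x r \<subseteq> ball y s" "0 < r" "0 < s"
  shows "mass w y s \<le> C * (s / r) powr (real DIM('a) * p) * mass w x r"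
proof -
  note D = muckenhouptD[OF mu]
  let ?k = "unit_ball_vol (real DIM('a))"
  have k: "0 < ?k" "?k \<noteq> 0" by (simp_all add: less_imp_neq[symmetric])
  have "emeasure lebesgue (ball x r) / emeasure lebesgue (ball y s) = ennreal ((r / s) powr real DIM('a))"
    using assms k by (simp add: emeasure_ball divide_ennreal powr_realpow power_divide)
  then have "epowr (emeasure lebesgue (ball x r) / emeasure lebesgue (ball y s)) p =
      ennreal ((r / s) powr (real DIM('a) * p))"
    using D by (simp add: epowr_ennreal powr_powr)
  then have "ennreal ((r / s) powr (real DIM('a) * p)) * ennreal (mass w y s) \<le> ennreal C * ennreal (mass w x r)"
    using muckenhoupt_subset[OF mu _ assms(2,4)] D by (simp add: emeasure_wm_ball)
  then have "(r / s) powr (real DIM('a) * p) * mass w y s \<le> C * mass w x r"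
    using D by (simp add: mass_def ennreal_le_iff flip: ennreal_mult)
  then have "(s / r) powr (real DIM('a) * p) * ((r / s) powr (real DIM('a) * p) * mass w y s)
      \<le> (s / r) powr (real DIM('a) * p) * (C * mass w x r)"
    by (intro mult_left_mono) auto
  moreover have "(s / r) powr (real DIM('a) * p) * (r / s) powr (real DIM('a) * p) = 1"
    using assms by (simp flip: powr_mult)
  ultimately show ?thesis
    by (simp add: mult.assoc[symmetric]) (simp add: ac_simps)
qed

text \<open>Vitali's lemma selects disjoint balls on which the average exceeds \<open>t\<close>. One
  factor \<open>C\<close> and the power of 5 come from doubling of the enlarged balls, the other
  \<open>C\<close> from the defining inequality on each selected ball.\<close>

lemma muckenhoupt_weak_type:
  fixes w :: "'a::euclidean_space \<Rightarrow> real"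
  assumes mu: "muckenhoupt p C w" and g: "g \<in> borel_measurable lebesgue" and "0 < t"
  shows "ennreal (t powr p) * emeasure (wm w) {x. ennreal t < hl g x} \<le>
    ennreal (C * C * 5 powr (real DIM('a) * p)) * (\<integral>\<^sup>+y. epowr (g y) p \<partial>wm w)"
proof -
  note D = muckenhouptD[OF mu]
  let ?D = "C * 5 powr (real DIM('a) * p)"
  \<comment> \<open>The covering lemma asks for bounded radii, so the level set is exhausted by the
    increasing open sets \<open>S N\<close>.\<close>
  define K where "K N = {(z, r). 0 < r \<and> r \<le> real N \<and> ennreal t < avg g z r}" for N :: nat
  define S where "S N = (\<Union>(z, r)\<in>K N. ball z r)" for N
  have open_S: "open (S N)" for N
    unfolding S_def by auto
  have bound: "ennreal (t powr p) * emeasure (wm w) (S N) \<le> ennreal (C * ?D) * (\<integral>\<^sup>+y. epowr (g y) p \<partial>wm w)" for N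
  proof -
    obtain I where I: "countable I" "I \<subseteq> K N"
      "pairwise (\<lambda>i j. disjnt (ball (fst i) (snd i)) (ball (fst j) (snd j))) I"
      "S N \<subseteq> (\<Union>i\<in>I. ball (fst i) (5 * snd i))"
      by (rule Vitali_covering_lemma_balls[where S = "S N" and K = "K N" and a = fst and r = snd and B = "real N"])
         (auto simp: S_def K_def case_prod_beta)
    have disj: "disjoint_family_on (\<lambda>i. ball (fst i) (snd i)) I"
      using I(3) by (auto simp: disjoint_family_on_def pairwise_def disjnt_def)
    have "emeasure (wm w) (S N) \<le> emeasure (wm w) (\<Union>i\<in>I. ball (fst i) (5 * snd i))"
      using I(1,4) by (intro emeasure_mono) auto
    also have "\<dots> \<le> (\<integral>\<^sup>+i. emeasure (wm w) (ball (fst i) (5 * snd i)) \<partial>count_space I)"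
      using I(1) by (intro emeasure_UN_le_count_space) auto
    finally have "ennreal (t powr p) * emeasure (wm w) (S N)
        \<le> ennreal (t powr p) * (\<integral>\<^sup>+i. emeasure (wm w) (ball (fst i) (5 * snd i)) \<partial>count_space I)"
      by (intro mult_left_mono) auto
    also have "\<dots> = (\<integral>\<^sup>+i. ennreal (t powr p) * emeasure (wm w) (ball (fst i) (5 * snd i)) \<partial>count_space I)"
      by (simp add: nn_integral_cmult)
    also have "\<dots> \<le> (\<integral>\<^sup>+i. ennreal (C * ?D) * (\<integral>\<^sup>+y\<in>ball (fst i) (snd i). epowr (g y) p \<partial>wm w) \<partial>count_space I)"
    proof (intro nn_integral_mono, simp)
      fix i assume "i \<in> I"
      then obtain z r where i: "i = (z, r)" "0 < r" "ennreal t < avg g z r"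
        using I(2) by (auto simp: K_def)
      have "ball z r \<subseteq> ball z (5 * r)"
        using i by (intro subset_ball) auto
      then have "mass w z (5 * r) \<le> ?D * mass w z r"
        using muckenhoupt_doubling[OF mu, of z r z "5 * r"] i by auto
      then have "emeasure (wm w) (ball z (5 * r)) \<le> ennreal ?D * emeasure (wm w) (ball z r)"
        using D by (simp add: emeasure_wm_ball mass_def ennreal_leI flip: ennreal_mult)
      then have "ennreal (t powr p) * emeasure (wm w) (ball z (5 * r)) \<le>
          epowr (ennreal t) p * (ennreal ?D * emeasure (wm w) (ball z r))"
        using \<open>0 < t\<close> D by (simp add: epowr_ennreal mult_left_mono)
      also have "\<dots> \<le> epowr (avg g z r) p * (ennreal ?D * emeasure (wm w) (ball z r))"
        using i D by (intro mult_right_mono epowr_mono) auto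
      also have "\<dots> = ennreal ?D * (epowr (avg g z r) p * emeasure (wm w) (ball z r))"
        by (simp add: ac_simps)
      also have "\<dots> \<le> ennreal ?D * (ennreal C * (\<integral>\<^sup>+y\<in>ball z r. epowr (g y) p \<partial>wm w))"
        using i g by (intro mult_left_mono D) auto
      also have "\<dots> = ennreal (C * ?D) * (\<integral>\<^sup>+y\<in>ball z r. epowr (g y) p \<partial>wm w)"
        using D by (simp add: ennreal_mult ac_simps)
      finally show "ennreal (t powr p) * emeasure (wm w) (ball (fst i) (5 * snd i)) \<le>
         ennreal (C * ?D) * (\<integral>\<^sup>+y\<in>ball (fst i) (snd i). epowr (g y) p \<partial>wm w)"
        using i by simp
    qed
    also have "\<dots> = ennreal (C * ?D) * (\<integral>\<^sup>+i. (\<integral>\<^sup>+y\<in>ball (fst i) (snd i). epowr (g y) p \<partial>wm w) \<partial>count_space I)"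
      by (simp add: nn_integral_cmult)
    also have "\<dots> \<le> ennreal (C * ?D) * (\<integral>\<^sup>+y\<in>UNIV. epowr (g y) p \<partial>wm w)"
      using I(1) disj g by (intro mult_left_mono set_nn_integral_disjoint_le) auto
    finally show ?thesis by simp
  qed
  have "{x. ennreal t < hl g x} = (\<Union>N. S N)"
    unfolding hl_greater_eq S_def K_def by auto (metis real_arch_simple)
  moreover have "incseq S"
    unfolding incseq_def S_def by (intro allI impI UN_mono) (auto simp: K_def)
  ultimately have "emeasure (wm w) {x. ennreal t < hl g x} = (SUP N. emeasure (wm w) (S N))"
    using open_S by (subst SUP_emeasure_incseq) auto
  then have "ennreal (t powr p) * emeasure (wm w) {x. ennreal t < hl g x} =
      (SUP N. ennreal (t powr p) * emeasure (wm w) (S N))"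
    by (simp add: SUP_mult_left_ennreal)
  also have "\<dots> \<le> ennreal (C * ?D) * (\<integral>\<^sup>+y. epowr (g y) p \<partial>wm w)"
    using bound by (intro SUP_least) auto
  finally show ?thesis by (simp add: mult.assoc)
qed

section \<open>The reverse Hoelder inequality\<close>

lemma mass_nonneg [simp]: "0 \<le> mass w x r"
  by (simp add: mass_def)

text \<open>
  This replaces Lebesgue's differentiation theorem: cover \<open>E\<close> by disjoint small balls inside an open
  set of almost the same measure.
\<close>
lemma negligible_greater_of_ball_averages_le:
  fixes w :: "'a::euclidean_space \<Rightarrow> real"
  assumes w: "weight w" and E [measurable]: "E \<in> sets lebesgue" and fin: "emeasure lebesgue E < top"
    and "0 < d" "0 \<le> t" and gt: "\<And>x. x \<in> E \<Longrightarrow> t < w x"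
    and le: "\<And>x s. x \<in> E \<Longrightarrow> 0 < s \<Longrightarrow> s < d \<Longrightarrow>
      emeasure (wm w) (ball x s) \<le> ennreal t * emeasure lebesgue (ball x s)"
  shows "emeasure lebesgue E = 0"
proof -
  have [measurable]: "w \<in> borel_measurable lebesgue"
    using w by (simp add: weight_def)
  have outer: "emeasure (wm w) E \<le> ennreal t * emeasure lebesgue U" if U: "open U" "E \<subseteq> U" for U
  proof -
    define K where "K = {(x, s). x \<in> E \<and> 0 < s \<and> s < d \<and> ball x s \<subseteq> U}"
    have "\<exists>i. i \<in> K \<and> x \<in> ball (fst i) (snd i) \<and> snd i < e" if xe: "x \<in> E" "0 < e" for x e
    proof -
      obtain s where "0 < s" "ball x s \<subseteq> U"
        using openE[OF U(1), of x] subsetD[OF U(2) xe(1)] by metis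
      moreover define u where "u = min s (min (d / 2) (e / 2))"
      moreover have "ball x u \<subseteq> ball x s"
        by (intro subset_ball) (simp add: u_def)
      ultimately have "(x, u) \<in> K" "0 < u" "u < e"
        using xe \<open>0 < d\<close> by (auto simp: K_def u_def)
      then show ?thesis
        by (intro exI[of _ "(x, u)"]) simp
    qed
    then obtain I where I: "countable I" "I \<subseteq> K"
      "pairwise (\<lambda>i j. disjnt (ball (fst i) (snd i)) (ball (fst j) (snd j))) I"
      "negligible (E - (\<Union>i\<in>I. ball (fst i) (snd i)))"
      by (rule Vitali_covering_theorem_balls[where S = E and K = K and a = fst and r = snd])
    have disj: "disjoint_family_on (\<lambda>i. ball (fst i) (snd i)) I"
      using I(3) by (auto simp: disjoint_family_on_def pairwise_def disjnt_def)
    let ?V = "\<Union>i\<in>I. ball (fst i) (snd i)"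
    have [measurable]: "?V \<in> sets lebesgue"
      using I(1) by auto
    have "emeasure lebesgue (E - ?V) = 0"
      using I(4) by (simp add: negligible_iff_emeasure0)
    then have "emeasure (wm w) (E - ?V) = 0"
      using weight_null_iff[OF w, of "E - ?V"] by simp
    moreover have "emeasure (wm w) E \<le> emeasure (wm w) (E - ?V) + emeasure (wm w) ?V"
      by (rule order_trans[OF emeasure_mono emeasure_subadditive]) auto
    ultimately have "emeasure (wm w) E \<le> emeasure (wm w) ?V"
      by simp
    also have "\<dots> \<le> (\<integral>\<^sup>+i. emeasure (wm w) (ball (fst i) (snd i)) \<partial>count_space I)"
      using I(1) by (intro emeasure_UN_le_count_space) auto
    also have "\<dots> \<le> (\<integral>\<^sup>+i. ennreal t * emeasure lebesgue (ball (fst i) (snd i)) \<partial>count_space I)"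
      using I(2) le by (intro nn_integral_mono) (auto simp: K_def)
    also have "\<dots> = ennreal t * emeasure lebesgue ?V"
      using I(1) disj by (subst emeasure_UN_countable) (auto simp: nn_integral_cmult)
    also have "\<dots> \<le> ennreal t * emeasure lebesgue U"
      using I(2) U by (intro mult_left_mono emeasure_mono) (fastforce simp: K_def)+
    finally show ?thesis .
  qed
  have "emeasure (wm w) E \<le> ennreal t * emeasure lebesgue E + ennreal (t * e)" if "0 < e" for e
  proof -
    obtain U where U: "open U" "E \<subseteq> U" "emeasure lebesgue (U - E) < ennreal e"
      using sets_lebesgue_outer_open[OF E \<open>0 < e\<close>] by metis
    have "emeasure lebesgue U = emeasure lebesgue E + emeasure lebesgue (U - E)"
    proof -
      have "U \<in> sets lebesgue" using U by auto
      then have "emeasure lebesgue (E \<union> (U - E)) = emeasure lebesgue E + emeasure lebesgue (U - E)"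
        by (intro plus_emeasure[symmetric]) auto
      then show ?thesis using U by (simp add: Un_absorb1 Un_commute)
    qed
    also have "\<dots> \<le> emeasure lebesgue E + ennreal e"
      using U by (intro add_left_mono) auto
    finally have "ennreal t * emeasure lebesgue U \<le> ennreal t * (emeasure lebesgue E + ennreal e)"
      by (rule mult_left_mono) auto
    then show ?thesis
      using outer[OF U(1,2)] \<open>0 \<le> t\<close> \<open>0 < e\<close> by (auto simp: distrib_left ennreal_mult)
  qed
  moreover have "\<exists>e>0. ennreal (t * e) \<le> ennreal e'" if "0 < e'" for e'
    using that \<open>0 \<le> t\<close> by (intro exI[of _ "e' / (t + 1)"]) (auto intro!: ennreal_leI simp: field_simps)
  ultimately have eps: "emeasure (wm w) E \<le> ennreal t * emeasure lebesgue E + ennreal e'" if "0 < e'" for e'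
    using that by (meson add_left_mono order_trans)
  have *: "emeasure (wm w) E \<le> ennreal t * emeasure lebesgue E"
    by (rule ennreal_le_epsilon) (rule eps)
  \<comment> \<open>On \<open>E\<close> write \<open>w = (w - t) + t\<close>. The second part has a
    finite integral and cancels against the bound just obtained, so \<open>w - t\<close>, which is
    positive on \<open>E\<close>, integrates to 0.\<close>
  have "emeasure (wm w) E = (\<integral>\<^sup>+x. ennreal (w x - t) * indicator E x + ennreal t * indicator E x \<partial>lebesgue)"
  proof -
    have "emeasure (wm w) E = (\<integral>\<^sup>+x. ennreal (w x) * indicator E x \<partial>lebesgue)"
      by (simp add: wm_def emeasure_density)
    also have "\<dots> = (\<integral>\<^sup>+x. ennreal (w x - t) * indicator E x + ennreal t * indicator E x \<partial>lebesgue)"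
      using gt \<open>0 \<le> t\<close>
      by (intro nn_integral_cong) (auto simp: indicator_def less_imp_le simp flip: ennreal_plus)
    finally show ?thesis .
  qed
  also have "\<dots> = (\<integral>\<^sup>+x. ennreal (w x - t) * indicator E x \<partial>lebesgue) + ennreal t * emeasure lebesgue E"
    by (simp add: nn_integral_add nn_integral_cmult)
  finally have "(\<integral>\<^sup>+x. ennreal (w x - t) * indicator E x \<partial>lebesgue) + ennreal t * emeasure lebesgue E
      \<le> 0 + ennreal t * emeasure lebesgue E"
    using * by simp
  then have "(\<integral>\<^sup>+x. ennreal (w x - t) * indicator E x \<partial>lebesgue) = 0"
    using fin by (subst (asm) (1 2) add.commute, subst (asm) ennreal_add_left_cancel_le) (auto simp: ennreal_mult_eq_top_iff less_top)
  then have "AE x in lebesgue. ennreal (w x - t) * indicator E x = 0"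
    by (subst (asm) nn_integral_0_iff_AE) auto
  then have "AE x in lebesgue. x \<notin> E"
    by eventually_elim (use gt in \<open>fastforce simp: indicator_def ennreal_eq_0_iff split: if_splits\<close>)
  then show ?thesis
    by (subst (asm) AE_iff_measurable[of E]) auto
qed

text \<open>Doubling for a ball and itself. It gives \<open>b \<le> 1\<close> and
  \<open>B \<ge> 1\<close> in the reverse Hoelder argument.\<close>

lemma muckenhoupt_const_ge_1:
  assumes mu: "muckenhoupt p C w"
  shows "1 \<le> C"
  using muckenhoupt_doubling[OF mu subset_refl, of 1 undefined] mass_pos[OF muckenhouptD(1)[OF mu], of 1 undefined]
  by (simp add: field_simps)

lemma set_nn_integral_le_cmult_emeasure:
  assumes [measurable]: "E \<in> sets M" and "\<And>x. x \<in> E \<Longrightarrow> h x \<le> c"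
  shows "(\<integral>\<^sup>+x\<in>E. h x \<partial>M) \<le> c * emeasure M E"
proof -
  have "(\<integral>\<^sup>+x\<in>E. h x \<partial>M) \<le> (\<integral>\<^sup>+x. c * indicator E x \<partial>M)"
    using assms(2) by (intro nn_integral_mono) (auto simp: indicator_def)
  then show ?thesis by (simp add: nn_integral_cmult_indicator)
qed

text \<open>The part \<open>E\<close> where \<open>w \<le> b * t\<close> carries at most the
  proportion \<open>b\<close> of the weighted mass, hence by \<open>muckenhoupt_subset\<close> it
  fills a proportion of the ball whose \<open>p\<close>-th power is at most \<open>C * b\<close>.
  The choice \<open>b = 1 / (C * 2 powr p)\<close> makes this proportion at most one half.\<close>

lemma muckenhoupt_large_part:
  fixes w :: "'a::euclidean_space \<Rightarrow> real"
  assumes mu: "muckenhoupt p C w" and "0 < s" "0 < t"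
    and t: "ennreal t * emeasure lebesgue (ball z s) \<le> emeasure (wm w) (ball z s)"
  shows "emeasure lebesgue (ball z s) \<le> 2 * emeasure lebesgue {y \<in> ball z s. t / (C * 2 powr p) < w y}"
proof -
  note D = muckenhouptD[OF mu]
  have [measurable]: "w \<in> borel_measurable lebesgue"
    using D by (simp add: weight_def)
  define b where "b = 1 / (C * 2 powr p)"
  have b: "0 < b" "C * b = (1 / 2) powr p"
    using D by (auto simp: b_def powr_divide field_simps)
  let ?B = "ball z s"
  define E where "E = {y \<in> ?B. w y \<le> b * t}"
  define G where "G = {y \<in> ?B. b * t < w y}"
  have [measurable]: "E \<in> sets lebesgue" "G \<in> sets lebesgue"
    unfolding E_def G_def by measurable
  obtain v where v: "emeasure lebesgue ?B = ennreal v" "0 < v"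
    using \<open>0 < s\<close> by (simp add: emeasure_ball)
  have B: "emeasure lebesgue ?B = emeasure lebesgue E + emeasure lebesgue G"
  proof -
    have "?B = E \<union> G" "E \<inter> G = {}" by (auto simp: E_def G_def)
    then show ?thesis
      using plus_emeasure[of E lebesgue G] \<open>E \<in> sets lebesgue\<close> \<open>G \<in> sets lebesgue\<close> by metis
  qed
  then obtain e where e: "emeasure lebesgue E = ennreal e" "0 \<le> e"
    using v by (cases "emeasure lebesgue E") (auto simp: top_add)
  have "emeasure (wm w) E = (\<integral>\<^sup>+y\<in>E. ennreal (w y) \<partial>lebesgue)"
    by (simp add: wm_def emeasure_density)
  also have "\<dots> \<le> ennreal (b * t) * emeasure lebesgue E"
    by (rule set_nn_integral_le_cmult_emeasure[OF \<open>E \<in> sets lebesgue\<close>]) (auto simp: E_def intro: ennreal_leI)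
  also have "\<dots> \<le> ennreal (b * t) * emeasure lebesgue ?B"
  proof (intro mult_left_mono emeasure_mono)
    show "E \<subseteq> ?B" by (auto simp: E_def)
  qed auto
  also have "\<dots> = ennreal b * (ennreal t * emeasure lebesgue ?B)"
    using b \<open>0 < t\<close> by (simp add: ennreal_mult mult.assoc)
  also have "\<dots> \<le> ennreal b * emeasure (wm w) ?B"
    using t by (intro mult_left_mono) auto
  finally have wE: "emeasure (wm w) E \<le> ennreal b * emeasure (wm w) ?B" .
  have "epowr (emeasure lebesgue E / emeasure lebesgue ?B) p * emeasure (wm w) ?B \<le> ennreal C * emeasure (wm w) E"
    using \<open>0 < s\<close> by (intro muckenhoupt_subset[OF mu \<open>E \<in> sets lebesgue\<close>]) (auto simp: E_def)
  also have "\<dots> \<le> ennreal C * (ennreal b * emeasure (wm w) ?B)"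
    using wE by (intro mult_left_mono) auto
  also have "emeasure (wm w) ?B = ennreal (mass w z s)"
    using D by (simp add: emeasure_wm_ball)
  finally have "(e / v) powr p * mass w z s \<le> C * b * mass w z s"
    using e v D b(1) by (simp add: divide_ennreal epowr_ennreal ennreal_le_iff mult.assoc flip: ennreal_mult)
  then have "(e / v) powr p \<le> (1 / 2) powr p"
    using mass_pos[OF D(1) \<open>0 < s\<close>, of z] b by simp
  then have "e / v \<le> 1 / 2"
    using D e v powr_less_mono2[of p "1/2" "e / v"] by (cases "e / v \<le> 1 / 2") auto
  then have "2 * e \<le> v"
    using v by (simp add: field_simps)
  moreover obtain g where g: "emeasure lebesgue G = ennreal g" "0 \<le> g"
    using B v by (cases "emeasure lebesgue G") (auto simp: add_top)
  moreover have "v = e + g"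
    using B e g v by (simp flip: ennreal_plus)
  ultimately have "v \<le> 2 * g"
    by simp
  then have "emeasure lebesgue ?B \<le> 2 * emeasure lebesgue G"
    unfolding v g using ennreal_leI[of v "2 * g"] g by (simp add: ennreal_mult)
  moreover have "G = {y \<in> ?B. t / (C * 2 powr p) < w y}"
    by (simp add: G_def b_def)
  ultimately show ?thesis
    by (simp only:)
qed

text \<open>
  A stopping-time argument with balls: the points where \<open>w > t\<close> are covered by balls with average of \<open>w\<close>
  about \<open>t\<close>, and \<open>w\<close> is at least of order \<open>t\<close> on half of each such ball.
\<close>
lemma muckenhoupt_level_set:
  fixes w :: "'a::euclidean_space \<Rightarrow> real" and x0 :: 'a
  assumes mu: "muckenhoupt p C w" and "0 < r"
    and t: "C * 6 powr (real DIM('a) * p) * mass w x0 r / (unit_ball_vol (real DIM('a)) * r ^ DIM('a)) \<le> t"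
  shows "emeasure (wm w) {x \<in> ball x0 r. t < w x} \<le>
    ennreal (2 * 5 ^ DIM('a) * t) * emeasure lebesgue {x \<in> ball x0 (2 * r). t / (C * 2 powr p) < w x}"
proof -
  note D = muckenhouptD[OF mu]
  let ?k = "unit_ball_vol (real DIM('a))"
  let ?n = "DIM('a)"
  have k: "0 < ?k" "?k \<noteq> 0" by (simp_all add: less_imp_neq[symmetric])
  have [measurable]: "w \<in> borel_measurable lebesgue"
    using D by (simp add: weight_def)
  have t0: "0 < t"
    using mass_pos[OF D(1) \<open>0 < r\<close>, of x0] D k \<open>0 < r\<close> by (intro less_le_trans[OF _ t]) auto
  \<comment> \<open>Stopping condition: the average of \<open>w\<close> exceeds \<open>t\<close> on
    the ball, but not on its fivefold enlargement. The first half makes \<open>w\<close> large on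
    half of the ball, the second bounds the mass of the enlargements that Vitali's lemma
    produces.\<close>
  define K where "K = {(z, s). z \<in> ball x0 r \<and> 0 < s \<and> s < r \<and> t * (?k * s ^ ?n) < mass w z s \<and>
    mass w z (5 * s) \<le> t * (?k * (5 * s) ^ ?n)}"
  define U where "U = (\<Union>(z, s)\<in>K. ball z s)"
  have "open U" unfolding U_def by auto
  then have [measurable]: "U \<in> sets lebesgue" by auto
  define E where "E = {x \<in> ball x0 r. t < w x} - U"
  have [measurable]: "E \<in> sets lebesgue" unfolding E_def by measurable
  have small: "mass w x s \<le> t * (?k * s ^ ?n)" if x: "x \<in> E" and s: "0 < s" "s < r" for x s
  proof (rule ccontr)
    assume "\<not> mass w x s \<le> t * (?k * s ^ ?n)"
    \<comment> \<open>\<open>P j\<close> says that the average over the ball of radius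
      \<open>5 ^ j * s\<close> is at most \<open>t\<close>. It fails for \<open>j = 0\<close> and
      holds for \<open>J\<close>, the first index with radius beyond \<open>r\<close>: that radius
      is at most \<open>5 * r\<close>, so the ball lies in \<open>ball x0 (6 * r)\<close>, whence
      the 6 in the assumption on \<open>t\<close>. The index before the least \<open>j\<close> with
      \<open>P j\<close> gives a ball of \<open>K\<close> around \<open>x\<close>.\<close>
    define P where "P j \<longleftrightarrow> mass w x (5 ^ j * s) \<le> t * (?k * (5 ^ j * s) ^ ?n)" for j :: nat
    have "\<exists>j. r / s < 5 ^ j"
      by (rule real_arch_pow) simp
    define J where "J = (LEAST j. r / s < (5::real) ^ j)"
    have J: "r / s < 5 ^ J"
      unfolding J_def using \<open>\<exists>j. r / s < 5 ^ j\<close> by (rule LeastI_ex)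
    have "J \<noteq> 0" using J s by (intro notI) (auto simp: field_simps)
    then obtain J' where J': "J = Suc J'" by (cases J) auto
    have J'': "5 ^ J' \<le> r / s"
      using not_less_Least[of J' "\<lambda>j. r / s < (5::real) ^ j"] J' by (auto simp: J_def)
    have rJ: "r \<le> 5 ^ J * s" "5 ^ J * s \<le> 5 * r" "5 ^ J' * s \<le> r"
      using J J'' s J' by (auto simp: field_simps)
    have PJ: "P J"
    proof -
      have "ball x (5 ^ J * s) \<subseteq> ball x0 (6 * r)"
        using x rJ by (subst ball_subset_ball_iff) (auto simp: E_def dist_commute)
      then have "mass w x (5 ^ J * s) \<le> mass w x0 (6 * r)"
        by (rule mass_mono[OF D(1)])
      also have "\<dots> \<le> C * 6 powr (real ?n * p) * mass w x0 r"
        using muckenhoupt_doubling[OF mu, of x0 r x0 "6 * r"] \<open>0 < r\<close> by (simp add: subset_ball)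
      also have "\<dots> \<le> t * (?k * r ^ ?n)"
        using t k \<open>0 < r\<close> by (simp add: field_simps)
      also have "\<dots> \<le> t * (?k * (5 ^ J * s) ^ ?n)"
        using rJ t0 k \<open>0 < r\<close> by (intro mult_left_mono power_mono) auto
      finally show ?thesis unfolding P_def .
    qed
    define j where "j = (LEAST j. P j)"
    have Pj: "P j" unfolding j_def using PJ by (rule LeastI)
    have "j \<le> J" unfolding j_def using PJ by (rule Least_le)
    have "j \<noteq> 0"
      using Pj \<open>\<not> mass w x s \<le> t * (?k * s ^ ?n)\<close> by (intro notI) (simp add: P_def)
    then obtain i where i: "j = Suc i" by (cases j) auto
    have nPi: "\<not> P i"
      using not_less_Least[of i P] i by (auto simp: j_def)
    have lt: "5 ^ i * s < r"
    proof -
      have "5 ^ i * s \<le> 5 ^ J' * s"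
        using \<open>j \<le> J\<close> i J' s by (intro mult_right_mono power_increasing) auto
      then have "5 ^ i * s \<le> r" using rJ by simp
      \<comment> \<open>\<open>K\<close> wants radii strictly below \<open>r\<close>. In the
        borderline case the argument used for \<open>J\<close> applies to the radius
        \<open>r\<close> itself and contradicts the failure of \<open>P i\<close>.\<close>
      moreover have "5 ^ i * s \<noteq> r"
      proof
        assume eq: "5 ^ i * s = r"
        have "mass w x r \<le> t * (?k * r ^ ?n)"
        proof -
          have "ball x r \<subseteq> ball x0 (6 * r)"
            using x \<open>0 < r\<close> by (subst ball_subset_ball_iff) (auto simp: E_def dist_commute)
          then have "mass w x r \<le> mass w x0 (6 * r)"
            by (rule mass_mono[OF D(1)])
          also have "\<dots> \<le> C * 6 powr (real ?n * p) * mass w x0 r"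
            using muckenhoupt_doubling[OF mu, of x0 r x0 "6 * r"] \<open>0 < r\<close> by (simp add: subset_ball)
          also have "\<dots> \<le> t * (?k * r ^ ?n)"
            using t k \<open>0 < r\<close> by (simp add: field_simps)
          finally show ?thesis .
        qed
        then show False using nPi eq by (simp add: P_def)
      qed
      ultimately show ?thesis by simp
    qed
    have "(x, 5 ^ i * s) \<in> K"
      using x lt s nPi Pj i unfolding K_def P_def E_def by (auto simp: mult.assoc)
    moreover have "x \<in> ball x (5 ^ i * s)" using s by simp
    ultimately have "x \<in> U" unfolding U_def by blast
    then show False using x by (simp add: E_def)
  qed
  have "emeasure lebesgue E = 0"
  proof (rule negligible_greater_of_ball_averages_le[OF D(1) \<open>E \<in> sets lebesgue\<close> _ \<open>0 < r\<close> less_imp_le[OF t0]])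
    have "emeasure lebesgue E \<le> emeasure lebesgue (ball x0 r)"
      by (intro emeasure_mono) (auto simp: E_def)
    also have "\<dots> < top" using \<open>0 < r\<close> by (simp add: emeasure_ball)
    finally show "emeasure lebesgue E < top" .
    show "emeasure (wm w) (ball x s) \<le> ennreal t * emeasure lebesgue (ball x s)"
      if "x \<in> E" "0 < s" "s < r" for x s
      using small[OF that] that t0 k D(1)
      by (simp add: emeasure_wm_ball emeasure_ball ennreal_leI flip: ennreal_mult)
  qed (auto simp: E_def)
  then have "emeasure (wm w) E = 0"
    using weight_null_iff[OF D(1), of E] by simp
  moreover have "emeasure (wm w) {x \<in> ball x0 r. t < w x} \<le> emeasure (wm w) E + emeasure (wm w) U"
  proof -
    have "{x \<in> ball x0 r. t < w x} \<subseteq> E \<union> U" by (auto simp: E_def)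
    then have "emeasure (wm w) {x \<in> ball x0 r. t < w x} \<le> emeasure (wm w) (E \<union> U)"
      by (intro emeasure_mono) auto
    also have "\<dots> \<le> emeasure (wm w) E + emeasure (wm w) U"
      by (intro emeasure_subadditive) auto
    finally show ?thesis .
  qed
  ultimately have "emeasure (wm w) {x \<in> ball x0 r. t < w x} \<le> emeasure (wm w) U"
    by simp
  obtain I where I: "countable I" "I \<subseteq> K"
    "pairwise (\<lambda>i j. disjnt (ball (fst i) (snd i)) (ball (fst j) (snd j))) I"
    "U \<subseteq> (\<Union>i\<in>I. ball (fst i) (5 * snd i))"
    by (rule Vitali_covering_lemma_balls[where S = U and K = K and a = fst and r = snd and B = r])
       (auto simp: U_def K_def case_prod_beta)
  have disj: "disjoint_family_on (\<lambda>i. ball (fst i) (snd i)) I"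
    using I(3) by (auto simp: disjoint_family_on_def pairwise_def disjnt_def)
  define G where "G i = {y \<in> ball (fst i) (snd i). t / (C * 2 powr p) < w y}" for i :: "'a \<times> real"
  have [measurable]: "G i \<in> sets lebesgue" for i
    unfolding G_def by measurable
  note \<open>emeasure (wm w) {x \<in> ball x0 r. t < w x} \<le> emeasure (wm w) U\<close>
  also have "emeasure (wm w) U \<le> emeasure (wm w) (\<Union>i\<in>I. ball (fst i) (5 * snd i))"
    using I(1,4) by (intro emeasure_mono) auto
  also have "\<dots> \<le> (\<integral>\<^sup>+i. emeasure (wm w) (ball (fst i) (5 * snd i)) \<partial>count_space I)"
    using I(1) by (intro emeasure_UN_le_count_space) auto
  also have "\<dots> \<le> (\<integral>\<^sup>+i. ennreal (2 * 5 ^ ?n * t) * emeasure lebesgue (G i) \<partial>count_space I)"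
  proof (rule nn_integral_mono)
    fix i assume "i \<in> space (count_space I)"
    then obtain z s where i: "i = (z, s)" "z \<in> ball x0 r" "0 < s" "s < r" "t * (?k * s ^ ?n) < mass w z s"
      "mass w z (5 * s) \<le> t * (?k * (5 * s) ^ ?n)"
      using I(2) by (auto simp: K_def)
    have "emeasure (wm w) (ball z (5 * s)) \<le> ennreal (5 ^ ?n * t) * emeasure lebesgue (ball z s)"
      using i D t0 k by (simp add: emeasure_wm_ball emeasure_ball ennreal_leI power_mult_distrib ac_simps flip: ennreal_mult)
    also have "\<dots> \<le> ennreal (5 ^ ?n * t) * (2 * emeasure lebesgue (G i))"
      unfolding G_def i fst_conv snd_conv using i D t0 k
      by (intro mult_left_mono muckenhoupt_large_part[OF mu])
         (auto simp: emeasure_wm_ball emeasure_ball ennreal_leI simp flip: ennreal_mult)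
    also have "\<dots> = ennreal (2 * 5 ^ ?n * t) * emeasure lebesgue (G i)"
      using t0 by (simp add: ennreal_mult ac_simps)
    finally show "emeasure (wm w) (ball (fst i) (5 * snd i)) \<le> ennreal (2 * 5 ^ ?n * t) * emeasure lebesgue (G i)"
      using i by simp
  qed
  also have "\<dots> = ennreal (2 * 5 ^ ?n * t) * emeasure lebesgue (\<Union>i\<in>I. G i)"
  proof -
    have "disjoint_family_on G I"
      using disj unfolding disjoint_family_on_def G_def by blast
    then show ?thesis
      using I(1) by (subst emeasure_UN_countable) (auto simp: nn_integral_cmult)
  qed
  also have "\<dots> \<le> ennreal (2 * 5 ^ ?n * t) * emeasure lebesgue {x \<in> ball x0 (2 * r). t / (C * 2 powr p) < w x}"
  proof (intro mult_left_mono emeasure_mono)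
    show "(\<Union>i\<in>I. G i) \<subseteq> {x \<in> ball x0 (2 * r). t / (C * 2 powr p) < w x}"
    proof clarify
      fix y z s assume "(z, s) \<in> I" "y \<in> G (z, s)"
      then have "y \<in> ball z s" "t / (C * 2 powr p) < w y" "z \<in> ball x0 r" "s < r"
        using I(2) by (auto simp: G_def K_def)
      moreover have "dist x0 y \<le> dist x0 z + dist z y" by (rule dist_triangle)
      ultimately show "y \<in> ball x0 (2 * r) \<and> t / (C * 2 powr p) < w y" by auto
    qed
    show "{x \<in> ball x0 (2 * r). t / (C * 2 powr p) < w x} \<in> sets lebesgue"
      by measurable
  qed (rule zero_le)
  finally show ?thesis .
qed

text \<open>
  The truncation at \<open>m\<close> makes all terms finite. The coefficient of the integral over the doubled ball is
  small with \<open>\<epsilon>\<close>, so that the inequality can be iterated over the balls of radius \<open>2\<^sup>j r\<close>.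
\<close>
lemma truncated_power_step:
  fixes w :: "'a::euclidean_space \<Rightarrow> real" and x0 :: 'a and C p m \<epsilon> :: real
  defines "b \<equiv> 1 / (C * 2 powr p)"
    and "F \<equiv> \<lambda>r. \<integral>\<^sup>+y\<in>ball x0 r. epowr (min (ennreal (w y)) (ennreal m)) \<epsilon> \<partial>wm w"
  assumes mu: "muckenhoupt p C w" and "0 < r" and eps: "0 < \<epsilon>" "\<epsilon> \<le> 1" and "0 < m"
    and T: "C * 6 powr (real DIM('a) * p) * mass w x0 r / (unit_ball_vol (real DIM('a)) * r ^ DIM('a)) = T"
  shows "F r \<le> ennreal (T powr \<epsilon> * mass w x0 r) + ennreal (\<epsilon> * (2 * 5 ^ DIM('a) / b\<^sup>2)) * F (2 * r)"
proof -
  note D = muckenhouptD[OF mu]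
  let ?n = "DIM('a)"
  have [measurable]: "w \<in> borel_measurable lebesgue"
    using D by (simp add: weight_def)
  have [measurable]: "ball x0 r \<in> sets (wm w)" "ball x0 (2 * r) \<in> sets (wm w)" for r by simp_all
  have b: "0 < b" "b \<le> 1"
  proof -
    have "1 * 1 \<le> C * 2 powr p"
      using muckenhoupt_const_ge_1[OF mu] D(2) by (intro mult_mono) (auto simp: ge_one_powr_ge_zero)
    then show "0 < b" "b \<le> 1"
      using D(3) by (simp_all add: b_def)
  qed
  have T0: "0 < T"
    using mass_pos[OF D(1) \<open>0 < r\<close>, of x0] D(3) \<open>0 < r\<close> unfolding T[symmetric] by simp
  \<comment> \<open>The functions are chosen so that for \<open>0 < t < m\<close> their level sets
    are the two sets compared in \<open>muckenhoupt_level_set\<close>; for \<open>t \<ge> m\<close>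
    both are empty.\<close>
  define h where "h y = min (ennreal (w y)) (ennreal m) * indicator (ball x0 r) y" for y
  define k where "k y = min (ennreal (w y / b)) (ennreal m) * indicator (ball x0 (2 * r)) y" for y
  have [measurable]: "h \<in> borel_measurable lebesgue" "k \<in> borel_measurable lebesgue"
    unfolding h_def k_def by measurable
  let ?I = "\<integral>\<^sup>+y. epowr (k y) (1 + \<epsilon>) \<partial>lebesgue"
  have Fh: "F r = (\<integral>\<^sup>+y. epowr (h y) \<epsilon> \<partial>wm w)"
    unfolding F_def h_def using eps by (intro nn_integral_cong) (auto simp: indicator_def)
  have h_level: "{y. ennreal t < h y} = {y \<in> ball x0 r. t < w y \<and> t < m}" if "0 < t" for t
    using that by (auto simp: h_def ennreal_less_iff indicator_def)
  have k_level: "{y. ennreal t < k y} = {y \<in> ball x0 (2 * r). t / (C * 2 powr p) < w y \<and> t < m}" if "0 < t" for t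
    using that b D(3) by (auto simp: k_def b_def ennreal_less_iff indicator_def field_simps)
  have pt: "ennreal (t powr (\<epsilon> - 1)) * indicator {0<..} t * emeasure (wm w) {y. ennreal t < h y} \<le>
      ennreal (mass w x0 r) * (ennreal (t powr (\<epsilon> - 1)) * indicator {0<..<T} t) +
      ennreal (2 * 5 ^ ?n) * (ennreal (t powr ((1 + \<epsilon>) - 1)) * indicator {0<..} t * emeasure lebesgue {y. ennreal t < k y})"
    for t
  proof -
    \<comment> \<open>Below \<open>T\<close> the level set is bounded by the whole ball, which
      produces the term with \<open>T powr \<epsilon>\<close>. Above \<open>T\<close> the level set
      inequality supplies a factor \<open>t\<close>, which raises the exponent from \<epsilon> to
      \<open>1 + \<epsilon>\<close> while passing from weighted to Lebesgue measure.\<close>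
    consider "t \<le> 0" | "0 < t" "t < T" | "T \<le> t" "m \<le> t" | "T \<le> t" "t < m"
      by linarith
    then show ?thesis
    proof cases
      case 1 then show ?thesis by simp
    next
      case 2
      have "emeasure (wm w) {y. ennreal t < h y} \<le> emeasure (wm w) (ball x0 r)"
        by (intro emeasure_mono) (auto simp: h_def indicator_def split: if_splits)
      then have "ennreal (t powr (\<epsilon> - 1)) * emeasure (wm w) {y. ennreal t < h y} \<le>
          ennreal (mass w x0 r) * ennreal (t powr (\<epsilon> - 1))"
        using D(1) by (subst mult.commute) (simp add: emeasure_wm_ball mult_right_mono)
      then show ?thesis
        using 2 by (simp add: add_increasing2)
    next
      case 3
      then have "{y. ennreal t < h y} = {}"
        using h_level[of t] T0 by auto
      then show ?thesis by simp
    next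
      case 4
      then have t0: "0 < t" using T0 by simp
      have lev: "{y. ennreal t < h y} = {y \<in> ball x0 r. t < w y}"
        "{y. ennreal t < k y} = {y \<in> ball x0 (2 * r). t / (C * 2 powr p) < w y}"
        unfolding h_level[OF t0] k_level[OF t0] using 4 by auto
      have "emeasure (wm w) {y. ennreal t < h y} \<le> ennreal (2 * 5 ^ ?n * t) * emeasure lebesgue {y. ennreal t < k y}"
        unfolding lev using 4 T by (intro muckenhoupt_level_set[OF mu \<open>0 < r\<close>]) simp
      also have "ennreal (2 * 5 ^ ?n * t) = ennreal (2 * 5 ^ ?n) * ennreal t"
        using t0 by (intro ennreal_mult) auto
      finally have "ennreal (t powr (\<epsilon> - 1)) * emeasure (wm w) {y. ennreal t < h y} \<le>
          ennreal (t powr (\<epsilon> - 1)) * (ennreal (2 * 5 ^ ?n) * ennreal t * emeasure lebesgue {y. ennreal t < k y})"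
        by (rule mult_left_mono) simp
      also have "\<dots> = ennreal (2 * 5 ^ ?n) * ((ennreal t * ennreal (t powr (\<epsilon> - 1))) * emeasure lebesgue {y. ennreal t < k y})"
        by (simp only: ac_simps)
      also have "ennreal t * ennreal (t powr (\<epsilon> - 1)) = ennreal (t powr ((1 + \<epsilon>) - 1))"
        using t0 powr_mult_base[of t "\<epsilon> - 1"] by (simp flip: ennreal_mult)
      finally show ?thesis
        using t0 by (simp add: add_increasing)
    qed
  qed
  have "ennreal (1 / \<epsilon>) * F r =
      (\<integral>\<^sup>+t. ennreal (t powr (\<epsilon> - 1)) * indicator {0<..} t * emeasure (wm w) {y. ennreal t < h y} \<partial>lborel)"
    unfolding Fh using nn_integral_layer_cake[OF sigma_finite_wm[OF D(1)], of h \<epsilon>] eps by simp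
  also have "\<dots> \<le> (\<integral>\<^sup>+t. ennreal (mass w x0 r) * (ennreal (t powr (\<epsilon> - 1)) * indicator {0<..<T} t) +
      ennreal (2 * 5 ^ ?n) * (ennreal (t powr ((1 + \<epsilon>) - 1)) * indicator {0<..} t * emeasure lebesgue {y. ennreal t < k y}) \<partial>lborel)"
    by (intro nn_integral_mono pt)
  also have "\<dots> = ennreal (mass w x0 r) * ennreal (T powr \<epsilon> / \<epsilon>) +
      ennreal (2 * 5 ^ ?n) * (ennreal (1 / (1 + \<epsilon>)) * ?I)"
  proof -
    interpret sigma_finite_measure "lebesgue :: 'a measure" by (rule sigma_finite_lebesgue)
    have m1: "(\<lambda>t. emeasure lebesgue {y. ennreal t < k y}) \<in> borel_measurable borel"
    proof -
      have "(\<lambda>t. emeasure lebesgue (Pair t -` {z \<in> space (borel \<Otimes>\<^sub>M lebesgue). ennreal (fst z) < k (snd z)})) \<in> borel_measurable borel"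
        by (rule measurable_emeasure_Pair) measurable
      then show ?thesis by (simp add: space_pair_measure vimage_def)
    qed
    have "(\<integral>\<^sup>+t. ennreal (t powr (\<epsilon> - 1)) * indicator {0<..<T} t \<partial>lborel) = ennreal (T powr \<epsilon> / \<epsilon>)"
      using eps T0 by (intro nn_integral_powr_Ioo) auto
    moreover have "(\<integral>\<^sup>+t. ennreal (t powr ((1 + \<epsilon>) - 1)) * indicator {0<..} t * emeasure lebesgue {y. ennreal t < k y} \<partial>lborel) =
        ennreal (1 / (1 + \<epsilon>)) * ?I"
      using nn_integral_layer_cake[OF sigma_finite_lebesgue, of k "1 + \<epsilon>"] eps by simp
    ultimately show ?thesis
      using m1 by (subst nn_integral_add) (auto simp: nn_integral_cmult simp del: add_diff_cancel_left')
  qed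
  also have "?I \<le> ennreal (1 / b\<^sup>2) * F (2 * r)"
  proof -
    have "epowr (k y) (1 + \<epsilon>) \<le> ennreal (1 / b\<^sup>2) *
        (epowr (min (ennreal (w y)) (ennreal m)) \<epsilon> * ennreal (w y) * indicator (ball x0 (2 * r)) y)" for y
    proof (cases "0 < w y \<and> y \<in> ball x0 (2 * r)")
      case True
      let ?a = "min (w y / b) m" and ?c = "min (w y) m"
      have ac: "0 < ?a" "0 < ?c" using True b \<open>0 < m\<close> by auto
      \<comment> \<open>The truncation survives the rescaling because \<open>b \<le> 1\<close>. Of
        the power \<open>1 + \<epsilon>\<close>, the exponent 1 restores the density
        \<open>w / b\<close>, and the exponent \<epsilon> gives the truncated power again.\<close>
      have "m \<le> m / b"
        using b \<open>0 < m\<close> by (simp add: pos_le_divide_eq mult_left_le)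
      then have "?a \<le> ?c / b"
        by (cases "w y \<le> m") auto
      then have "?a powr \<epsilon> \<le> (?c / b) powr \<epsilon>"
        using ac eps by (intro powr_mono2) auto
      also have "\<dots> = ?c powr \<epsilon> * (1 / b) powr \<epsilon>"
        using ac b by (simp add: powr_divide)
      also have "\<dots> \<le> ?c powr \<epsilon> * (1 / b) powr 1"
        using b eps by (intro mult_left_mono powr_mono) auto
      finally have "?a powr \<epsilon> \<le> ?c powr \<epsilon> * (1 / b)"
        using b by simp
      moreover have "?a \<le> w y / b" by simp
      ultimately have "?a * ?a powr \<epsilon> \<le> (w y / b) * (?c powr \<epsilon> * (1 / b))"
        using ac True b by (intro mult_mono) auto
      also have "?a * ?a powr \<epsilon> = ?a powr (1 + \<epsilon>)"
        using ac by (simp add: powr_add)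
      finally have "?a powr (1 + \<epsilon>) \<le> 1 / b\<^sup>2 * (?c powr \<epsilon> * w y)"
        by (simp add: power2_eq_square ac_simps)
      then have "ennreal (?a powr (1 + \<epsilon>)) \<le> ennreal (1 / b\<^sup>2 * (?c powr \<epsilon> * w y))"
        by (rule ennreal_leI)
      also have "\<dots> = ennreal (1 / b\<^sup>2) * ennreal (?c powr \<epsilon> * w y)"
        using True by (intro ennreal_mult) auto
      also have "ennreal (?c powr \<epsilon> * w y) = ennreal (?c powr \<epsilon>) * ennreal (w y)"
        using True by (intro ennreal_mult) auto
      finally have "ennreal (?a powr (1 + \<epsilon>)) \<le> ennreal (1 / b\<^sup>2) * (ennreal (?c powr \<epsilon>) * ennreal (w y))" .
      moreover have "min (ennreal (w y / b)) (ennreal m) = ennreal ?a" "min (ennreal (w y)) (ennreal m) = ennreal ?c"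
        using True b \<open>0 < m\<close> by (auto simp: min_def ennreal_le_iff)
      ultimately show ?thesis
        using True ac eps by (simp add: k_def epowr_ennreal)
    next
      case False
      then have "k y = 0"
        using b by (auto simp: k_def ennreal_neg divide_nonpos_pos)
      then show ?thesis using eps by simp
    qed
    then have "?I \<le> (\<integral>\<^sup>+y. ennreal (1 / b\<^sup>2) *
        (epowr (min (ennreal (w y)) (ennreal m)) \<epsilon> * ennreal (w y) * indicator (ball x0 (2 * r)) y) \<partial>lebesgue)"
      by (intro nn_integral_mono)
    also have "\<dots> = ennreal (1 / b\<^sup>2) * F (2 * r)"
      unfolding F_def by (subst set_nn_integral_wm) (auto simp: nn_integral_cmult)
    finally show ?thesis .
  qed
  finally have "ennreal (1 / \<epsilon>) * F r \<le> ennreal (mass w x0 r) * ennreal (T powr \<epsilon> / \<epsilon>) +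
      ennreal (2 * 5 ^ ?n) * (ennreal (1 / (1 + \<epsilon>)) * (ennreal (1 / b\<^sup>2) * F (2 * r)))"
    by (simp add: mult_left_mono add_left_mono)
  also have "\<dots> \<le> ennreal (mass w x0 r) * ennreal (T powr \<epsilon> / \<epsilon>) +
      ennreal (2 * 5 ^ ?n) * (1 * (ennreal (1 / b\<^sup>2) * F (2 * r)))"
    using eps by (intro add_left_mono mult_left_mono mult_right_mono) (auto simp: ennreal_le_1)
  \<comment> \<open>Multiplication by \<epsilon> cancels the \<open>1 / \<epsilon>\<close> of the
    layer-cake formula and leaves \<epsilon> in front of the integral over the doubled ball.\<close>
  finally have "ennreal \<epsilon> * (ennreal (1 / \<epsilon>) * F r) \<le> ennreal \<epsilon> * (ennreal (mass w x0 r) * ennreal (T powr \<epsilon> / \<epsilon>) +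
      ennreal (2 * 5 ^ ?n) * (1 * (ennreal (1 / b\<^sup>2) * F (2 * r))))"
    by (rule mult_left_mono) simp
  also have "\<dots> = ennreal (\<epsilon> * (mass w x0 r * (T powr \<epsilon> / \<epsilon>))) + ennreal (\<epsilon> * (2 * 5 ^ ?n * (1 / b\<^sup>2))) * F (2 * r)"
  proof -
    have "ennreal (\<epsilon> * (2 * 5 ^ ?n * (1 / b\<^sup>2))) = ennreal \<epsilon> * (ennreal (2 * 5 ^ ?n) * ennreal (1 / b\<^sup>2))"
      "ennreal (\<epsilon> * (mass w x0 r * (T powr \<epsilon> / \<epsilon>))) = ennreal \<epsilon> * (ennreal (mass w x0 r) * ennreal (T powr \<epsilon> / \<epsilon>))"
      using eps by (metis ennreal_mult mult_nonneg_nonneg mass_nonneg powr_ge_zero zero_le_divide_iff zero_le_power2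
          zero_le_power zero_le_numeral zero_le_one less_imp_le)+
    then show ?thesis by (simp only: distrib_left mult_1 mult.assoc)
  qed
  also have "ennreal \<epsilon> * (ennreal (1 / \<epsilon>) * F r) = F r"
  proof -
    have "ennreal \<epsilon> * ennreal (1 / \<epsilon>) = 1"
      using eps by (simp flip: ennreal_mult)
    then show ?thesis by (simp only: mult.assoc[symmetric] mult_1)
  qed
  finally show ?thesis
    using eps by (simp add: ac_simps)
qed

text \<open>After \<open>j\<close> outward steps of \<open>truncated_power_step\<close>, the trivial
  bound \<open>m powr \<epsilon>\<close> for the truncated power survives only with the factor
  \<open>(1 / 2) ^ j\<close>. Letting \<open>j\<close> grow removes it, and monotone convergence
  then removes the truncation.\<close>

lemma muckenhoupt_reverse_Hoelder:
  fixes w :: "'a::euclidean_space \<Rightarrow> real"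
  assumes mu: "muckenhoupt p C w"
  obtains \<epsilon> K where "0 < \<epsilon>" "0 < K"
    "\<And>x r. 0 < r \<Longrightarrow> (\<integral>\<^sup>+y\<in>ball x r. ennreal (w y powr (1 + \<epsilon>)) \<partial>lebesgue) \<le>
      ennreal (K * (mass w x r / (unit_ball_vol (real DIM('a)) * r ^ DIM('a))) powr \<epsilon> * mass w x r)"
proof -
  note D = muckenhouptD[OF mu]
  have C1: "1 \<le> C" by (rule muckenhoupt_const_ge_1[OF mu])
  let ?n = "DIM('a)" let ?k = "unit_ball_vol (real DIM('a))"
  have k: "0 < ?k" by simp
  have [measurable]: "w \<in> borel_measurable lebesgue"
    using D by (simp add: weight_def)
  define b where "b = 1 / (C * 2 powr p)"
  define A where "A = C * 6 powr (real ?n * p)"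
  define B where "B = C * 2 powr (real ?n * p)"
  \<comment> \<open>Doubling the radius multiplies the mass by at most \<open>B\<close> and
    \<open>T powr \<epsilon>\<close> by at most \<open>B powr \<epsilon> \<le> B\<close>. The second
    entry of the minimum yields \<open>\<eta> * B\<^sup>2 \<le> 1 / 2\<close>, so each step halves
    the remainder and the coefficient 2 of \<open>T powr \<epsilon>\<close> reproduces
    itself.\<close>
  define \<epsilon> where "\<epsilon> = min 1 (b\<^sup>2 / (4 * 5 ^ ?n * B\<^sup>2))"
  define \<eta> where "\<eta> = \<epsilon> * (2 * 5 ^ ?n / b\<^sup>2)"
  have b: "0 < b" and A: "0 < A" using D by (simp_all add: b_def A_def)
  have B: "1 \<le> B"
  proof -
    have "1 * 1 \<le> C * 2 powr (real ?n * p)"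
      using C1 D(2) by (intro mult_mono) (auto simp: ge_one_powr_ge_zero)
    then show ?thesis by (simp add: B_def)
  qed
  have eps: "0 < \<epsilon>" "\<epsilon> \<le> 1"
    using b B by (auto simp: \<epsilon>_def)
  have eta: "0 \<le> \<eta>" "\<eta> * B\<^sup>2 \<le> 1 / 2"
  proof -
    show "0 \<le> \<eta>" using eps b by (simp add: \<eta>_def)
    have "\<epsilon> \<le> b\<^sup>2 / (4 * 5 ^ ?n * B\<^sup>2)" by (simp add: \<epsilon>_def)
    then have "\<epsilon> * (2 * 5 ^ ?n / b\<^sup>2) * B\<^sup>2 \<le> b\<^sup>2 / (4 * 5 ^ ?n * B\<^sup>2) * (2 * 5 ^ ?n / b\<^sup>2) * B\<^sup>2"
      by (intro mult_right_mono) auto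
    also have "\<dots> = 1 / 2" using b B by (simp add: field_simps)
    finally show "\<eta> * B\<^sup>2 \<le> 1 / 2" by (simp add: \<eta>_def)
  qed
  define T where "T x r = A * mass w x r / (?k * r ^ ?n)" for x :: 'a and r
  define F where "F m x r = (\<integral>\<^sup>+y\<in>ball x r. epowr (min (ennreal (w y)) (ennreal m)) \<epsilon> \<partial>wm w)" for m x r
  have dbl: "mass w x (2 * r) \<le> B * mass w x r" if "0 < r" for x r
    using muckenhoupt_doubling[OF mu, of x r x "2 * r"] that by (simp add: subset_ball B_def)
  have T0: "0 \<le> T x r" if "0 < r" for x r
    using A k that by (simp add: T_def)
  have Tdbl: "T x (2 * r) \<le> B * T x r" if "0 < r" for x r
  proof -
    have "A * mass w x (2 * r) \<le> A * (B * mass w x r)"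
      using dbl[OF that] A by (intro mult_left_mono) auto
    moreover have "?k * r ^ ?n \<le> ?k * (2 * r) ^ ?n"
      using that k by (intro mult_left_mono power_mono) auto
    ultimately have "A * mass w x (2 * r) / (?k * (2 * r) ^ ?n) \<le> A * (B * mass w x r) / (?k * r ^ ?n)"
      using that k A B by (intro frac_le) auto
    then show ?thesis by (simp add: T_def ac_simps)
  qed
  have iter: "F m x r \<le> ennreal ((2 * T x r powr \<epsilon> + (1 / 2) ^ j * m powr \<epsilon>) * mass w x r)"
    if "0 < m" "0 < r" for m x r j
    using that(2)
  proof (induction j arbitrary: r)
    case (0 r)
    have "F m x r \<le> ennreal (m powr \<epsilon>) * emeasure (wm w) (ball x r)"
      unfolding F_def
    proof (rule set_nn_integral_le_cmult_emeasure)
      fix y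
      have "epowr (min (ennreal (w y)) (ennreal m)) \<epsilon> \<le> epowr (ennreal m) \<epsilon>"
        using eps by (intro epowr_mono) auto
      then show "epowr (min (ennreal (w y)) (ennreal m)) \<epsilon> \<le> ennreal (m powr \<epsilon>)"
        using eps that by (simp add: epowr_ennreal)
    qed simp
    also have "\<dots> = ennreal (m powr \<epsilon> * mass w x r)"
      using D(1) by (simp add: emeasure_wm_ball ennreal_mult)
    also have "\<dots> \<le> ennreal ((2 * T x r powr \<epsilon> + (1 / 2) ^ 0 * m powr \<epsilon>) * mass w x r)"
      by (intro ennreal_leI mult_right_mono) auto
    finally show ?case .
  next
    case (Suc j r)
    let ?t = "T x r powr \<epsilon>" and ?M = "mass w x r" and ?h = "(1 / 2) ^ j * m powr \<epsilon>"
    have "F m x r \<le> ennreal (?t * ?M) + ennreal \<eta> * F m x (2 * r)"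
      unfolding F_def \<eta>_def b_def
      using that Suc.prems eps
      by (intro truncated_power_step[OF mu]) (auto simp: T_def A_def)
    also have "\<dots> \<le> ennreal (?t * ?M) + ennreal \<eta> *
        ennreal ((2 * T x (2 * r) powr \<epsilon> + ?h) * mass w x (2 * r))"
      using Suc.IH[of "2 * r"] Suc.prems by (intro add_left_mono mult_left_mono) auto
    also have "\<dots> = ennreal (?t * ?M + \<eta> * ((2 * T x (2 * r) powr \<epsilon> + ?h) * mass w x (2 * r)))"
      using eta by (simp flip: ennreal_mult ennreal_plus)
    also have "\<dots> \<le> ennreal ((2 * ?t + (1 / 2) ^ Suc j * m powr \<epsilon>) * ?M)"
    proof (rule ennreal_leI)
      have "T x (2 * r) powr \<epsilon> \<le> (B * T x r) powr \<epsilon>"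
        using Tdbl T0 Suc.prems eps by (intro powr_mono2) auto
      also have "\<dots> = B powr \<epsilon> * ?t"
        using B T0 Suc.prems by (simp add: powr_mult)
      also have "\<dots> \<le> B powr 1 * ?t"
        using B eps by (intro mult_right_mono powr_mono) auto
      finally have "T x (2 * r) powr \<epsilon> \<le> B * ?t"
        using B by simp
      moreover have "1 * ?h \<le> B * ?h"
        using B by (intro mult_right_mono) auto
      ultimately have "2 * T x (2 * r) powr \<epsilon> + ?h \<le> B * (2 * ?t) + B * ?h"
        by linarith
      then have "(2 * T x (2 * r) powr \<epsilon> + ?h) * mass w x (2 * r) \<le> (B * (2 * ?t) + B * ?h) * (B * ?M)"
        using dbl Suc.prems B by (intro mult_mono) auto
      then have "\<eta> * ((2 * T x (2 * r) powr \<epsilon> + ?h) * mass w x (2 * r)) \<le> \<eta> * ((B * (2 * ?t) + B * ?h) * (B * ?M))"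
        using eta by (intro mult_left_mono) auto
      also have "\<dots> = (\<eta> * B\<^sup>2) * ((2 * ?t + ?h) * ?M)"
        by (simp add: power2_eq_square algebra_simps)
      also have "\<dots> \<le> (1 / 2) * ((2 * ?t + ?h) * ?M)"
        using eta by (intro mult_right_mono) auto
      finally show "?t * ?M + \<eta> * ((2 * T x (2 * r) powr \<epsilon> + ?h) * mass w x (2 * r))
          \<le> (2 * ?t + (1 / 2) ^ Suc j * m powr \<epsilon>) * ?M"
        by (simp add: algebra_simps)
    qed
    finally show ?case .
  qed
  have trunc: "F m x r \<le> ennreal (2 * T x r powr \<epsilon> * mass w x r)" if "0 < m" "0 < r" for m x r
  proof (rule LIMSEQ_le_const)
    have "(\<lambda>j. (2 * T x r powr \<epsilon> + (1 / 2) ^ j * m powr \<epsilon>) * mass w x r) \<longlonglongrightarrow>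
        (2 * T x r powr \<epsilon> + 0 * m powr \<epsilon>) * mass w x r"
      by (intro tendsto_intros LIMSEQ_power_zero) auto
    then show "(\<lambda>j. ennreal ((2 * T x r powr \<epsilon> + (1 / 2) ^ j * m powr \<epsilon>) * mass w x r)) \<longlonglongrightarrow>
        ennreal (2 * T x r powr \<epsilon> * mass w x r)"
      by (simp add: tendsto_ennrealI)
    show "\<exists>N. \<forall>j\<ge>N. F m x r \<le> ennreal ((2 * T x r powr \<epsilon> + (1 / 2) ^ j * m powr \<epsilon>) * mass w x r)"
      using iter[OF that] by auto
  qed
  show ?thesis
  proof (rule that[OF eps(1), of "2 * A powr \<epsilon>"])
    show "0 < 2 * A powr \<epsilon>" using A by simp
    fix x :: 'a and r :: real assume r: "0 < r"
    let ?f = "\<lambda>m::nat. \<lambda>y. epowr (min (ennreal (w y)) (ennreal (real (Suc m)))) \<epsilon> * indicator (ball x r) y"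
    have "(\<integral>\<^sup>+y\<in>ball x r. epowr (ennreal (w y)) \<epsilon> \<partial>wm w) = (\<integral>\<^sup>+y. (SUP m. ?f m y) \<partial>wm w)"
    proof (intro nn_integral_cong antisym)
      fix y
      obtain m :: nat where "w y \<le> real (Suc m)"
        by (meson real_arch_simple le_SucI of_nat_le_iff order_trans less_imp_le lessI)
      then have "min (ennreal (w y)) (ennreal (real (Suc m))) = ennreal (w y)"
        by (intro min_absorb1 ennreal_leI)
      then show "epowr (ennreal (w y)) \<epsilon> * indicator (ball x r) y \<le> (SUP m. ?f m y)"
        by (intro SUP_upper2[of m]) auto
      show "(SUP m. ?f m y) \<le> epowr (ennreal (w y)) \<epsilon> * indicator (ball x r) y"
        using eps by (intro SUP_least mult_right_mono epowr_mono) auto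
    qed
    also have "\<dots> = (SUP m. \<integral>\<^sup>+y. ?f m y \<partial>wm w)"
    proof (rule nn_integral_monotone_convergence_SUP)
      show "incseq ?f"
        unfolding incseq_def le_fun_def using eps
        by (intro allI impI mult_right_mono epowr_mono min.mono ennreal_leI) auto
    qed auto
    also have "\<dots> \<le> ennreal (2 * T x r powr \<epsilon> * mass w x r)"
      using trunc[of "real (Suc _)" r x] r unfolding F_def by (intro SUP_least) auto
    also have "T x r powr \<epsilon> = A powr \<epsilon> * (mass w x r / (?k * r ^ ?n)) powr \<epsilon>"
      unfolding T_def using A k r by (subst powr_mult[symmetric]) auto
    finally have *: "(\<integral>\<^sup>+y\<in>ball x r. epowr (ennreal (w y)) \<epsilon> \<partial>wm w) \<le>
        ennreal (2 * A powr \<epsilon> * (mass w x r / (?k * r ^ ?n)) powr \<epsilon> * mass w x r)"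
      by (simp add: mult.assoc)
    have "AE y in lebesgue. 0 < w y"
      using D(1) by (simp add: weight_def)
    then have "AE y in lebesgue. ennreal (w y powr (1 + \<epsilon>)) = epowr (ennreal (w y)) \<epsilon> * ennreal (w y)"
      by eventually_elim (use eps in \<open>simp add: epowr_ennreal powr_add flip: ennreal_mult\<close>)
    then have "(\<integral>\<^sup>+y\<in>ball x r. ennreal (w y powr (1 + \<epsilon>)) \<partial>lebesgue) =
        (\<integral>\<^sup>+y\<in>ball x r. epowr (ennreal (w y)) \<epsilon> * ennreal (w y) \<partial>lebesgue)"
      by (intro nn_integral_cong_AE) (auto elim: eventually_mono)
    also have "\<dots> = (\<integral>\<^sup>+y\<in>ball x r. epowr (ennreal (w y)) \<epsilon> \<partial>wm w)"
      by (subst set_nn_integral_wm) auto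
    finally show "(\<integral>\<^sup>+y\<in>ball x r. ennreal (w y powr (1 + \<epsilon>)) \<partial>lebesgue) \<le>
      ennreal (2 * A powr \<epsilon> * (mass w x r / (?k * r ^ ?n)) powr \<epsilon> * mass w x r)"
      using * by simp
  qed
qed

section \<open>Strong type estimates and the classes \<open>A\<^sub>p\<close> and \<open>A\<^sub>1\<close>\<close>

text \<open>Marcinkiewicz interpolation between the weak type \<open>(q, q)\<close> and the trivial
  bound for bounded functions, by cutting \<open>g\<close> at a height proportional to
  \<open>t\<close>.\<close>

lemma muckenhoupt_strong_type:
  fixes w :: "'a::euclidean_space \<Rightarrow> real"
  assumes mu: "muckenhoupt q C w" and "q < p"
  obtains K where "0 < K" "\<And>g. g \<in> borel_measurable lebesgue \<Longrightarrow>
    (\<integral>\<^sup>+x. epowr (hl g x) p \<partial>wm w) \<le> ennreal K * (\<integral>\<^sup>+x. epowr (g x) p \<partial>wm w)"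
proof -
  note D = muckenhouptD[OF mu]
  define A where "A = C * C * 5 powr (real DIM('a) * q) * 2 powr q"
  define K where "K = p * A * (1 / (p - q)) * 2 powr (p - q)"
  have A: "0 < A" using D by (simp add: A_def)
  have pq: "0 < p" "0 < q" "0 < p - q" using D \<open>q < p\<close> by simp_all
  have K: "0 < K" using A pq by (simp add: K_def)
  interpret pair_sigma_finite "wm w" lborel
    using sigma_finite_wm[OF D(1)] by (simp add: pair_sigma_finite_def sigma_finite_lborel)
  have "(\<integral>\<^sup>+x. epowr (hl g x) p \<partial>wm w) \<le> ennreal K * (\<integral>\<^sup>+x. epowr (g x) p \<partial>wm w)"
    if g [measurable]: "g \<in> borel_measurable lebesgue" for g
  proof -
    let ?J = "\<lambda>t. \<integral>\<^sup>+x. epowr (g x) q * indicator {x. ennreal t < 2 * g x} x \<partial>wm w"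
    let ?k = "\<lambda>t x. ennreal (t powr ((p - q) - 1)) * indicator {t. 0 < t \<and> ennreal t < 2 * g x} t"
    have level: "emeasure (wm w) {x. ennreal t < hl g x} \<le>
        ennreal (A * t powr (- q)) * ?J t"
      if t: "0 < t" for t
    proof -
      \<comment> \<open>The part of \<open>g\<close> above \<open>t / 2\<close>. The rest has
        maximal function at most \<open>t / 2\<close>, so \<open>hl g x > t\<close> forces
        \<open>hl h x > t / 2\<close>.\<close>
      define h where "h x = g x * indicator {x. ennreal t < 2 * g x} x" for x
      have [measurable]: "h \<in> borel_measurable lebesgue" unfolding h_def by measurable
      have half: "ennreal t = 2 * ennreal (t / 2)"
        using t ennreal_mult[of 2 "t / 2"] by simp
      have "hl g x \<le> hl h x + ennreal (t / 2)" for x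
      proof -
        have "g y \<le> h y + ennreal (t / 2)" for y
        proof (cases "ennreal t < 2 * g y")
          case False
          then have "2 * g y \<le> 2 * ennreal (t / 2)" using half by (simp add: not_less)
          then have "g y \<le> ennreal (t / 2)"
            by (subst (asm) ennreal_mult_le_mult_iff) auto
          then show ?thesis by (simp add: add_increasing)
        qed (simp add: h_def)
        then have "hl g x \<le> hl (\<lambda>y. h y + ennreal (t / 2)) x"
          by (rule hl_mono)
        also have "\<dots> \<le> hl h x + hl (\<lambda>y. ennreal (t / 2)) x"
          by (rule hl_add_le) auto
        finally show ?thesis by (simp add: hl_const)
      qed
      then have le: "hl g x \<le> hl h x + ennreal (t / 2)" for x .
      have "ennreal t = ennreal (t / 2) + ennreal (t / 2)"
        using t by (simp flip: ennreal_plus)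
      then have "ennreal (t / 2) < hl h x" if "ennreal t < hl g x" for x
        using le[of x] that add_right_mono[of "hl h x" "ennreal (t / 2)" "ennreal (t / 2)"]
        by (metis leD leI order_trans)
      then have sub: "{x. ennreal t < hl g x} \<subseteq> {x. ennreal (t / 2) < hl h x}"
        by auto
      have "ennreal ((t / 2) powr q) * emeasure (wm w) {x. ennreal t < hl g x} \<le>
          ennreal ((t / 2) powr q) * emeasure (wm w) {x. ennreal (t / 2) < hl h x}"
        using sub open_hl_greater[of "ennreal (t / 2)" h] by (intro mult_left_mono emeasure_mono) auto
      also have "\<dots> \<le> ennreal (C * C * 5 powr (real DIM('a) * q)) * (\<integral>\<^sup>+x. epowr (h x) q \<partial>wm w)"
        using t by (intro muckenhoupt_weak_type[OF mu]) auto
      also have "(\<integral>\<^sup>+x. epowr (h x) q \<partial>wm w) = ?J t"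
        using pq by (intro nn_integral_cong) (auto simp: h_def indicator_def)
      finally have "ennreal ((t / 2) powr (- q)) * (ennreal ((t / 2) powr q) * emeasure (wm w) {x. ennreal t < hl g x}) \<le>
          ennreal ((t / 2) powr (- q)) * (ennreal (C * C * 5 powr (real DIM('a) * q)) *
            ?J t)"
        by (rule mult_left_mono) simp
      also have "\<dots> = ennreal (A * t powr (- q)) * ?J t"
      proof -
        have "(t / 2) powr (- q) * (C * C * 5 powr (real DIM('a) * q)) = A * t powr (- q)"
          using t by (simp add: A_def powr_divide powr_minus field_simps)
        then show ?thesis
          by (simp add: mult.assoc[symmetric] ennreal_mult'[symmetric])
      qed
      also have "ennreal ((t / 2) powr (- q)) * (ennreal ((t / 2) powr q) * emeasure (wm w) {x. ennreal t < hl g x}) =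
          emeasure (wm w) {x. ennreal t < hl g x}"
      proof -
        have "ennreal ((t / 2) powr (- q)) * ennreal ((t / 2) powr q) = 1"
          using t by (simp add: powr_minus flip: ennreal_mult)
        then show ?thesis by (simp only: mult.assoc[symmetric] mult_1)
      qed
      finally show ?thesis .
    qed
    have "ennreal (1 / p) * (\<integral>\<^sup>+x. epowr (hl g x) p \<partial>wm w) =
        (\<integral>\<^sup>+t. ennreal (t powr (p - 1)) * indicator {0<..} t * emeasure (wm w) {x. ennreal t < hl g x} \<partial>lborel)"
      using nn_integral_layer_cake[OF sigma_finite_wm[OF D(1)], of "hl g" p] pq by simp
    also have "\<dots> \<le> (\<integral>\<^sup>+t. \<integral>\<^sup>+x. ennreal A * (epowr (g x) q *
        ?k t x) \<partial>wm w \<partial>lborel)"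
    proof (intro nn_integral_mono)
      fix t :: real
      show "ennreal (t powr (p - 1)) * indicator {0<..} t * emeasure (wm w) {x. ennreal t < hl g x} \<le>
        (\<integral>\<^sup>+x. ennreal A * (epowr (g x) q * ?k t x) \<partial>wm w)"
      proof (cases "0 < t")
        case True
        have "ennreal (t powr (p - 1)) * emeasure (wm w) {x. ennreal t < hl g x} \<le> ennreal (t powr (p - 1)) *
           (ennreal (A * t powr (- q)) * ?J t)"
          using level[OF True] by (intro mult_left_mono) auto
        also have "\<dots> = ennreal (A * t powr ((p - q) - 1)) * ?J t"
        proof -
          have "t powr (p - 1) * (A * t powr (- q)) = A * t powr ((p - q) - 1)"
            using True by (simp add: powr_add[symmetric] mult.left_commute) (simp add: algebra_simps)
          then have "ennreal (A * t powr ((p - q) - 1)) = ennreal (t powr (p - 1)) * ennreal (A * t powr (- q))"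
            using ennreal_mult[of "t powr (p - 1)" "A * t powr (- q)"] A by (metis less_imp_le mult_nonneg_nonneg powr_ge_zero)
          then show ?thesis
            by (simp only: mult.assoc)
        qed
        also have "\<dots> = (\<integral>\<^sup>+x. ennreal (A * t powr ((p - q) - 1)) * (epowr (g x) q * indicator {x. ennreal t < 2 * g x} x) \<partial>wm w)"
          by (subst nn_integral_cmult) auto
        also have "\<dots> = (\<integral>\<^sup>+x. ennreal A * (epowr (g x) q * ?k t x) \<partial>wm w)"
          using True A by (intro nn_integral_cong) (auto simp: indicator_def ennreal_mult ac_simps)
        finally show ?thesis using True by simp
      qed simp
    qed
    \<comment> \<open>After the exchange the inner integral runs over
      \<open>0 < t < 2 * g x\<close>; it converges at 0 because \<open>q < p\<close>, and it
      restores the missing power \<open>p - q\<close> of \<open>g x\<close>.\<close>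
    also have "\<dots> = (\<integral>\<^sup>+x. \<integral>\<^sup>+t. ennreal A * (epowr (g x) q *
        ?k t x) \<partial>lborel \<partial>wm w)"
      by (intro Fubini') (simp add: indicator_def case_prod_beta)
    also have "\<dots> = (\<integral>\<^sup>+x. ennreal (A * (1 / (p - q)) * 2 powr (p - q)) * epowr (g x) p \<partial>wm w)"
    proof (intro nn_integral_cong)
      fix x
      have "(\<integral>\<^sup>+t. ennreal A * (epowr (g x) q * ?k t x) \<partial>lborel)
         = ennreal A * (epowr (g x) q * (ennreal (1 / (p - q)) * epowr (2 * g x) (p - q)))"
        using nn_integral_powr_less[OF pq(3), of "2 * g x"] by (subst nn_integral_cmult, simp)+ simp
      also have "epowr (2 * g x) (p - q) = ennreal (2 powr (p - q)) * epowr (g x) (p - q)"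
        using pq epowr_ennreal[of "p - q" 2] by (simp add: epowr_mult)
      also have "ennreal A * (epowr (g x) q * (ennreal (1 / (p - q)) * (ennreal (2 powr (p - q)) * epowr (g x) (p - q)))) =
        (ennreal A * ennreal (1 / (p - q)) * ennreal (2 powr (p - q))) * (epowr (g x) q * epowr (g x) (p - q))"
        by (simp only: ac_simps)
      also have "epowr (g x) q * epowr (g x) (p - q) = epowr (g x) p"
        using epowr_add[OF pq(2,3), of "g x"] by simp
      also have "ennreal A * ennreal (1 / (p - q)) * ennreal (2 powr (p - q)) = ennreal (A * (1 / (p - q)) * 2 powr (p - q))"
        using A pq by (simp flip: ennreal_mult)
      finally show "(\<integral>\<^sup>+t. ennreal A * (epowr (g x) q * ?k t x) \<partial>lborel)
         = ennreal (A * (1 / (p - q)) * 2 powr (p - q)) * epowr (g x) p" .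
    qed
    also have "\<dots> = ennreal (A * (1 / (p - q)) * 2 powr (p - q)) * (\<integral>\<^sup>+x. epowr (g x) p \<partial>wm w)"
      by (subst nn_integral_cmult) auto
    finally have "ennreal p * (ennreal (1 / p) * (\<integral>\<^sup>+x. epowr (hl g x) p \<partial>wm w)) \<le>
        ennreal p * (ennreal (A * (1 / (p - q)) * 2 powr (p - q)) * (\<integral>\<^sup>+x. epowr (g x) p \<partial>wm w))"
      by (rule mult_left_mono) simp
    moreover have "ennreal p * ennreal (1 / p) = 1"
      using pq by (simp flip: ennreal_mult)
    moreover have "ennreal p * ennreal (A * (1 / (p - q)) * 2 powr (p - q)) = ennreal K"
      using pq A by (simp add: K_def mult.assoc flip: ennreal_mult)
    ultimately show ?thesis
      by (simp only: mult.assoc[symmetric] mult_1)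
  qed
  with K show ?thesis using that by blast
qed

section \<open>Dual weights and lowering the exponent\<close>

lemma weightI:
  fixes s :: "'a::euclidean_space \<Rightarrow> real"
  assumes [measurable]: "s \<in> borel_measurable lebesgue" and nn: "\<And>y. 0 \<le> s y" and pos: "AE y in lebesgue. 0 < s y"
    and fin: "\<And>r. 0 < r \<Longrightarrow> (\<integral>\<^sup>+y\<in>ball 0 r. ennreal (s y) \<partial>lebesgue) < top"
  shows "weight s"
  unfolding weight_def
proof (intro conjI allI impI)
  fix K :: "'a set" assume K: "compact K"
  then obtain r where r: "0 < r" "K \<subseteq> ball 0 r"
    using bounded_subset_ballD[OF compact_imp_bounded, of K 0] by auto
  have [measurable]: "K \<in> sets lebesgue"
    using K by (simp add: compact_imp_closed)
  show "set_integrable lebesgue K s"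
    unfolding set_integrable_def
  proof (rule integrableI_bounded)
    have "(\<integral>\<^sup>+y. ennreal (norm (indicat_real K y *\<^sub>R s y)) \<partial>lebesgue) \<le> (\<integral>\<^sup>+y\<in>ball 0 r. ennreal (s y) \<partial>lebesgue)"
      using r nn by (intro nn_integral_mono) (auto simp: indicator_def)
    also have "\<dots> < \<infinity>" using fin[OF r(1)] by simp
    finally show "(\<integral>\<^sup>+y. ennreal (norm (indicat_real K y *\<^sub>R s y)) \<partial>lebesgue) < \<infinity>" .
  qed measurable
qed (use pos in auto)

text \<open>Hoelder's inequality for \<open>g w\<^sup>1\<^sup>/\<^sup>p\<close> and \<open>w\<^sup>-\<^sup>1\<^sup>/\<^sup>p\<close>.\<close>
lemma muckenhoupt_of_dual:
  fixes w s :: "'a::euclidean_space \<Rightarrow> real"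
  assumes w: "weight w" and s: "weight s" and "1 < p"
    and dual: "AE y in lebesgue. s y = w y powr (1 - conj_exp p)" and "0 < K"
    and bound: "\<And>x r. 0 < r \<Longrightarrow>
      mass w x r * mass s x r powr (p - 1) \<le> K * (unit_ball_vol (real DIM('a)) * r ^ DIM('a)) powr p"
  shows "muckenhoupt p K w"
  unfolding muckenhoupt_def
proof (intro conjI allI impI)
  fix x :: 'a and r :: real and g :: "'a \<Rightarrow> ennreal"
  assume r: "0 < r" and g [measurable]: "g \<in> borel_measurable lebesgue"
  have [measurable]: "w \<in> borel_measurable lebesgue" "s \<in> borel_measurable lebesgue"
    using w s by (simp_all add: weight_def)
  define q where "q = conj_exp p"
  have q: "1 < q" "1 / p + 1 / q = 1" "p / q = p - 1" "q / p = q - 1"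
    using \<open>1 < p\<close> by (auto simp: q_def conj_exp_def field_simps)
  let ?B = "ball x r"
  let ?v = "unit_ball_vol (real DIM('a)) * r ^ DIM('a)"
  let ?I = "\<integral>\<^sup>+y\<in>?B. epowr (g y) p \<partial>wm w"
  let ?a = "\<lambda>y. g y * ennreal (w y powr (1 / p)) * indicator ?B y"
  let ?b = "\<lambda>y. ennreal (w y powr (- (1 / p))) * indicator ?B y"
  have v: "0 < ?v" using r by simp
  have pos: "AE y in lebesgue. 0 < w y" using w by (simp add: weight_def)
  have "(\<integral>\<^sup>+y\<in>?B. g y \<partial>lebesgue) = (\<integral>\<^sup>+y. ?a y *
      ?b y \<partial>lebesgue)"
  proof (rule nn_integral_cong_AE)
    show "AE y in lebesgue. g y * indicator ?B y = ?a y *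
      ?b y"
      using pos
    proof eventually_elim
      case (elim y)
      have "ennreal (w y powr (1 / p)) * ennreal (w y powr (- (1 / p))) = 1"
        using elim by (simp add: powr_minus flip: ennreal_mult)
      then have "g y * ennreal (w y powr (1 / p)) * ennreal (w y powr (- (1 / p))) = g y"
        by (simp only: mult.assoc mult_1_right)
      then show ?case by (simp add: indicator_def)
    qed
  qed
  also have "\<dots> \<le> epowr (\<integral>\<^sup>+y. epowr (?a y) p \<partial>lebesgue) (1 / p) *
      epowr (\<integral>\<^sup>+y. epowr (?b y) q \<partial>lebesgue) (1 / q)"
    using \<open>1 < p\<close> q by (intro nn_integral_Hoelder) auto
  also have "(\<integral>\<^sup>+y. epowr (?a y) p \<partial>lebesgue) = ?I"
  proof -
    have "(\<integral>\<^sup>+y. epowr (?a y) p \<partial>lebesgue) =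
        (\<integral>\<^sup>+y\<in>?B. epowr (g y) p * ennreal (w y) \<partial>lebesgue)"
    proof (rule nn_integral_cong_AE)
      show "AE y in lebesgue. epowr (?a y) p =
          epowr (g y) p * ennreal (w y) * indicator ?B y"
        using pos by eventually_elim (use \<open>1 < p\<close> in \<open>auto simp: indicator_def epowr_mult epowr_ennreal powr_powr\<close>)
    qed
    then show ?thesis by (subst set_nn_integral_wm) auto
  qed
  also have "(\<integral>\<^sup>+y. epowr (?b y) q \<partial>lebesgue) = ennreal (mass s x r)"
  proof -
    have "(\<integral>\<^sup>+y. epowr (?b y) q \<partial>lebesgue) =
        (\<integral>\<^sup>+y\<in>?B. ennreal (s y) \<partial>lebesgue)"
    proof (rule nn_integral_cong_AE)
      have e: "- (1 / p) * q = 1 - conj_exp p" using q by (simp add: q_def)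
      show "AE y in lebesgue. epowr (?b y) q =
          ennreal (s y) * indicator ?B y"
        using pos dual
        by eventually_elim (use q e in \<open>auto simp: indicator_def epowr_ennreal powr_powr\<close>)
    qed
    also have "\<dots> = emeasure (wm s) ?B"
      by (simp add: wm_def emeasure_density)
    finally show ?thesis using s by (simp add: emeasure_wm_ball)
  qed
  finally have "epowr (\<integral>\<^sup>+y\<in>?B. g y \<partial>lebesgue) p \<le> epowr (epowr ?I (1 / p) * epowr (ennreal (mass s x r)) (1 / q)) p"
    using \<open>1 < p\<close> by (intro epowr_mono) auto
  also have "\<dots> = ?I * ennreal (mass s x r powr (p - 1))"
    using \<open>1 < p\<close> q by (simp add: epowr_mult epowr_epowr epowr_ennreal powr_powr)
  finally have main: "epowr (\<integral>\<^sup>+y\<in>?B. g y \<partial>lebesgue) p \<le> ?I * ennreal (mass s x r powr (p - 1))" .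
  have "epowr (avg g x r) p = epowr (\<integral>\<^sup>+y\<in>?B. g y \<partial>lebesgue) p * ennreal ((1 / ?v) powr p)"
    unfolding avg_def divide_ennreal_def using \<open>1 < p\<close> v
    by (simp add: epowr_mult emeasure_ball[OF less_imp_le[OF r]] inverse_ennreal epowr_ennreal inverse_eq_divide
        del: inverse_mult_distrib)
  then have "epowr (avg g x r) p * emeasure (wm w) ?B \<le>
      (?I * ennreal (mass s x r powr (p - 1))) * ennreal ((1 / ?v) powr p) * ennreal (mass w x r)"
    using main w by (simp add: emeasure_wm_ball mult_right_mono)
  also have "\<dots> = ?I * ennreal ((1 / ?v) powr p * (mass w x r * mass s x r powr (p - 1)))"
    by (simp add: ennreal_mult ac_simps)
  also have "\<dots> \<le> ?I * ennreal ((1 / ?v) powr p * (K * ?v powr p))"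
    using bound[OF r] by (intro mult_left_mono ennreal_leI) auto
  also have "(1 / ?v) powr p * (K * ?v powr p) = K"
  proof -
    have "(1 / u) powr p * (K * u powr p) = K" if "0 < u" for u :: real
      using that by (simp add: powr_divide)
    then show ?thesis using v by blast
  qed
  finally show "epowr (avg g x r) p * emeasure (wm w) ?B \<le> ennreal K * ?I"
    by (simp add: mult.commute)
qed (use assms in auto)

text \<open>Local integrability of the dual weight is not part of \<open>Ap\<close> but follows from
  it: an infinite average of \<open>s\<close>, multiplied by the positive average of
  \<open>w\<close>, would make the supremum infinite. Clearing denominators then collects the volume
  to the power \<open>1 + (p - 1) = p\<close>.\<close>

lemma Ap_dual_bound:
  fixes w :: "'a::euclidean_space \<Rightarrow> real"
  assumes "Ap p w" "1 < p"
  defines "s \<equiv> \<lambda>y. w y powr (1 - conj_exp p)"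
  obtains K where "0 < K" "weight s" "\<And>x r. 0 < r \<Longrightarrow>
      mass w x r * mass s x r powr (p - 1) \<le> K * (unit_ball_vol (real DIM('a)) * r ^ DIM('a)) powr p"
proof -
  let ?v = "\<lambda>r. unit_ball_vol (real DIM('a)) * r ^ DIM('a)"
  have w: "weight w" using assms by (simp add: Ap_def)
  have [measurable]: "w \<in> borel_measurable lebesgue" using w by (simp add: weight_def)
  have [measurable]: "s \<in> borel_measurable lebesgue" unfolding s_def by measurable
  let ?S = "SUP x. SUP r\<in>{0<..}. wmeas w (ball x r) / emeasure lebesgue (ball x r) *
      epowr (wmeas s (ball x r) / emeasure lebesgue (ball x r)) (p - 1)"
  have "?S < top" using assms by (simp add: Ap_def)
  then obtain K0 where K0: "?S = ennreal K0" "0 \<le> K0" unfolding less_top_ennreal by blast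
  define K where "K = K0 + 1"
  have le: "wmeas w (ball x r) / emeasure lebesgue (ball x r) *
      epowr (wmeas s (ball x r) / emeasure lebesgue (ball x r)) (p - 1) \<le> ennreal K" if "0 < r" for x r
  proof -
    have "wmeas w (ball x r) / emeasure lebesgue (ball x r) *
      epowr (wmeas s (ball x r) / emeasure lebesgue (ball x r)) (p - 1) \<le> ?S"
      using that by (intro SUP_upper2[of x] SUP_upper2[of r]) auto
    also have "\<dots> \<le> ennreal K" unfolding K0 K_def by (intro ennreal_leI) simp
    finally show ?thesis .
  qed
  have v: "0 < ?v r" if "0 < r" for r using that by simp
  have avgw: "wmeas w (ball x r) / emeasure lebesgue (ball x r) = ennreal (mass w x r / ?v r)" if "0 < r" for x r
    using that w v[OF that] by (simp add: wmeas_eq emeasure_wm_ball emeasure_ball divide_ennreal)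
  have fin: "wmeas s (ball x r) < top" if "0 < r" for x r
  proof (rule ccontr)
    assume "\<not> wmeas s (ball x r) < top"
    then have "wmeas s (ball x r) = top" using less_top by blast
    then have "wmeas s (ball x r) / emeasure lebesgue (ball x r) = top"
      using that by (simp add: emeasure_ball divide_ennreal_def inverse_ennreal ennreal_top_mult ennreal_eq_0_iff not_le
          del: inverse_mult_distrib)
    then have "wmeas w (ball x r) / emeasure lebesgue (ball x r) *
      epowr (wmeas s (ball x r) / emeasure lebesgue (ball x r)) (p - 1) = top"
      using avgw[OF that, of x] mass_pos[OF w that, of x] v[OF that] \<open>1 < p\<close>
      by (simp add: ennreal_mult_top ennreal_eq_0_iff not_le)
    then show False using le[OF that, of x] by (simp add: top_unique)
  qed
  have s: "weight s"
  proof (rule weightI)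
    have "AE y in lebesgue. 0 < w y" using w by (simp add: weight_def)
    then show "AE y in lebesgue. 0 < s y" by eventually_elim (simp add: s_def)
    show "(\<integral>\<^sup>+y\<in>ball 0 r. ennreal (s y) \<partial>lebesgue) < top" if "0 < r" for r
      using fin[OF that, of 0] by (simp add: wmeas_def)
  qed (auto simp: s_def)
  have "mass w x r * mass s x r powr (p - 1) \<le> K * ?v r powr p" if r: "0 < r" for x r
  proof -
    have "wmeas s (ball x r) / emeasure lebesgue (ball x r) = ennreal (mass s x r / ?v r)"
      using r s v[OF r] by (simp add: wmeas_eq emeasure_wm_ball emeasure_ball divide_ennreal)
    then have "ennreal (mass w x r / ?v r) * ennreal ((mass s x r / ?v r) powr (p - 1)) \<le> ennreal K"
      using le[OF r, of x] avgw[OF r, of x] v[OF r] \<open>1 < p\<close>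
      by (simp add: epowr_ennreal)
    moreover have "ennreal (mass w x r / ?v r * (mass s x r / ?v r) powr (p - 1)) =
        ennreal (mass w x r / ?v r) * ennreal ((mass s x r / ?v r) powr (p - 1))"
      using v[OF r] by (intro ennreal_mult) auto
    ultimately have "ennreal (mass w x r / ?v r * (mass s x r / ?v r) powr (p - 1)) \<le> ennreal K"
      by (simp only:)
    then have "mass w x r / ?v r * (mass s x r / ?v r) powr (p - 1) \<le> K"
      using K0 by (subst (asm) ennreal_le_iff) (simp_all add: K_def)
    also have "mass w x r / ?v r * (mass s x r / ?v r) powr (p - 1) =
        mass w x r * mass s x r powr (p - 1) / ?v r powr p"
    proof -
      have "?v r powr p = ?v r * ?v r powr (p - 1)"
        using v[OF r] powr_add[of "?v r" 1 "p - 1"] by simp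
      then show ?thesis using v[OF r] by (simp only: powr_divide mass_nonneg less_imp_le) (simp add: field_simps)
    qed
    finally have "mass w x r * mass s x r powr (p - 1) / ?v r powr p \<le> K" .
    moreover have "0 < ?v r powr p"
      unfolding powr_gt_zero using v[OF r] by (rule less_imp_neq[symmetric])
    ultimately show ?thesis
      by (simp only: pos_divide_le_eq)
  qed
  moreover have "0 < K" using K0 by (simp add: K_def)
  ultimately show ?thesis using that s by blast
qed

lemma Ap_muckenhoupt:
  assumes "Ap p w" "1 < p"
  obtains C where "muckenhoupt p C w"
proof -
  define s where "s = (\<lambda>y. w y powr (1 - conj_exp p))"
  obtain K where K: "0 < K" "weight s" "\<And>x r. 0 < r \<Longrightarrow>
      mass w x r * mass s x r powr (p - 1) \<le> K * (unit_ball_vol (real DIM('a)) * r ^ DIM('a)) powr p"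
    using Ap_dual_bound[OF assms] unfolding s_def by blast
  have "muckenhoupt p K w"
    using assms K by (intro muckenhoupt_of_dual[where s = s]) (auto simp: Ap_def s_def)
  then show ?thesis by (rule that)
qed

text \<open>
  The dual weight \<open>s\<close> satisfies a reverse Hoelder inequality; \<open>s\<^sup>1\<^sup>+\<^sup>\<epsilon>\<close> is the weight
  dual to \<open>w\<close> for the smaller exponent \<open>q = 1 + (p - 1) / (1 + \<epsilon>)\<close>.
\<close>
lemma Ap_muckenhoupt_open:
  fixes w :: "'a::euclidean_space \<Rightarrow> real"
  assumes Ap: "Ap p w" and p: "1 < p"
  obtains q C where "q < p" "muckenhoupt q C w"
proof -
  let ?v = "\<lambda>r. unit_ball_vol (real DIM('a)) * r ^ DIM('a)"
  have v: "0 < ?v r" if "0 < r" for r using that by simp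
  have w: "weight w" using Ap by (simp add: Ap_def)
  have wpos: "AE y in lebesgue. 0 < w y" using w by (simp add: weight_def)
  define s where "s = (\<lambda>y. w y powr (1 - conj_exp p))"
  obtain K where K: "0 < K" "weight s" "\<And>x r. 0 < r \<Longrightarrow>
      mass w x r * mass s x r powr (p - 1) \<le> K * ?v r powr p"
    using Ap_dual_bound[OF assms] unfolding s_def by blast
  have spos: "AE y in lebesgue. 0 < s y" using K(2) by (simp add: weight_def)
  have [measurable]: "s \<in> borel_measurable lebesgue" using K(2) by (simp add: weight_def)
  let ?p' = "conj_exp p"
  have p': "1 < ?p'" "(p - 1) * (?p' - 1) = 1" "p * (?p' - 1) = ?p'"
    using p by (auto simp: conj_exp_def field_simps)
  \<comment> \<open>The bound is symmetric in the two weights: raised to the power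
    \<open>?p' - 1 = 1 / (p - 1)\<close>, it is the condition on \<open>s\<close> for the exponent
    \<open>?p'\<close>, and the weight dual to \<open>s\<close> is \<open>w\<close> again.\<close>
  have "muckenhoupt ?p' (K powr (?p' - 1)) s"
  proof (rule muckenhoupt_of_dual[OF K(2) w p'(1)])
    show "AE y in lebesgue. w y = s y powr (1 - conj_exp ?p')"
      using wpos
    proof eventually_elim
      case (elim y)
      have "1 - conj_exp p = - (1 / (p - 1))" "conj_exp (conj_exp p) = p"
        using p by (simp_all add: conj_exp_def divide_simps)
      then have "(1 - conj_exp p) * (1 - conj_exp (conj_exp p)) = 1"
        using p by (simp only:) (simp add: divide_simps)
      then show ?case using elim by (simp add: s_def powr_powr)
    qed
    show "0 < K powr (?p' - 1)" using K by simp
    fix x :: 'a and r :: real assume r: "0 < r"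
    have "(mass w x r * mass s x r powr (p - 1)) powr (?p' - 1) \<le> (K * ?v r powr p) powr (?p' - 1)"
      using K(3)[OF r] p' by (intro powr_mono2) auto
    then show "mass s x r * mass w x r powr (?p' - 1) \<le> K powr (?p' - 1) * ?v r powr ?p'"
      using p' K(1) by (simp add: powr_mult powr_powr mult.commute)
  qed
  then obtain \<epsilon> D where D: "0 < \<epsilon>" "0 < D" "\<And>x r. 0 < r \<Longrightarrow>
      (\<integral>\<^sup>+y\<in>ball x r. ennreal (s y powr (1 + \<epsilon>)) \<partial>lebesgue) \<le> ennreal (D * (mass s x r / ?v r) powr \<epsilon> * mass s x r)"
    using muckenhoupt_reverse_Hoelder by blast
  define u where "u = (\<lambda>y. s y powr (1 + \<epsilon>))"
  have u: "weight u"
  proof (rule weightI)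
    show "AE y in lebesgue. 0 < u y" using spos by eventually_elim (simp add: u_def)
    show "(\<integral>\<^sup>+y\<in>ball 0 r. ennreal (u y) \<partial>lebesgue) < top" if "0 < r" for r
      using le_less_trans[OF D(3)[OF that, of 0] ennreal_less_top] by (simp add: u_def)
  qed (auto simp: u_def)
  define q where "q = 1 + (p - 1) / (1 + \<epsilon>)"
  have q: "1 < q" "q < p" "(q - 1) * (1 + \<epsilon>) = p - 1"
    using p D(1) by (auto simp: q_def field_simps)
  have cj: "1 - conj_exp t = - (1 / (t - 1))" if "1 < t" for t
    using that by (simp add: conj_exp_def divide_simps)
  have q': "(1 - conj_exp p) * (1 + \<epsilon>) = 1 - conj_exp q"
    unfolding cj[OF p] cj[OF q(1)] using p D(1) by (simp add: q_def)
  have "muckenhoupt q (D powr (q - 1) * K) w"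
  proof (rule muckenhoupt_of_dual[OF w u q(1)])
    show "AE y in lebesgue. u y = w y powr (1 - conj_exp q)"
      using q' by (simp add: u_def s_def powr_powr)
    show "0 < D powr (q - 1) * K" using D K by simp
    fix x :: 'a and r :: real assume r: "0 < r"
    define V where "V = ?v r"
    have V: "0 < V" using r by (simp add: V_def)
    let ?S = "mass s x r"
    have S: "0 < ?S" by (rule mass_pos[OF K(2) r])
    have "ennreal (mass u x r) = (\<integral>\<^sup>+y\<in>ball x r. ennreal (s y powr (1 + \<epsilon>)) \<partial>lebesgue)"
      using emeasure_wm_ball[OF u, of x r] by (simp add: wm_def emeasure_density u_def)
    also have "\<dots> \<le> ennreal (D * (?S / V) powr \<epsilon> * ?S)"
      using D(3)[OF r] by (simp add: V_def)
    finally have "mass u x r \<le> D * (?S / V) powr \<epsilon> * ?S"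
      using D(2) by (subst (asm) ennreal_le_iff) auto
    also have "\<dots> = D * ?S powr (1 + \<epsilon>) * V powr (- \<epsilon>)"
      using S V by (simp add: powr_divide powr_add powr_minus field_simps)
    finally have "mass u x r powr (q - 1) \<le> (D * ?S powr (1 + \<epsilon>) * V powr (- \<epsilon>)) powr (q - 1)"
      using q by (intro powr_mono2) auto
    also have "\<dots> = D powr (q - 1) * ?S powr (p - 1) * V powr (q - p)"
    proof -
      have "(1 + \<epsilon>) * (q - 1) = p - 1" "- \<epsilon> * (q - 1) = q - p"
        using q(3) by (simp_all add: algebra_simps)
      then show ?thesis using D(2) V S by (simp add: powr_mult powr_powr del: mult_minus_left)
    qed
    finally have "mass w x r * mass u x r powr (q - 1) \<le> mass w x r * (D powr (q - 1) * ?S powr (p - 1) * V powr (q - p))"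
      by (intro mult_left_mono) auto
    also have "\<dots> = (D powr (q - 1) * V powr (q - p)) * (mass w x r * ?S powr (p - 1))"
      by (simp only: ac_simps)
    also have "\<dots> \<le> (D powr (q - 1) * V powr (q - p)) * (K * V powr p)"
      using K(3)[OF r, of x] unfolding V_def by (intro mult_left_mono) auto
    also have "\<dots> = D powr (q - 1) * K * (V powr (q - p) * V powr p)"
      by (simp only: ac_simps)
    also have "V powr (q - p) * V powr p = V powr q"
      using V by (simp flip: powr_add)
    finally show "mass w x r * mass u x r powr (q - 1) \<le> D powr (q - 1) * K * ?v r powr q"
      by (simp only: V_def)
  qed
  then show ?thesis using that q(2) by blast
qed

lemma A1_muckenhoupt:
  fixes w :: "'a::euclidean_space \<Rightarrow> real"
  assumes "A1 w"
  obtains C where "muckenhoupt 1 C w"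
proof -
  have w: "weight w" using assms by (simp add: A1_def)
  have [measurable]: "w \<in> borel_measurable lebesgue" using w by (simp add: weight_def)
  obtain c where c: "\<And>x r. 0 < r \<Longrightarrow> AE y in lebesgue. y \<in> ball x r \<longrightarrow>
      wmeas w (ball x r) / emeasure lebesgue (ball x r) \<le> ennreal (c * w y)"
    using assms by (auto simp: A1_def)
  define C where "C = max c 1"
  have "muckenhoupt 1 C w"
    unfolding muckenhoupt_def
  proof (intro conjI allI impI)
    fix x :: 'a and r :: real and g :: "'a \<Rightarrow> ennreal"
    assume r: "0 < r" and [measurable]: "g \<in> borel_measurable lebesgue"
    let ?B = "ball x r"
    have "AE y in lebesgue. 0 < w y" using w by (simp add: weight_def)
    then have ae: "AE y in lebesgue. emeasure (wm w) ?B / emeasure lebesgue ?B * (g y * indicator ?B y) \<le>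
        ennreal C * (g y * ennreal (w y) * indicator ?B y)"
      using c[OF r, of x]
    proof eventually_elim
      case (elim y)
      show ?case
      proof (cases "y \<in> ?B")
        case True
        then have "emeasure (wm w) ?B / emeasure lebesgue ?B \<le> ennreal (c * w y)"
          using elim by (simp add: wmeas_eq)
        also have "\<dots> \<le> ennreal (C * w y)"
          using elim by (intro ennreal_leI mult_right_mono) (auto simp: C_def)
        also have "\<dots> = ennreal C * ennreal (w y)"
          using elim by (intro ennreal_mult) (auto simp: C_def)
        finally have "emeasure (wm w) ?B / emeasure lebesgue ?B * g y \<le> ennreal C * ennreal (w y) * g y"
          by (rule mult_right_mono) simp
        then show ?thesis using True by (simp add: ac_simps)
      qed simp
    qed
    have "avg g x r * emeasure (wm w) ?B = emeasure (wm w) ?B / emeasure lebesgue ?B * (\<integral>\<^sup>+y\<in>?B. g y \<partial>lebesgue)"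
      by (simp add: avg_def divide_ennreal_def ac_simps)
    also have "\<dots> = (\<integral>\<^sup>+y. emeasure (wm w) ?B / emeasure lebesgue ?B * (g y * indicator ?B y) \<partial>lebesgue)"
      by (subst nn_integral_cmult) auto
    also have "\<dots> \<le> (\<integral>\<^sup>+y. ennreal C * (g y * ennreal (w y) * indicator ?B y) \<partial>lebesgue)"
      by (rule nn_integral_mono_AE[OF ae])
    also have "\<dots> = ennreal C * (\<integral>\<^sup>+y\<in>?B. g y \<partial>wm w)"
      by (subst set_nn_integral_wm) (auto simp: nn_integral_cmult)
    finally show "epowr (avg g x r) 1 * emeasure (wm w) ?B \<le> ennreal C * (\<integral>\<^sup>+y\<in>?B. epowr (g y) 1 \<partial>wm w)"
      by simp
  qed (use w in \<open>auto simp: C_def\<close>)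
  then show ?thesis by (rule that)
qed

section \<open>The reverse Hoelder classes and the decay of mass on small balls\<close>

text \<open>The reverse Hoelder inequality in averaged form; it shows that the supremum defining
  \<open>rh_index w\<close> runs over a nonempty set.\<close>

lemma muckenhoupt_RH:
  fixes w :: "'a::euclidean_space \<Rightarrow> real"
  assumes "muckenhoupt p C w"
  obtains \<sigma> where "1 < \<sigma>" "RH \<sigma> w"
proof -
  let ?v = "\<lambda>r. unit_ball_vol (real DIM('a)) * r ^ DIM('a)"
  have w: "weight w" using assms by (simp add: muckenhoupt_def)
  have [measurable]: "w \<in> borel_measurable lebesgue" using w by (simp add: weight_def)
  obtain \<epsilon> D where D: "0 < \<epsilon>" "0 < D" "\<And>x r. 0 < r \<Longrightarrow>
      (\<integral>\<^sup>+y\<in>ball x r. ennreal (w y powr (1 + \<epsilon>)) \<partial>lebesgue) \<le> ennreal (D * (mass w x r / ?v r) powr \<epsilon> * mass w x r)"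
    using muckenhoupt_reverse_Hoelder[OF assms] by blast
  have "RH (1 + \<epsilon>) w"
    unfolding RH_def
  proof (intro exI[of _ "D powr (1 / (1 + \<epsilon>))"] allI impI)
    fix x :: 'a and r :: real assume r: "0 < r"
    define V where "V = ?v r"
    have V: "0 < V" "emeasure lebesgue (ball x r) = ennreal V"
      using r by (simp_all add: V_def emeasure_ball)
    define a where "a = mass w x r / V"
    have a: "0 < a" using mass_pos[OF w r] V by (simp add: a_def)
    have avg: "wmeas w (ball x r) / emeasure lebesgue (ball x r) = ennreal a"
      unfolding V using w V by (simp add: wmeas_eq emeasure_wm_ball divide_ennreal a_def)
    have "wmeas (\<lambda>y. w y powr (1 + \<epsilon>)) (ball x r) / ennreal V \<le> ennreal (D * a powr \<epsilon> * mass w x r) / ennreal V"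
      using D(3)[OF r, of x] unfolding wmeas_def a_def V_def by (rule divide_right_mono_ennreal)
    also have "\<dots> = ennreal (D * a powr \<epsilon> * mass w x r / V)"
      using V D by (intro divide_ennreal) auto
    also have "D * a powr \<epsilon> * mass w x r / V = D * (a powr \<epsilon> * a powr 1)"
    proof -
      have "a powr 1 = a" using a by simp
      then show ?thesis by (simp only: a_def times_divide_eq_right mult.assoc)
    qed
    also have "\<dots> = (D powr (1 / (1 + \<epsilon>)) * a) powr (1 + \<epsilon>)"
      using D(1,2) a powr_add[of a 1 \<epsilon>] by (simp add: powr_mult powr_powr mult.commute)
    finally have "epowr (wmeas (\<lambda>y. w y powr (1 + \<epsilon>)) (ball x r) / ennreal V) (1 / (1 + \<epsilon>)) \<le>
        ennreal (D powr (1 / (1 + \<epsilon>)) * a)"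
      using D a by (subst epowr_inverse_le_iff) auto
    then show "epowr (wmeas (\<lambda>y. w y powr (1 + \<epsilon>)) (ball x r) / emeasure lebesgue (ball x r)) (1 / (1 + \<epsilon>))
        \<le> ennreal (D powr (1 / (1 + \<epsilon>))) * (wmeas w (ball x r) / emeasure lebesgue (ball x r))"
      unfolding avg unfolding V(2) using a by (simp add: ennreal_mult)
  qed
  then show ?thesis using that[of "1 + \<epsilon>"] D(1) by simp
qed

text \<open>Hoelder's inequality for \<open>w\<close> on the large ball against the indicator of the
  small one, followed by \<open>RH \<sigma>\<close> on the large ball. The exponent is the dimension
  divided by the conjugate of \<sigma>; this is how conjugate exponents enter the condition on
  \<open>lam1\<close>.\<close>

lemma RH_mass_le:
  fixes w :: "'a::euclidean_space \<Rightarrow> real"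
  assumes w: "weight w" and "RH \<sigma> w" and \<sigma>: "1 < \<sigma>"
  obtains K where "0 < K" "\<And>x y r s. 0 < r \<Longrightarrow> 0 < s \<Longrightarrow> ball x r \<subseteq> ball y s \<Longrightarrow>
    mass w x r \<le> K * (r / s) powr (real DIM('a) * (1 - 1 / \<sigma>)) * mass w y s"
proof -
  let ?k = "unit_ball_vol (real DIM('a))" let ?n = "DIM('a)"
  have [measurable]: "w \<in> borel_measurable lebesgue" using w by (simp add: weight_def)
  obtain c where c: "\<And>x r. 0 < r \<Longrightarrow> epowr (wmeas (\<lambda>y. w y powr \<sigma>) (ball x r) / emeasure lebesgue (ball x r)) (1 / \<sigma>)
      \<le> ennreal c * (wmeas w (ball x r) / emeasure lebesgue (ball x r))"
    using \<open>RH \<sigma> w\<close> by (auto simp: RH_def)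
  define K where "K = max c 1"
  have K: "0 < K" "c \<le> K" by (auto simp: K_def)
  define q where "q = conj_exp \<sigma>"
  have q: "1 < q" "1 / \<sigma> + 1 / q = 1" "1 / q = 1 - 1 / \<sigma>"
    using \<sigma> by (auto simp: q_def conj_exp_def field_simps)
  have "mass w x r \<le> K * (r / s) powr (real ?n * (1 - 1 / \<sigma>)) * mass w y s"
    if r: "0 < r" and s: "0 < s" and sub: "ball x r \<subseteq> ball y s" for x y :: 'a and r s
  proof -
    define V where "V = ?k * s ^ ?n"
    define U where "U = ?k * r ^ ?n"
    have V: "0 < V" "emeasure lebesgue (ball y s) = ennreal V"
      and U: "0 < U" "emeasure lebesgue (ball x r) = ennreal U"
      using r s by (simp_all add: V_def U_def emeasure_ball)
    define I where "I = wmeas (\<lambda>y. w y powr \<sigma>) (ball y s)"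
    let ?m = "mass w y s"
    have m: "0 < ?m" by (rule mass_pos[OF w s])
    have "epowr (I / ennreal V) (1 / \<sigma>) \<le> ennreal c * ennreal (?m / V)"
      using c[OF s, of y] w V by (simp add: I_def wmeas_eq emeasure_wm_ball divide_ennreal)
    also have "\<dots> \<le> ennreal K * ennreal (?m / V)"
      using K by (intro mult_right_mono ennreal_leI) auto
    also have "\<dots> = ennreal (K * (?m / V))"
      using K m V by (intro ennreal_mult[symmetric]) auto
    finally have "I / ennreal V \<le> ennreal ((K * (?m / V)) powr \<sigma>)"
      using \<sigma> K m V by (subst (asm) epowr_inverse_le_iff) auto
    then have "I / ennreal V * ennreal V \<le> ennreal ((K * (?m / V)) powr \<sigma>) * ennreal V"
      by (rule mult_right_mono) simp
    moreover have "I / ennreal V * ennreal V = I"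
      using V by (simp add: ennreal_divide_times ennreal_mult_divide_eq)
    moreover have "ennreal ((K * (?m / V)) powr \<sigma>) * ennreal V = ennreal ((K * (?m / V) * V powr (1 / \<sigma>)) powr \<sigma>)"
    proof -
      have "(K * (?m / V) * V powr (1 / \<sigma>)) powr \<sigma> = (K * (?m / V)) powr \<sigma> * V"
        using K m V \<sigma> powr_mult[of "K * (?m / V)" "V powr (1 / \<sigma>)" \<sigma>] by (simp add: powr_powr)
      then show ?thesis using V by (simp add: ennreal_mult)
    qed
    ultimately have "epowr I (1 / \<sigma>) \<le> ennreal (K * (?m / V) * V powr (1 / \<sigma>))"
      using K m V \<sigma> by (subst epowr_inverse_le_iff) auto
    note I = this
    have "ennreal (mass w x r) = (\<integral>\<^sup>+z. ennreal (w z) * indicator (ball x r) z \<partial>lebesgue)"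
      using emeasure_wm_ball[OF w, of x r] by (simp add: wm_def emeasure_density)
    also have "\<dots> = (\<integral>\<^sup>+z. (ennreal (w z) * indicator (ball y s) z) * indicator (ball x r) z \<partial>lebesgue)"
      using sub by (intro nn_integral_cong) (auto simp: indicator_def)
    also have "\<dots> \<le> epowr (\<integral>\<^sup>+z. epowr (ennreal (w z) * indicator (ball y s) z) \<sigma> \<partial>lebesgue) (1 / \<sigma>) *
        epowr (\<integral>\<^sup>+z. epowr (indicator (ball x r) z) q \<partial>lebesgue) (1 / q)"
      using \<sigma> q by (intro nn_integral_Hoelder) auto
    also have "(\<integral>\<^sup>+z. epowr (indicator (ball x r) z) q \<partial>lebesgue) = ennreal U"
    proof -
      have "(\<integral>\<^sup>+z. epowr (indicator (ball x r) z) q \<partial>lebesgue) = (\<integral>\<^sup>+z. indicator (ball x r) z \<partial>lebesgue)"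
        using q by (intro nn_integral_cong) (auto simp: indicator_def)
      then show ?thesis using U by simp
    qed
    also have "(\<integral>\<^sup>+z. epowr (ennreal (w z) * indicator (ball y s) z) \<sigma> \<partial>lebesgue) \<le> I"
      unfolding I_def wmeas_def
    proof (intro nn_integral_mono)
      fix z
      show "epowr (ennreal (w z) * indicator (ball y s) z) \<sigma> \<le> ennreal (w z powr \<sigma>) * indicator (ball y s) z"
        using \<sigma> by (cases "0 \<le> w z") (auto simp: indicator_def epowr_ennreal ennreal_neg)
    qed
    finally have "ennreal (mass w x r) \<le> epowr I (1 / \<sigma>) * epowr (ennreal U) (1 / q)"
      using \<sigma> by (simp add: epowr_mono mult_right_mono)
    also have "\<dots> \<le> ennreal (K * (?m / V) * V powr (1 / \<sigma>)) * ennreal (U powr (1 / q))"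
      using I epowr_ennreal_pos[OF U(1), of "1 / q"] by (intro mult_mono) auto
    also have "\<dots> = ennreal (K * (?m / V) * V powr (1 / \<sigma>) * U powr (1 / q))"
      using K m V by (intro ennreal_mult[symmetric]) auto
    finally have "mass w x r \<le> K * (?m / V) * V powr (1 / \<sigma>) * U powr (1 / q)"
      using K m V by (subst (asm) ennreal_le_iff) auto
    also have "\<dots> = K * ?m * (U / V) powr (1 / q)"
    proof -
      have e: "V powr (1 / \<sigma>) / V = V powr (- (1 / q))"
        using V powr_diff[of V "1 / \<sigma>" 1] q by simp
      have "K * (?m / V) * V powr (1 / \<sigma>) * U powr (1 / q) = K * ?m * (U powr (1 / q) * (V powr (1 / \<sigma>) / V))"
        by (simp add: mult.assoc mult.left_commute mult.commute)
      also have "V powr (1 / \<sigma>) / V = V powr (- (1 / q))" by (rule e)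
      also have "U powr (1 / q) * V powr (- (1 / q)) = (U / V) powr (1 / q)"
        using U V by (simp add: powr_divide powr_minus_divide)
      finally show ?thesis .
    qed
    also have "U / V = (r / s) powr real ?n"
      using r s less_imp_neq[OF unit_ball_vol_pos, of "real ?n"] by (simp add: U_def V_def powr_realpow power_divide)
    also have "((r / s) powr real ?n) powr (1 / q) = (r / s) powr (real ?n * (1 - 1 / \<sigma>))"
      unfolding powr_powr using q by simp
    finally show ?thesis by (simp add: ac_simps)
  qed
  then show ?thesis using that K by blast
qed

section \<open>Power weights on Morrey spaces\<close>

text \<open>With \<kappa> the bound on \<alpha> is written without a quotient, so that
  \<open>lam2 = n\<close>, where \<open>\<kappa> = 0\<close> and \<alpha> is arbitrary, is no
  separate case. \<open>growth\<close> is the form in which the reverse Hoelder index enters;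
  \<open>p = 1\<close> is included.\<close>

locale morrey_power_weight =
  fixes w :: "'a::euclidean_space \<Rightarrow> real" and p C lam1 lam2 \<kappa> \<theta> \<alpha> c :: real
  assumes mu: "muckenhoupt p C w"
    and lam2: "0 \<le> lam2" "lam2 \<le> real DIM('a)"
    and kappa_eq: "\<kappa> = 1 - lam2 / real DIM('a)"
    and c: "0 < c"
    and decay: "\<And>r R. 0 < r \<Longrightarrow> r < R \<Longrightarrow>
      mass w 0 r \<le> c * (r / R) powr (real DIM('a) * \<theta>) * mass w 0 R"
    and theta: "0 \<le> \<theta>" "0 < lam1 + lam2 * \<theta>"
    and alpha: "0 \<le> \<alpha>" "\<alpha> * \<kappa> < lam1 + lam2 * \<theta>"
    and growth: "\<exists>K>0. \<forall>x r s. 0 < r \<longrightarrow> r \<le> s \<longrightarrow>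
      (s / r) powr lam1 * (mass w x r / mass w x s) powr \<kappa> \<le> K"
begin

abbreviation v :: "'a \<Rightarrow> real" where "v \<equiv> power_weight \<alpha> w"

text \<open>\<open>U x r\<close> is comparable to \<open>mass v x r\<close>, for all balls.\<close>
definition U :: "'a \<Rightarrow> real \<Rightarrow> real" where
  "U x r = max (norm x) r powr \<alpha> * mass w x r"

text \<open>Up to constants the Morrey factor
  \<open>r powr lam1 * mass v x r powr (lam2 / n)\<close> divided by \<open>mass v x r\<close>, that
  is, the size allowed to the mean of \<open>g\<^sup>p\<close> with respect to
  \<open>v\<close>.\<close>

definition \<phi> :: "'a \<Rightarrow> real \<Rightarrow> real" where
  "\<phi> x r = r powr lam1 * U x r powr (- \<kappa>)"

text \<open>\<open>N\<close> stands for the \<open>p\<close>-th power of the Morrey norm, so that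
  all estimates are linear in \<open>N\<close>.\<close>

definition morrey_bound :: "real \<Rightarrow> ('a \<Rightarrow> ennreal) \<Rightarrow> bool" where
  "morrey_bound N g \<longleftrightarrow> 0 \<le> N \<and> g \<in> borel_measurable lebesgue \<and>
    (\<forall>x r. 0 < r \<longrightarrow> (\<integral>\<^sup>+y\<in>ball x r. epowr (g y) p \<partial>wm v) \<le>
      ennreal (N * (r powr lam1 * mass v x r powr (lam2 / real DIM('a)))))"

lemmas D = muckenhouptD[OF mu]

lemma w_measurable [measurable]: "w \<in> borel_measurable lebesgue"
  using D(1) by (simp add: weight_def)

lemma v_measurable [measurable]: "v \<in> borel_measurable lebesgue"
proof -
  have [measurable]: "(\<lambda>x::'a. norm x) \<in> borel_measurable lebesgue"
    by (rule measurable_completion) simp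
  show ?thesis unfolding power_weight_def by measurable
qed

lemma kappa: "0 \<le> \<kappa>" "\<kappa> \<le> 1"
  using lam2 by (auto simp: kappa_eq field_simps)

lemma max_pos: "0 < r \<Longrightarrow> 0 < max (norm x) r"
  by auto

lemma U_pos: "0 < r \<Longrightarrow> 0 < U x r"
  using mass_pos[OF D(1), of r x] max_pos[of r x] by (auto simp: U_def)

lemma phi_pos: "0 < r \<Longrightarrow> 0 < \<phi> x r"
  using U_pos[of r x] by (simp add: \<phi>_def)

lemma phi_mult_U: "0 < r \<Longrightarrow> \<phi> x r * U x r = r powr lam1 * U x r powr (lam2 / real DIM('a))"
  using U_pos[of r x] powr_add[of "U x r" "- \<kappa>" 1] by (simp add: \<phi>_def) (simp add: kappa_eq)

lemma v_upper:
  assumes [measurable]: "E \<in> sets lebesgue" "h \<in> borel_measurable lebesgue" and "\<And>y. y \<in> E \<Longrightarrow> norm y \<le> b"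
  shows "(\<integral>\<^sup>+y\<in>E. h y \<partial>wm v) \<le> ennreal (b powr \<alpha>) * (\<integral>\<^sup>+y\<in>E. h y \<partial>wm w)"
proof -
  have "(\<integral>\<^sup>+y\<in>E. h y \<partial>wm v) = (\<integral>\<^sup>+y\<in>E. h y * ennreal (v y) \<partial>lebesgue)"
    by (rule set_nn_integral_wm) measurable
  also have "\<dots> \<le> (\<integral>\<^sup>+y. ennreal (b powr \<alpha>) * (h y * ennreal (w y) * indicator E y) \<partial>lebesgue)"
  proof (intro nn_integral_mono)
    fix y
    show "h y * ennreal (v y) * indicator E y \<le> ennreal (b powr \<alpha>) * (h y * ennreal (w y) * indicator E y)"
    proof (cases "y \<in> E")
      case True
      have "ennreal (v y) = ennreal (norm y powr \<alpha>) * ennreal (w y)"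
        unfolding power_weight_def by (rule ennreal_mult') simp
      also have "\<dots> \<le> ennreal (b powr \<alpha>) * ennreal (w y)"
        using assms(3)[OF True] alpha by (intro mult_right_mono ennreal_leI powr_mono2) auto
      finally have "h y * ennreal (v y) \<le> h y * (ennreal (b powr \<alpha>) * ennreal (w y))"
        by (rule mult_left_mono) simp
      then show ?thesis using True by (simp add: ac_simps)
    qed simp
  qed
  also have "\<dots> = ennreal (b powr \<alpha>) * (\<integral>\<^sup>+y\<in>E. h y * ennreal (w y) \<partial>lebesgue)"
    by (subst nn_integral_cmult) auto
  also have "(\<integral>\<^sup>+y\<in>E. h y * ennreal (w y) \<partial>lebesgue) = (\<integral>\<^sup>+y\<in>E. h y \<partial>wm w)"
    by (rule set_nn_integral_wm[symmetric]) measurable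
  finally show ?thesis .
qed

lemma v_lower:
  assumes [measurable]: "E \<in> sets lebesgue" "h \<in> borel_measurable lebesgue"
    and "0 < a" and "\<And>y. y \<in> E \<Longrightarrow> a \<le> norm y"
  shows "(\<integral>\<^sup>+y\<in>E. h y \<partial>wm w) \<le> ennreal (a powr (- \<alpha>)) * (\<integral>\<^sup>+y\<in>E. h y \<partial>wm v)"
proof -
  have "(\<integral>\<^sup>+y\<in>E. h y \<partial>wm w) = (\<integral>\<^sup>+y\<in>E. h y * ennreal (w y) \<partial>lebesgue)"
    by (rule set_nn_integral_wm) measurable
  also have "\<dots> \<le> (\<integral>\<^sup>+y. ennreal (a powr (- \<alpha>)) * (h y * ennreal (v y) * indicator E y) \<partial>lebesgue)"
  proof (intro nn_integral_mono)
    fix y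
    show "h y * ennreal (w y) * indicator E y \<le> ennreal (a powr (- \<alpha>)) * (h y * ennreal (v y) * indicator E y)"
    proof (cases "y \<in> E")
      case True
      have "1 \<le> a powr (- \<alpha>) * norm y powr \<alpha>"
        using assms(4)[OF True] \<open>0 < a\<close> alpha powr_mono2[of \<alpha> a "norm y"]
        by (simp add: powr_minus field_simps)
      then have "1 * ennreal (w y) \<le> ennreal (a powr (- \<alpha>) * norm y powr \<alpha>) * ennreal (w y)"
        by (intro mult_right_mono) auto
      also have "\<dots> = ennreal (a powr (- \<alpha>)) * ennreal (v y)"
        unfolding power_weight_def by (simp add: ennreal_mult' mult.assoc)
      finally have "h y * ennreal (w y) \<le> h y * (ennreal (a powr (- \<alpha>)) * ennreal (v y))"
        by (intro mult_left_mono) auto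
      then show ?thesis using True by (simp add: ac_simps)
    qed simp
  qed
  also have "\<dots> = ennreal (a powr (- \<alpha>)) * (\<integral>\<^sup>+y\<in>E. h y * ennreal (v y) \<partial>lebesgue)"
    by (subst nn_integral_cmult) auto
  also have "(\<integral>\<^sup>+y\<in>E. h y * ennreal (v y) \<partial>lebesgue) = (\<integral>\<^sup>+y\<in>E. h y \<partial>wm v)"
    by (rule set_nn_integral_wm[symmetric]) measurable
  finally show ?thesis .
qed

lemma v_upper_emeasure:
  assumes [measurable]: "E \<in> sets lebesgue" and "\<And>y. y \<in> E \<Longrightarrow> norm y \<le> b"
  shows "emeasure (wm v) E \<le> ennreal (b powr \<alpha>) * emeasure (wm w) E"
  using v_upper[of E "\<lambda>_. 1" b] assms by simp

lemma v_lower_emeasure: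
  assumes [measurable]: "E \<in> sets lebesgue" and "0 < a" "\<And>y. y \<in> E \<Longrightarrow> a \<le> norm y"
  shows "emeasure (wm w) E \<le> ennreal (a powr (- \<alpha>)) * emeasure (wm v) E"
  using v_lower[of E "\<lambda>_. 1" a] assms by simp

lemma weight_v: "weight v"
  unfolding weight_def
proof (intro conjI allI impI)
  show "v \<in> borel_measurable lebesgue" by (rule v_measurable)
  have "AE y in lebesgue. y \<notin> {0::'a}"
    by (rule AE_not_in) (simp flip: negligible_iff_null_sets)
  moreover have "AE y in lebesgue. 0 < w y"
    using D(1) by (simp add: weight_def)
  ultimately show "AE y in lebesgue. 0 < v y"
    by eventually_elim (simp add: power_weight_def)
  fix K :: "'a set" assume K: "compact K"
  then obtain r where r: "0 < r" "K \<subseteq> ball 0 r"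
    using bounded_subset_ballD[OF compact_imp_bounded, of K 0] by auto
  have [measurable]: "K \<in> sets lebesgue"
    using K by (simp add: compact_imp_closed)
  have "set_integrable lebesgue K w"
    using K D(1) by (simp add: weight_def)
  then have "integrable lebesgue (\<lambda>y. r powr \<alpha> * (indicat_real K y *\<^sub>R w y))"
    unfolding set_integrable_def by (rule integrable_mult_right)
  then show "set_integrable lebesgue K v"
    unfolding set_integrable_def
  proof (rule Bochner_Integration.integrable_bound)
    show "AE y in lebesgue. norm (indicat_real K y *\<^sub>R v y) \<le> norm (r powr \<alpha> * (indicat_real K y *\<^sub>R w y))"
    proof (intro AE_I2)
      fix y
      have "norm y powr \<alpha> \<le> r powr \<alpha>" if "y \<in> K"
        using that r alpha by (intro powr_mono2) auto
      then show "norm (indicat_real K y *\<^sub>R v y) \<le> norm (r powr \<alpha> * (indicat_real K y *\<^sub>R w y))"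
        by (auto simp: indicator_def power_weight_def abs_mult intro!: mult_right_mono)
    qed
  qed measurable
qed

lemma mass_v_le:
  assumes "0 < r"
  shows "mass v x r \<le> 2 powr \<alpha> * U x r"
proof -
  have "norm y \<le> 2 * max (norm x) r" if "y \<in> ball x r" for y
    using that norm_triangle_sub[of y x] by (auto simp: dist_norm norm_minus_commute)
  then have "emeasure (wm v) (ball x r) \<le> ennreal ((2 * max (norm x) r) powr \<alpha>) * emeasure (wm w) (ball x r)"
    by (intro v_upper_emeasure) auto
  then have "ennreal (mass v x r) \<le> ennreal ((2 * max (norm x) r) powr \<alpha> * mass w x r)"
    using D(1) weight_v by (simp add: emeasure_wm_ball ennreal_mult)
  then have "mass v x r \<le> (2 * max (norm x) r) powr \<alpha> * mass w x r"
    by (subst (asm) ennreal_le_iff) auto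
  also have "\<dots> = 2 powr \<alpha> * U x r"
    using max_pos[OF assms, of x] by (simp add: U_def powr_mult)
  finally show ?thesis .
qed

text \<open>Near the origin \<open>v\<close> can be far smaller than
  \<open>max (norm x) r powr \<alpha> * w\<close>. So the mass is taken from a ball of radius
  \<open>r / 4\<close> whose centre is pushed outwards by \<open>r / 2\<close>; there
  \<open>norm y \<ge> max (norm x) r / 4\<close>, and doubling of \<open>w\<close> returns to
  \<open>ball x r\<close>. The two quarters give the base 4 of the constant.\<close>

lemma U_le_mass_v:
  assumes r: "0 < r"
  shows "U x r \<le> C * 4 powr (real DIM('a) * p + \<alpha>) * mass v x r"
proof -
  let ?m = "max (norm x) r"
  obtain e :: 'a where e: "norm e = 1" "norm (x + (r / 2) *\<^sub>R e) = norm x + r / 2"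
  proof (cases "x = 0")
    case True
    obtain b :: 'a where "b \<in> Basis" using nonempty_Basis by blast
    then show ?thesis using that[of b] r True by simp
  next
    case False
    have "x + (r / 2) *\<^sub>R (x /\<^sub>R norm x) = (1 + r / 2 / norm x) *\<^sub>R x"
      by (simp only: scaleR_add_left scaleR_one scaleR_scaleR divide_inverse[of "r / 2"])
    then have "norm (x + (r / 2) *\<^sub>R (x /\<^sub>R norm x)) = \<bar>1 + r / 2 / norm x\<bar> * norm x"
      by (simp only: norm_scaleR)
    also have "\<dots> = norm x + r / 2"
    proof -
      have "0 < 1 + r / 2 / norm x" using r by (intro add_pos_nonneg) auto
      then have "\<bar>1 + r / 2 / norm x\<bar> * norm x = (1 + r / 2 / norm x) * norm x" by simp
      then show ?thesis using False by (simp add: distrib_right)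
    qed
    finally show ?thesis using that[of "x /\<^sub>R norm x"] False by simp
  qed
  define z where "z = x + (r / 2) *\<^sub>R e"
  have z: "norm z = norm x + r / 2" "dist z x = r / 2"
    using e r by (auto simp: z_def dist_norm)
  have sub: "ball z (r / 4) \<subseteq> ball x r"
    using z r by (subst ball_subset_ball_iff) auto
  have "?m / 4 \<le> norm y" if "y \<in> ball z (r / 4)" for y
  proof -
    have "norm z \<le> norm y + dist z y"
      using norm_triangle_sub[of z y] by (simp add: dist_norm)
    then have "norm x + r / 4 \<le> norm y" using that z by simp
    moreover have "?m \<le> norm x + r" using r by auto
    ultimately show ?thesis using norm_ge_zero[of x] by linarith
  qed
  then have "emeasure (wm w) (ball z (r / 4)) \<le> ennreal ((?m / 4) powr (- \<alpha>)) * emeasure (wm v) (ball z (r / 4))"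
    using max_pos[OF r, of x] by (intro v_lower_emeasure) auto
  then have "ennreal (mass w z (r / 4)) \<le> ennreal ((?m / 4) powr (- \<alpha>) * mass v z (r / 4))"
    using D(1) weight_v by (simp add: emeasure_wm_ball ennreal_mult)
  then have *: "mass w z (r / 4) \<le> (?m / 4) powr (- \<alpha>) * mass v z (r / 4)"
    by (subst (asm) ennreal_le_iff) auto
  have "mass w x r \<le> C * (r / (r / 4)) powr (real DIM('a) * p) * mass w z (r / 4)"
    using r by (intro muckenhoupt_doubling[OF mu sub]) auto
  also have "\<dots> \<le> C * (r / (r / 4)) powr (real DIM('a) * p) * ((?m / 4) powr (- \<alpha>) * mass v x r)"
    using order_trans[OF * mult_left_mono[OF mass_mono[OF weight_v sub]]] D(3)
    by (intro mult_left_mono) auto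
  finally have "?m powr \<alpha> * mass w x r \<le> ?m powr \<alpha> * (C * (r / (r / 4)) powr (real DIM('a) * p) * ((?m / 4) powr (- \<alpha>) * mass v x r))"
    by (intro mult_left_mono) auto
  also have "\<dots> = C * 4 powr (real DIM('a) * p) * (?m powr \<alpha> * (?m / 4) powr (- \<alpha>)) * mass v x r"
    using r by simp
  also have "?m powr \<alpha> * (?m / 4) powr (- \<alpha>) = 4 powr \<alpha>"
    using max_pos[OF r, of x] by (simp add: powr_minus powr_divide)
  finally show ?thesis
    by (simp add: U_def powr_add mult.assoc)
qed

lemma morrey_bound_U:
  assumes "morrey_bound N g" "0 < r"
  shows "(\<integral>\<^sup>+y\<in>ball x r. epowr (g y) p \<partial>wm v) \<le> ennreal (2 powr \<alpha> * N * (\<phi> x r * U x r))"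
proof -
  let ?e = "lam2 / real DIM('a)"
  have e: "0 \<le> ?e" "?e \<le> 1" using lam2 by auto
  have "mass v x r powr ?e \<le> (2 powr \<alpha> * U x r) powr ?e"
    using mass_v_le[OF assms(2), of x] e by (intro powr_mono2) auto
  also have "\<dots> = (2 powr \<alpha>) powr ?e * U x r powr ?e"
    using U_pos[OF assms(2), of x] by (simp add: powr_mult)
  also have "\<dots> \<le> (2 powr \<alpha>) powr 1 * U x r powr ?e"
    using e alpha by (intro mult_right_mono powr_mono) (auto simp: ge_one_powr_ge_zero)
  finally have "N * (r powr lam1 * mass v x r powr ?e) \<le> N * (r powr lam1 * (2 powr \<alpha> * U x r powr ?e))"
    using assms(1) by (intro mult_left_mono) (auto simp: morrey_bound_def)
  also have "\<dots> = 2 powr \<alpha> * N * (\<phi> x r * U x r)"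
    unfolding phi_mult_U[OF assms(2)] by simp
  finally show ?thesis
    using assms by (auto simp: morrey_bound_def intro: order_trans[OF _ ennreal_leI])
qed

text \<open>Away from the origin, at scale \<open>max (norm x) r\<close>, the weight \<open>v\<close> is a multiple of \<open>w\<close>.\<close>
lemma avg_away_from_0:
  assumes mb: "morrey_bound N g" and r: "0 < r" and E [measurable]: "E \<in> sets lebesgue"
    and "E \<subseteq> ball x r" and far: "\<And>y. y \<in> E \<Longrightarrow> max (norm x) r / 2 \<le> norm y"
  shows "epowr (avg (\<lambda>y. g y * indicator E y) x r) p \<le> ennreal (C * 4 powr \<alpha> * N * \<phi> x r)"
proof -
  have g [measurable]: "g \<in> borel_measurable lebesgue" and N: "0 \<le> N"
    using mb by (auto simp: morrey_bound_def)
  let ?m = "max (norm x) r" and ?M = "mass w x r"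
  have m: "0 < ?m" by (rule max_pos[OF r])
  have M: "0 < ?M" by (rule mass_pos[OF D(1) r])
  have "epowr (avg (\<lambda>y. g y * indicator E y) x r) p * ennreal ?M \<le>
      ennreal C * (\<integral>\<^sup>+y\<in>ball x r. epowr (g y * indicator E y) p \<partial>wm w)"
    using D(4)[OF r, of "\<lambda>y. g y * indicator E y" x] D(1) by (simp add: emeasure_wm_ball)
  also have "(\<integral>\<^sup>+y\<in>ball x r. epowr (g y * indicator E y) p \<partial>wm w) = (\<integral>\<^sup>+y\<in>E. epowr (g y) p \<partial>wm w)"
    using assms(4) D(2) by (intro nn_integral_cong) (auto simp: indicator_def)
  also have "\<dots> \<le> ennreal ((?m / 2) powr (- \<alpha>)) * (\<integral>\<^sup>+y\<in>E. epowr (g y) p \<partial>wm v)"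
    using far m by (intro v_lower) auto
  also have "(\<integral>\<^sup>+y\<in>E. epowr (g y) p \<partial>wm v) \<le> (\<integral>\<^sup>+y\<in>ball x r. epowr (g y) p \<partial>wm v)"
    using assms(4) by (intro nn_integral_mono) (auto simp: indicator_def)
  also have "\<dots> \<le> ennreal (2 powr \<alpha> * N * (\<phi> x r * U x r))"
    by (rule morrey_bound_U[OF mb r])
  finally have "epowr (avg (\<lambda>y. g y * indicator E y) x r) p * ennreal ?M \<le>
      ennreal C * (ennreal ((?m / 2) powr (- \<alpha>)) * ennreal (2 powr \<alpha> * N * (\<phi> x r * U x r)))"
    by (simp add: mult_left_mono)
  also have "\<dots> = ennreal (C * ((?m / 2) powr (- \<alpha>) * (2 powr \<alpha> * N * (\<phi> x r * U x r))))"
    using D(3) N phi_pos[OF r, of x] U_pos[OF r, of x] by (simp add: ennreal_mult)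
  also have "C * ((?m / 2) powr (- \<alpha>) * (2 powr \<alpha> * N * (\<phi> x r * U x r))) = C * 4 powr \<alpha> * N * \<phi> x r * ?M"
  proof -
    have "(?m / 2) powr (- \<alpha>) * ?m powr \<alpha> = 2 powr \<alpha>"
      using m by (simp add: powr_minus powr_divide)
    moreover have "(4::real) powr \<alpha> = 2 powr \<alpha> * 2 powr \<alpha>"
      by (simp flip: powr_mult)
    moreover have "C * ((?m / 2) powr (- \<alpha>) * (2 powr \<alpha> * N * (\<phi> x r * U x r))) =
        C * (((?m / 2) powr (- \<alpha>) * ?m powr \<alpha>) * 2 powr \<alpha>) * N * \<phi> x r * ?M"
      by (simp only: U_def ac_simps)
    ultimately show ?thesis by (simp only:)
  qed
  also have "ennreal (C * 4 powr \<alpha> * N * \<phi> x r * ?M) = ennreal (C * 4 powr \<alpha> * N * \<phi> x r) * ennreal ?M"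
    using D(3) N phi_pos[OF r, of x] M by (intro ennreal_mult) auto
  finally show ?thesis
    using M by (subst (asm) (1 2) mult.commute, subst (asm) ennreal_mult_le_mult_iff) auto
qed

end

section \<open>Averages and the maximal function under a Morrey bound\<close>

lemma epowr_le_ennreal_iff:
  assumes "0 < p" "0 \<le> y"
  shows "epowr x p \<le> ennreal y \<longleftrightarrow> x \<le> ennreal (y powr (1 / p))"
  using epowr_inverse_le_iff[of "1 / p" y x] assms by simp

lemma dyadic_annulus_cover:
  fixes y :: "'a::real_normed_vector"
  assumes "y \<noteq> 0" "norm y < R"
  obtains k :: nat where "R * 2 powr (- real k) / 2 \<le> norm y" "norm y < R * 2 powr (- real k)"
proof -
  define L where "L = log 2 (R / norm y)"
  have pos: "0 < norm y" "0 < R" using assms by (auto intro: le_less_trans[OF norm_ge_zero])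
  have "0 < L" unfolding L_def using assms pos by simp
  \<comment> \<open>The largest integer strictly below \<open>L\<close>. It makes the outer
    inequality strict and the inner one not, as fits an open ball minus the open ball of half its
    radius.\<close>
  define k where "k = nat (\<lceil>L\<rceil> - 1)"
  have k: "real k < L" "L \<le> real k + 1"
    using \<open>0 < L\<close> unfolding k_def by linarith+
  have e: "2 powr L = R / norm y"
    unfolding L_def using pos by simp
  have "2 powr real k < R / norm y"
    using k(1) unfolding e[symmetric] by simp
  then have 1: "norm y < R * 2 powr (- real k)"
    using pos by (simp add: powr_minus field_simps)
  have "R / norm y \<le> 2 powr (real k + 1)"
    using k(2) unfolding e[symmetric] by simp
  then have "R * 2 powr (- real k) / 2 \<le> norm y"
    using pos by (simp add: powr_minus powr_add field_simps)
  with 1 show ?thesis by (rule that[rotated])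
qed

text \<open>A ball that meets \<open>ball x r\<close> and leaves \<open>ball x (2 * r)\<close> has
  radius \<open>\<rho> > r / 2\<close>. It lies in the ball around \<open>x\<close> of radius
  \<open>r + 2 * \<rho> \<le> 4 * \<rho>\<close>, which costs the volume ratio
  \<open>4 ^ n\<close>.\<close>

lemma hl_local_split:
  fixes x :: "'a::euclidean_space"
  assumes y: "y \<in> ball x r" and b: "\<And>s. r \<le> s \<Longrightarrow> avg g x s \<le> b"
  shows "hl g y \<le> hl (\<lambda>u. g u * indicator (ball x (2 * r)) u) y + ennreal (4 ^ DIM('a)) * b"
proof (rule hl_leI)
  fix z \<rho> assume \<rho>: "0 < \<rho>" "y \<in> ball z \<rho>"
  have r: "0 < r" using y by (auto intro: le_less_trans[OF zero_le_dist])
  show "avg g z \<rho> \<le> hl (\<lambda>u. g u * indicator (ball x (2 * r)) u) y + ennreal (4 ^ DIM('a)) * b"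
  proof (cases "ball z \<rho> \<subseteq> ball x (2 * r)")
    case True
    then have "avg g z \<rho> = avg (\<lambda>u. g u * indicator (ball x (2 * r)) u) z \<rho>"
      by (intro avg_cong) (auto simp: subset_iff indicator_def)
    also have "\<dots> \<le> hl (\<lambda>u. g u * indicator (ball x (2 * r)) u) y"
      using \<rho> by (rule avg_le_hl)
    finally show ?thesis by (simp add: add_increasing2)
  next
    case False
    then obtain u where u: "u \<in> ball z \<rho>" "2 * r \<le> dist x u"
      by (meson leI mem_ball subsetI)
    have "dist x u \<le> dist x y + dist y z + dist z u"
      using dist_triangle[of x u y] dist_triangle[of y u z] by linarith
    then have 2: "r < 2 * \<rho>"
      using u y \<rho> by (simp add: dist_commute)
    define s where "s = r + 2 * \<rho>"
    have s: "r \<le> s" "0 < s" "s \<le> 4 * \<rho>" using r \<rho> 2 by (auto simp: s_def)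
    have "dist z x \<le> dist z y + dist y x" by (rule dist_triangle)
    then have "ball z \<rho> \<subseteq> ball x s"
      using y \<rho> by (subst ball_subset_ball_iff) (auto simp: s_def dist_commute)
    then have "avg g z \<rho> \<le> ennreal ((s / \<rho>) ^ DIM('a)) * avg g x s"
      using \<rho> s by (intro avg_subset_le) auto
    also have "\<dots> \<le> ennreal (4 ^ DIM('a)) * b"
      using b[OF s(1)] s \<rho> by (intro mult_mono ennreal_leI power_mono) (auto simp: field_simps)
    finally show ?thesis by (simp add: add_increasing)
  qed
qed

context morrey_power_weight
begin

text \<open>Doubling bounds \<open>mass w 0 r\<close> from below by a multiple of
  \<open>r powr (n * p)\<close>, and \<open>decay\<close> bounds it from above by a multiple of
  \<open>r powr (n * \<theta>)\<close>; for small \<open>r\<close> these are compatible only if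
  \<open>\<theta> \<le> p\<close>.\<close>

lemma theta_le_p: "\<theta> \<le> p"
proof (rule ccontr)
  assume "\<not> \<theta> \<le> p"
  define n where "n = real DIM('a)"
  define e where "e = n * (\<theta> - p)"
  have n: "0 < n" by (simp add: n_def)
  have e: "0 < e" using \<open>\<not> \<theta> \<le> p\<close> n by (simp add: e_def)
  \<comment> \<open>This leads to a concrete radius with \<open>C * c * r powr e < 1\<close>, in
    place of a limit at 0.\<close>
  define t where "t = 1 / (C * c + 1)"
  have Cc: "0 < C * c" using D(3) c by simp
  have t: "0 < t" "t < 1" "C * c * t < 1" using Cc by (auto simp: t_def field_simps)
  define r where "r = t powr (1 / e)"
  have r: "0 < r" "r < 1" "r powr e = t"
    using t e powr_less_mono2[of "1 / e" t 1] by (auto simp: r_def powr_powr)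
  have M: "0 < mass w 0 1" by (rule mass_pos[OF D(1)]) simp
  have "mass w 0 1 \<le> C * (1 / r) powr (n * p) * mass w 0 r"
    using r muckenhoupt_doubling[OF mu, of 0 r 0 1] by (simp add: subset_ball n_def)
  also have "\<dots> \<le> C * (1 / r) powr (n * p) * (c * (r / 1) powr (n * \<theta>) * mass w 0 1)"
    using decay[of r 1] r D(3) by (intro mult_left_mono) (auto simp: n_def)
  also have "\<dots> = C * c * ((1 / r) powr (n * p) * r powr (n * \<theta>)) * mass w 0 1"
    by simp
  also have "(1 / r) powr (n * p) * r powr (n * \<theta>) = r powr e"
    using r by (simp add: powr_divide e_def right_diff_distrib powr_diff)
  finally have "1 \<le> C * c * t"
    using M r by simp
  then show False using t by simp
qed

lemma alpha_exponent: "\<alpha> * \<kappa> < lam1 + lam2 * p"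
  using alpha(2) theta_le_p lam2 mult_left_mono[of \<theta> p lam2] by linarith

lemma avg_origin:
  obtains A where "0 < A"
    "\<And>N g R. morrey_bound N g \<Longrightarrow> 0 < R \<Longrightarrow> epowr (avg g 0 R) p \<le> ennreal (A * N * \<phi> 0 R)"
proof -
  define n where "n = real DIM('a)"
  have n: "0 < n" by (simp add: n_def)
  let ?m = "\<kappa> * (\<alpha> + n * p) - lam1"
  have p: "0 < p" using D(2) by simp
  \<comment> \<open>The annulus at scale \<open>2 powr (- k) * R\<close> contributes the volume
    ratio \<open>2 powr (- k * n)\<close> times the \<open>1 / p\<close>-th power of \<phi> at that
    scale, and \<phi> grows at most like \<open>2 powr (k * ?m)\<close>. Hence the terms decay like
    \<open>2 powr (- k * \<delta>)\<close>, and
    \<open>p * \<delta> = lam1 + lam2 * p - \<alpha> * \<kappa>\<close> is positive by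
    \<open>alpha_exponent\<close>.\<close>
  define \<delta> where "\<delta> = n + (lam1 - \<kappa> * (\<alpha> + n * p)) / p"
  have kn: "\<kappa> * n = n - lam2"
    using n by (simp add: kappa_eq n_def[symmetric] left_diff_distrib)
  have "p * \<delta> = p * n + (lam1 - \<kappa> * (\<alpha> + n * p))"
    using p by (simp add: \<delta>_def distrib_left)
  also have "\<kappa> * (\<alpha> + n * p) = \<alpha> * \<kappa> + (\<kappa> * n) * p"
    by (simp add: algebra_simps)
  finally have "p * \<delta> = lam1 + lam2 * p - \<alpha> * \<kappa>"
    unfolding kn by (simp add: algebra_simps)
  then have "0 < p * \<delta>" using alpha_exponent by simp
  then have \<delta>: "0 < \<delta>" using p by (simp add: zero_less_mult_iff)
  define \<rho> where "\<rho> = 2 powr (- \<delta>)"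
  have \<rho>: "0 < \<rho>" "\<rho> < 1"
    using \<delta> powr_less_mono[of "- \<delta>" 0 2] by (auto simp: \<rho>_def)
  define A0 where "A0 = C * 4 powr \<alpha> * C powr \<kappa>"
  have A0: "0 < A0" using D(3) by (simp add: A0_def)
  define A where "A = (1 / (1 - \<rho>)) powr p * A0"
  have "epowr (avg g 0 R) p \<le> ennreal (A * N * \<phi> 0 R)" if mb: "morrey_bound N g" and R: "0 < R" for N g R
  proof -
    have g [measurable]: "g \<in> borel_measurable lebesgue" and N: "0 \<le> N"
      using mb by (auto simp: morrey_bound_def)
    define r where "r k = R * 2 powr (- real k)" for k :: nat
    have r: "0 < r k" "r k \<le> R" for k
      using R powr_mono[of "- real k" 0 2] by (auto simp: r_def)
    define E :: "nat \<Rightarrow> 'a set" where "E k = ball 0 (r k) - ball 0 (r k / 2)" for k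
    have [measurable]: "E k \<in> sets lebesgue" for k unfolding E_def by simp
    define X where "X = (A0 * N * \<phi> 0 R) powr (1 / p)"
    have phi_k: "\<phi> 0 (r k) \<le> 2 powr (real k * ?m) * C powr \<kappa> * \<phi> 0 R" for k
    proof -
      define q where "q = C * 2 powr (real k * (\<alpha> + n * p))"
      have q: "0 < q" using D(3) by (simp add: q_def)
      have "R / r k = 2 powr real k"
        using R by (simp add: r_def powr_minus divide_inverse)
      then have "mass w 0 R \<le> C * (2 powr real k) powr (n * p) * mass w 0 (r k)"
        using muckenhoupt_doubling[OF mu, of 0 "r k" 0 R] r[of k] R by (simp add: subset_ball n_def)
      then have "R powr \<alpha> * mass w 0 R \<le> R powr \<alpha> * (C * (2 powr real k) powr (n * p) * mass w 0 (r k))"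
        by (intro mult_left_mono) auto
      also have Ra: "R powr \<alpha> = 2 powr (real k * \<alpha>) * r k powr \<alpha>"
      proof -
        have "r k powr \<alpha> = R powr \<alpha> * 2 powr (- (real k * \<alpha>))"
          by (simp add: r_def powr_mult powr_powr)
        then show ?thesis by (simp add: powr_minus)
      qed
      also have "2 powr (real k * \<alpha>) * r k powr \<alpha> * (C * (2 powr real k) powr (n * p) * mass w 0 (r k)) =
          q * (r k powr \<alpha> * mass w 0 (r k))"
        by (simp add: q_def powr_powr distrib_left powr_add)
      finally have "R powr \<alpha> * mass w 0 R \<le> q * (r k powr \<alpha> * mass w 0 (r k))"
        by (simp only: Ra)
      then have "U 0 R \<le> q * U 0 (r k)"
        using R r[of k] by (simp add: U_def max_def)
      then have "U 0 R / q \<le> U 0 (r k)"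
        using q by (simp add: field_simps)
      then have "U 0 (r k) powr (- \<kappa>) \<le> (U 0 R / q) powr (- \<kappa>)"
        using kappa(1) q U_pos[OF R, of 0] by (intro powr_mono2') auto
      also have "\<dots> = q powr \<kappa> * U 0 R powr (- \<kappa>)"
        using q U_pos[OF R, of 0] by (subst powr_divide) (auto simp: powr_minus divide_inverse)
      finally have "\<phi> 0 (r k) \<le> r k powr lam1 * (q powr \<kappa> * U 0 R powr (- \<kappa>))"
        unfolding \<phi>_def by (intro mult_left_mono) auto
      also have "\<dots> = 2 powr (- (real k * lam1)) * q powr \<kappa> * \<phi> 0 R"
        using R by (simp add: \<phi>_def r_def powr_mult powr_powr)
      also have "2 powr (- (real k * lam1)) * q powr \<kappa> = 2 powr (real k * ?m) * C powr \<kappa>"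
        using D(3) by (simp add: q_def powr_mult powr_powr) (simp add: algebra_simps powr_add[symmetric] powr_diff)
      finally show ?thesis .
    qed
    have term_k: "avg (\<lambda>y. g y * indicator (E k) y) 0 R \<le> ennreal (X * \<rho> ^ k)" for k
    proof -
      let ?h = "\<lambda>y. g y * indicator (E k) y"
      have "epowr (avg ?h 0 (r k)) p \<le> ennreal (C * 4 powr \<alpha> * N * \<phi> 0 (r k))"
        using r[of k] by (intro avg_away_from_0[OF mb]) (auto simp: E_def max_def)
      also have "\<dots> \<le> ennreal ((A0 * N * \<phi> 0 R) * 2 powr (real k * ?m))"
      proof (rule ennreal_leI)
        have "C * 4 powr \<alpha> * N * \<phi> 0 (r k) \<le> C * 4 powr \<alpha> * N *
            (2 powr (real k * ?m) * C powr \<kappa> * \<phi> 0 R)"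
          using phi_k[of k] D(3) N by (intro mult_left_mono) auto
        then show "C * 4 powr \<alpha> * N * \<phi> 0 (r k) \<le> (A0 * N * \<phi> 0 R) * 2 powr (real k * ?m)"
          by (simp add: A0_def ac_simps)
      qed
      finally have "avg ?h 0 (r k) \<le> ennreal (((A0 * N * \<phi> 0 R) * 2 powr (real k * ?m)) powr (1 / p))"
        using p A0 N phi_pos[OF R, of 0] by (subst (asm) epowr_le_ennreal_iff) auto
      also have "((A0 * N * \<phi> 0 R) * 2 powr (real k * ?m)) powr (1 / p) =
          X * 2 powr (real k * (?m / p))"
        using A0 N phi_pos[OF R, of 0] by (simp add: X_def powr_mult powr_powr)
      finally have a: "avg ?h 0 (r k) \<le> ennreal (X * 2 powr (real k * (?m / p)))" .
      have "avg ?h 0 R = ennreal (2 powr (- (real k * n))) * avg ?h 0 (r k)"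
      proof -
        have sub: "E k \<subseteq> ball 0 (r k)" "ball 0 (r k) \<subseteq> (ball 0 R :: 'a set)"
          using r[of k] by (auto simp: E_def)
        have i: "(\<integral>\<^sup>+y\<in>ball 0 s. ?h y \<partial>lebesgue) = (\<integral>\<^sup>+y. ?h y \<partial>lebesgue)" if "ball 0 (r k) \<subseteq> (ball 0 s :: 'a set)" for s
          using sub that by (intro nn_integral_cong) (auto simp: indicator_def)
        have "inverse (emeasure lebesgue (ball (0::'a) R)) = ennreal (2 powr (- (real k * n))) * inverse (emeasure lebesgue (ball (0::'a) (r k)))"
        proof -
          let ?u = "unit_ball_vol (real DIM('a))"
          have u: "0 < ?u" by simp
          have "inverse (?u * R ^ DIM('a)) = 2 powr (- (real k * n)) * inverse (?u * r k ^ DIM('a))"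
          proof -
            have "r k ^ DIM('a) = R ^ DIM('a) * 2 powr (- (real k * n))"
              by (simp add: r_def power_mult_distrib powr_power n_def mult.commute)
            then show ?thesis by (simp add: field_simps)
          qed
          then have "ennreal (inverse (?u * R ^ DIM('a))) =
              ennreal (2 powr (- (real k * n))) * ennreal (inverse (?u * r k ^ DIM('a)))"
            using r[of k] u by (metis ennreal_mult inverse_nonnegative_iff_nonnegative less_imp_le mult_nonneg_nonneg
                powr_ge_zero zero_le_power)
          moreover have "inverse (emeasure lebesgue (ball (0::'a) s)) = ennreal (inverse (?u * s ^ DIM('a)))" if "0 < s" for s
            using that u by (subst inverse_ennreal[symmetric]) (auto simp: emeasure_ball)
          ultimately show ?thesis
            using R r[of k] by (simp only:)
        qed
        then show ?thesis
          unfolding avg_def divide_ennreal_def i[OF subset_refl] i[OF sub(2)] by (simp add: ac_simps)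
      qed
      also have "\<dots> \<le> ennreal (2 powr (- (real k * n))) * ennreal (X * 2 powr (real k * (?m / p)))"
        by (rule mult_left_mono[OF a]) simp
      also have "\<dots> = ennreal (X * (2 powr (- (real k * n)) * 2 powr (real k * (?m / p))))"
        by (simp add: X_def ac_simps flip: ennreal_mult)
      also have "2 powr (- (real k * n)) * 2 powr (real k * (?m / p)) = \<rho> ^ k"
      proof -
        have "- (real k * n) + real k * (?m / p) = real k * - \<delta>"
          using p by (simp add: \<delta>_def field_simps)
        then show ?thesis
          by (simp only: powr_add[symmetric] \<rho>_def powr_power)
      qed
      finally show ?thesis .
    qed
    have "(\<integral>\<^sup>+y\<in>ball 0 R. g y \<partial>lebesgue) \<le> (\<integral>\<^sup>+y. (\<Sum>k. g y * indicator (E k) y * indicator (ball 0 R) y) \<partial>lebesgue)"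
    proof (rule nn_integral_mono_AE)
      have "AE y in lebesgue. y \<notin> {0::'a}"
        by (rule AE_not_in) (simp flip: negligible_iff_null_sets)
      then show "AE y in lebesgue. g y * indicator (ball 0 R) y \<le> (\<Sum>k. g y * indicator (E k) y * indicator (ball 0 R) y)"
      proof eventually_elim
        case (elim y)
        show ?case
        proof (cases "y \<in> ball 0 R")
          case True
          then obtain k where k: "R * 2 powr (- real k) / 2 \<le> norm y" "norm y < R * 2 powr (- real k)"
            using dyadic_annulus_cover[of y R] elim by auto
          then have "y \<in> E k" by (simp add: E_def r_def)
          then have "g y * indicator (ball 0 R) y = (\<Sum>j\<in>{k}. g y * indicator (E j) y * indicator (ball 0 R) y)"
            by simp
          also have "\<dots> \<le> (\<Sum>j. g y * indicator (E j) y * indicator (ball 0 R) y)"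
            by (rule sum_le_suminf) auto
          finally show ?thesis .
        qed simp
      qed
    qed
    also have "\<dots> = (\<Sum>k. \<integral>\<^sup>+y\<in>ball 0 R. (g y * indicator (E k) y) \<partial>lebesgue)"
      by (rule nn_integral_suminf) measurable
    finally have "avg g 0 R \<le> (\<Sum>k. \<integral>\<^sup>+y\<in>ball 0 R. (g y * indicator (E k) y) \<partial>lebesgue) / emeasure lebesgue (ball (0::'a) R)"
      unfolding avg_def by (rule divide_right_mono_ennreal)
    also have "\<dots> = (\<Sum>k. avg (\<lambda>y. g y * indicator (E k) y) 0 R)"
      unfolding avg_def divide_ennreal_def by (rule ennreal_suminf_multc[symmetric])
    also have "\<dots> \<le> (\<Sum>k. ennreal (X * \<rho> ^ k))"
      by (intro suminf_le term_k) auto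
    also have "\<dots> = ennreal (\<Sum>k. X * \<rho> ^ k)"
      using \<rho> by (intro suminf_ennreal2) (auto simp: X_def summable_geometric)
    also have "(\<Sum>k. X * \<rho> ^ k) = X * (1 / (1 - \<rho>))"
      using \<rho> by (simp add: suminf_mult suminf_geometric summable_geometric)
    finally have "epowr (avg g 0 R) p \<le> epowr (ennreal (X * (1 / (1 - \<rho>)))) p"
      using p by (intro epowr_mono) auto
    also have "\<dots> = ennreal ((X * (1 / (1 - \<rho>))) powr p)"
      using p \<rho> by (intro epowr_ennreal) (auto simp: X_def)
    also have "(X * (1 / (1 - \<rho>))) powr p = X powr p * (1 / (1 - \<rho>)) powr p"
      using \<rho> by (intro powr_mult)
    also have "X powr p = A0 * N * \<phi> 0 R"
      using p A0 N phi_pos[OF R, of 0] by (simp add: X_def powr_powr)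
    finally show ?thesis by (simp add: A_def ac_simps)
  qed
  moreover have "0 < A" using \<rho> A0 by (simp add: A_def)
  ultimately show ?thesis using that by blast
qed

text \<open>If \<open>r \<le> norm x / 2\<close>, the whole ball is away from the origin. Otherwise
  it lies in \<open>ball 0 (3 * r)\<close>, and \<open>\<phi> 0 (3 * r)\<close> is at most a
  multiple of \<open>\<phi> x r\<close>, because \<open>U\<close> increases in this passage and
  enters \<phi> with the exponent \<open>- \<kappa> \<le> 0\<close>.\<close>

lemma avg_bound:
  obtains A where "0 < A"
    "\<And>N g x r. morrey_bound N g \<Longrightarrow> 0 < r \<Longrightarrow> epowr (avg g x r) p \<le> ennreal (A * N * \<phi> x r)"
proof -
  obtain A1 where A1: "0 < A1"
    "\<And>N g R. morrey_bound N g \<Longrightarrow> 0 < R \<Longrightarrow> epowr (avg g 0 R) p \<le> ennreal (A1 * N * \<phi> 0 R)"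
    using avg_origin by blast
  let ?n = "DIM('a)"
  have p: "0 < p" using D(2) by simp
  define A2 where "A2 = (3 ^ ?n) powr p * A1 * 3 powr lam1"
  define A where "A = max (C * 4 powr \<alpha>) A2"
  have A: "0 < A" "C * 4 powr \<alpha> \<le> A" "A2 \<le> A" using D(3) by (auto simp: A_def less_max_iff_disj)
  have "epowr (avg g x r) p \<le> ennreal (A * N * \<phi> x r)" if mb: "morrey_bound N g" and r: "0 < r" for N g x r
  proof -
    have N: "0 \<le> N" using mb by (auto simp: morrey_bound_def)
    have ph: "0 < \<phi> x r" by (rule phi_pos[OF r])
    show ?thesis
    proof (cases "r \<le> norm x / 2")
      case True
      have "max (norm x) r / 2 \<le> norm y" if "y \<in> ball x r" for y
        using that True norm_triangle_sub[of x y] r by (auto simp: dist_norm max_def)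
      then have "epowr (avg (\<lambda>y. g y * indicator (ball x r) y) x r) p \<le> ennreal (C * 4 powr \<alpha> * N * \<phi> x r)"
        by (intro avg_away_from_0[OF mb r]) auto
      also have "avg (\<lambda>y. g y * indicator (ball x r) y) x r = avg g x r"
        by (rule avg_cong) simp
      also have "ennreal (C * 4 powr \<alpha> * N * \<phi> x r) \<le> ennreal (A * N * \<phi> x r)"
        using A N ph by (intro ennreal_leI mult_right_mono) auto
      finally show ?thesis .
    next
      case False
      have "avg g x r \<le> ennreal ((3 * r / r) ^ ?n) * avg g 0 (3 * r)"
        using False r by (intro avg_subset_le) (auto simp: ball_subset_ball_iff)
      then have "epowr (avg g x r) p \<le> epowr (ennreal (3 ^ ?n) * avg g 0 (3 * r)) p"
        using p r by (intro epowr_mono) auto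
      also have "\<dots> = ennreal ((3 ^ ?n) powr p) * epowr (avg g 0 (3 * r)) p"
        using p by (simp add: epowr_mult epowr_ennreal)
      also have "\<dots> \<le> ennreal ((3 ^ ?n) powr p) * ennreal (A1 * N * \<phi> 0 (3 * r))"
        using A1(2)[OF mb, of "3 * r"] r by (intro mult_left_mono) auto
      also have "\<dots> = ennreal ((3 ^ ?n) powr p * (A1 * N * \<phi> 0 (3 * r)))"
        using A1 N phi_pos[of "3 * r" 0] r by (intro ennreal_mult[symmetric]) auto
      also have "\<dots> \<le> ennreal (A * N * \<phi> x r)"
      proof (rule ennreal_leI)
        have "ball x r \<subseteq> ball 0 (3 * r)"
          using False r by (subst ball_subset_ball_iff) auto
        then have "mass w x r \<le> mass w 0 (3 * r)"
          by (rule mass_mono[OF D(1)])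
        moreover have "max (norm x) r powr \<alpha> \<le> max (norm (0::'a)) (3 * r) powr \<alpha>"
          using False r alpha by (intro powr_mono2) auto
        ultimately have "U x r \<le> U 0 (3 * r)"
          unfolding U_def by (intro mult_mono) auto
        then have "U 0 (3 * r) powr (- \<kappa>) \<le> U x r powr (- \<kappa>)"
          using kappa(1) U_pos[OF r, of x] by (intro powr_mono2') auto
        then have "\<phi> 0 (3 * r) \<le> (3 * r) powr lam1 * U x r powr (- \<kappa>)"
          unfolding \<phi>_def by (intro mult_left_mono) auto
        also have "\<dots> = 3 powr lam1 * \<phi> x r"
          using r by (simp add: \<phi>_def powr_mult)
        finally have "(3 ^ ?n) powr p * (A1 * N * \<phi> 0 (3 * r)) \<le> (3 ^ ?n) powr p * (A1 * N * (3 powr lam1 * \<phi> x r))"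
          using A1 N by (intro mult_left_mono) auto
        also have "\<dots> = A2 * (N * \<phi> x r)" by (simp add: A2_def)
        also have "\<dots> \<le> A * (N * \<phi> x r)"
          using A N ph by (intro mult_right_mono) auto
        finally show "(3 ^ ?n) powr p * (A1 * N * \<phi> 0 (3 * r)) \<le> A * N * \<phi> x r"
          by (simp add: mult.assoc)
      qed
      finally show ?thesis .
    qed
  qed
  then show ?thesis using that A(1) by blast
qed

text \<open>\<open>growth\<close> says this with \<open>mass w\<close> in place of \<open>U\<close>.
  The additional factor \<open>max (norm x) r powr \<alpha>\<close> increases with \<open>r\<close>
  and enters \<phi> with a nonpositive exponent, so it only helps.\<close>

lemma phi_mono:
  obtains K where "0 < K" "\<And>x r s. 0 < r \<Longrightarrow> r \<le> s \<Longrightarrow> \<phi> x s \<le> K * \<phi> x r"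
proof -
  obtain K where K: "0 < K" "\<And>x r s. 0 < r \<Longrightarrow> r \<le> s \<Longrightarrow>
      (s / r) powr lam1 * (mass w x r / mass w x s) powr \<kappa> \<le> K"
    using growth by blast
  have "\<phi> x s \<le> K * \<phi> x r" if r: "0 < r" and s: "r \<le> s" for x r s
  proof -
    let ?q = "mass w x r / mass w x s"
    have M: "0 < mass w x r" "0 < mass w x s" using mass_pos[OF D(1)] r s by auto
    have "max (norm x) r powr \<alpha> * mass w x s \<le> max (norm x) s powr \<alpha> * mass w x s"
      using r s alpha by (intro mult_right_mono powr_mono2) auto
    then have "U x r / ?q \<le> U x s"
      using M by (simp add: U_def)
    then have "U x s powr (- \<kappa>) \<le> (U x r / ?q) powr (- \<kappa>)"
      using kappa(1) M U_pos[OF r, of x] by (intro powr_mono2') auto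
    also have "\<dots> = ?q powr \<kappa> * U x r powr (- \<kappa>)"
      using M U_pos[OF r, of x] by (subst powr_divide) (auto simp: powr_minus divide_inverse)
    finally have "\<phi> x s \<le> s powr lam1 * (?q powr \<kappa> * U x r powr (- \<kappa>))"
      unfolding \<phi>_def by (intro mult_left_mono) auto
    also have "s powr lam1 = (s / r) powr lam1 * r powr lam1"
      using r s by (simp add: powr_divide)
    also have "(s / r) powr lam1 * r powr lam1 * (?q powr \<kappa> * U x r powr (- \<kappa>)) =
        ((s / r) powr lam1 * ?q powr \<kappa>) * \<phi> x r"
      by (simp add: \<phi>_def)
    also have "\<dots> \<le> K * \<phi> x r"
      using K(2)[OF r s, of x] phi_pos[OF r, of x] by (intro mult_right_mono) auto
    finally show ?thesis .
  qed
  then show ?thesis using that K(1) by blast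
qed

text \<open>The averages over larger concentric balls, needed in \<open>hl_local_split\<close>, are
  controlled by \<open>\<phi> x s\<close> for \<open>s \<ge> r\<close>, hence by
  \<open>\<phi> x r\<close>. The second summand is thus constant on the ball.\<close>

lemma hl_pointwise:
  obtains A where "0 < A"
    "\<And>N g x r y. morrey_bound N g \<Longrightarrow> y \<in> ball x r \<Longrightarrow>
      hl g y \<le> hl (\<lambda>u. g u * indicator (ball x (2 * r)) u) y + ennreal ((A * N * \<phi> x r) powr (1 / p))"
proof -
  have p: "0 < p" using D(2) by simp
  obtain A where A: "0 < A"
    "\<And>N g x r. morrey_bound N g \<Longrightarrow> 0 < r \<Longrightarrow> epowr (avg g x r) p \<le> ennreal (A * N * \<phi> x r)"
    using avg_bound by blast
  obtain K where K: "0 < K" "\<And>x r s. 0 < r \<Longrightarrow> r \<le> s \<Longrightarrow> \<phi> x s \<le> K * \<phi> x r"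
    using phi_mono by blast
  define B where "B = (4 ^ DIM('a)) powr p * (A * K)"
  have "hl g y \<le> hl (\<lambda>u. g u * indicator (ball x (2 * r)) u) y + ennreal ((B * N * \<phi> x r) powr (1 / p))"
    if mb: "morrey_bound N g" and y: "y \<in> ball x r" for N g x r y
  proof -
    have N: "0 \<le> N" using mb by (auto simp: morrey_bound_def)
    have r: "0 < r" using y by (auto intro: le_less_trans[OF zero_le_dist])
    have ph: "0 < \<phi> x r" by (rule phi_pos[OF r])
    let ?b = "(A * K * N * \<phi> x r) powr (1 / p)"
    have "avg g x s \<le> ennreal ?b" if s: "r \<le> s" for s
    proof -
      have "epowr (avg g x s) p \<le> ennreal (A * N * \<phi> x s)"
        using A(2)[OF mb] r s by auto
      also have "\<dots> \<le> ennreal (A * N * (K * \<phi> x r))"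
        using K(2)[OF r s, of x] A(1) N by (intro ennreal_leI mult_left_mono) auto
      finally have "epowr (avg g x s) p \<le> ennreal (A * K * N * \<phi> x r)"
        by (simp add: ac_simps)
      then show ?thesis
        using p A(1) K(1) N ph by (subst (asm) epowr_le_ennreal_iff) auto
    qed
    then have "hl g y \<le> hl (\<lambda>u. g u * indicator (ball x (2 * r)) u) y + ennreal (4 ^ DIM('a)) * ennreal ?b"
      by (rule hl_local_split[OF y])
    also have "ennreal (4 ^ DIM('a)) * ennreal ?b = ennreal (4 ^ DIM('a) * ?b)"
      by (simp add: ennreal_mult)
    also have "4 ^ DIM('a) * ?b = (B * N * \<phi> x r) powr (1 / p)"
    proof -
      have "B * N * \<phi> x r = (4 ^ DIM('a)) powr p * (A * K * N * \<phi> x r)"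
        by (simp add: B_def)
      then show ?thesis
        using p by (simp only: powr_mult) (simp add: powr_powr)
    qed
    finally show ?thesis .
  qed
  moreover have "0 < B" using A(1) K(1) by (simp add: B_def)
  ultimately show ?thesis using that by blast
qed

section \<open>The maximal function on balls far from the origin\<close>

text \<open>\<open>r \<le> norm x / 4\<close> keeps the doubled ball away from the origin:
  \<open>norm y \<ge> norm x / 2\<close> on \<open>ball x (2 * r)\<close>, while
  \<open>norm y \<le> 5 * norm x / 4\<close> on \<open>ball x r\<close>. Passing from
  \<open>v\<close> to \<open>w\<close> on the first and back on the second costs the quotient
  \<open>(5 / 2) powr \<alpha>\<close>. The prefactor is placed so that \<open>v_upper\<close> can
  be applied to the maximal function afterwards.\<close>

lemma far_local:
  obtains A where "0 < A"
    "\<And>N g x r. morrey_bound N g \<Longrightarrow> 0 < r \<Longrightarrow> r \<le> norm x / 4 \<Longrightarrow>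
      ennreal ((5 * norm x / 4) powr \<alpha>) * (\<integral>\<^sup>+y. epowr (g y * indicator (ball x (2 * r)) y) p \<partial>wm w)
      \<le> ennreal (A * N * (\<phi> x r * U x r))"
proof -
  have p: "0 < p" using D(2) by simp
  obtain K where K: "0 < K" "\<And>x r s. 0 < r \<Longrightarrow> r \<le> s \<Longrightarrow> \<phi> x s \<le> K * \<phi> x r"
    using phi_mono by blast
  define B where "B = C * 2 powr (real DIM('a) * p)"
  have B: "0 < B" using D(3) by (simp add: B_def)
  define A where "A = (5 / 2) powr \<alpha> * 2 powr \<alpha> * (K * B)"
  have "ennreal ((5 * norm x / 4) powr \<alpha>) * (\<integral>\<^sup>+y. epowr (g y * indicator (ball x (2 * r)) y) p \<partial>wm w)
      \<le> ennreal (A * N * (\<phi> x r * U x r))"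
    if mb: "morrey_bound N g" and r: "0 < r" "r \<le> norm x / 4" for N g x r
  proof -
    have g [measurable]: "g \<in> borel_measurable lebesgue" and N: "0 \<le> N"
      using mb by (auto simp: morrey_bound_def)
    have x: "0 < norm x" using r by linarith
    let ?I = "\<integral>\<^sup>+y. epowr (g y * indicator (ball x (2 * r)) y) p \<partial>wm w"
    have "?I = (\<integral>\<^sup>+y\<in>ball x (2 * r). epowr (g y) p \<partial>wm w)"
      using p by (intro nn_integral_cong) (auto simp: indicator_def)
    also have "\<dots> \<le> ennreal ((norm x / 2) powr (- \<alpha>)) * (\<integral>\<^sup>+y\<in>ball x (2 * r). epowr (g y) p \<partial>wm v)"
    proof (rule v_lower)
      show "norm x / 2 \<le> norm y" if "y \<in> ball x (2 * r)" for y
        using that r norm_triangle_sub[of x y] by (auto simp: dist_norm)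
    qed (use x in auto)
    also have "\<dots> \<le> ennreal ((norm x / 2) powr (- \<alpha>)) * ennreal (2 powr \<alpha> * N * (\<phi> x (2 * r) * U x (2 * r)))"
      using r by (intro mult_left_mono morrey_bound_U[OF mb]) auto
    finally have "ennreal ((5 * norm x / 4) powr \<alpha>) * ?I
        \<le> ennreal ((5 * norm x / 4) powr \<alpha>) * (ennreal ((norm x / 2) powr (- \<alpha>)) *
          ennreal (2 powr \<alpha> * N * (\<phi> x (2 * r) * U x (2 * r))))"
      by (rule mult_left_mono) simp
    also have "\<dots> = ennreal ((5 * norm x / 4) powr \<alpha> * ((norm x / 2) powr (- \<alpha>) *
          (2 powr \<alpha> * N * (\<phi> x (2 * r) * U x (2 * r)))))"
      using N phi_pos[of "2 * r" x] U_pos[of "2 * r" x] r by (simp add: ennreal_mult)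
    also have "\<dots> \<le> ennreal (A * N * (\<phi> x r * U x r))"
    proof (rule ennreal_leI)
      have "mass w x (2 * r) \<le> B * mass w x r"
        using muckenhoupt_doubling[OF mu, of x r x "2 * r"] r by (simp add: subset_ball B_def)
      then have "norm x powr \<alpha> * mass w x (2 * r) \<le> norm x powr \<alpha> * (B * mass w x r)"
        by (intro mult_left_mono) auto
      moreover have "max (norm x) (2 * r) = norm x" "max (norm x) r = norm x"
        using r by auto
      ultimately have "U x (2 * r) \<le> B * U x r"
        by (simp add: U_def mult.left_commute)
      then have "\<phi> x (2 * r) * U x (2 * r) \<le> (K * \<phi> x r) * (B * U x r)"
        using K(1) K(2)[of r "2 * r" x] r phi_pos[of r x] U_pos[of "2 * r" x] by (intro mult_mono) auto
      then have "(5 / 2) powr \<alpha> * 2 powr \<alpha> * N * (\<phi> x (2 * r) * U x (2 * r)) \<le>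
          (5 / 2) powr \<alpha> * 2 powr \<alpha> * N * ((K * \<phi> x r) * (B * U x r))"
        using N by (intro mult_left_mono) auto
      also have "\<dots> = A * N * (\<phi> x r * U x r)" by (simp add: A_def)
      also have "(5 / 2) powr \<alpha> = (5 * norm x / 4) powr \<alpha> * (norm x / 2) powr (- \<alpha>)"
      proof -
        have "(5 * norm x / 4) powr \<alpha> = (5 / 2) powr \<alpha> * (norm x / 2) powr \<alpha>"
          using x by (subst powr_mult[symmetric]) auto
        then show ?thesis using x by (simp add: powr_minus)
      qed
      finally show "(5 * norm x / 4) powr \<alpha> * ((norm x / 2) powr (- \<alpha>) *
          (2 powr \<alpha> * N * (\<phi> x (2 * r) * U x (2 * r)))) \<le> A * N * (\<phi> x r * U x r)"
        by (simp add: mult.assoc)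
    qed
    finally show ?thesis .
  qed
  moreover have "0 < A" using K(1) B by (simp add: A_def)
  ultimately show ?thesis using that by blast
qed

lemma mass_v_phi:
  assumes "0 < r" "0 \<le> B" "0 \<le> N"
  shows "ennreal (B * N * \<phi> x r) * emeasure (wm v) (ball x r) \<le> ennreal (2 powr \<alpha> * B * N * (\<phi> x r * U x r))"
proof -
  have "ennreal (B * N * \<phi> x r) * emeasure (wm v) (ball x r) = ennreal (B * N * \<phi> x r * mass v x r)"
    using assms phi_pos[of r x] weight_v by (simp add: emeasure_wm_ball ennreal_mult)
  also have "\<dots> \<le> ennreal (B * N * \<phi> x r * (2 powr \<alpha> * U x r))"
    using assms phi_pos[of r x] mass_v_le[of r x] by (intro ennreal_leI mult_left_mono) auto
  finally show ?thesis by (simp add: ac_simps)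
qed

lemma norm_le_far_ball: "r \<le> norm x / 4 \<Longrightarrow> y \<in> ball x r \<Longrightarrow> norm y \<le> 5 * norm x / 4"
  using norm_triangle_sub[of y x] by (auto simp: dist_norm norm_minus_commute)

text \<open>The strong type for \<open>w\<close> is a hypothesis here because the locale also covers
  \<open>p = 1\<close>. It is applied to the local part of \<open>g\<close>; the constant part is
  integrated by \<open>mass_v_phi\<close>.\<close>

lemma far_strong:
  assumes S: "0 < S" "\<And>g. g \<in> borel_measurable lebesgue \<Longrightarrow>
    (\<integral>\<^sup>+x. epowr (hl g x) p \<partial>wm w) \<le> ennreal S * (\<integral>\<^sup>+x. epowr (g x) p \<partial>wm w)"
  obtains A where "0 < A"
    "\<And>N g x r. morrey_bound N g \<Longrightarrow> 0 < r \<Longrightarrow> r \<le> norm x / 4 \<Longrightarrow>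
      (\<integral>\<^sup>+y\<in>ball x r. epowr (hl g y) p \<partial>wm v) \<le> ennreal (A * N * (\<phi> x r * U x r))"
proof -
  have p: "0 < p" using D(2) by simp
  obtain A1 where A1: "0 < A1"
    "\<And>N g x r. morrey_bound N g \<Longrightarrow> 0 < r \<Longrightarrow> r \<le> norm x / 4 \<Longrightarrow>
      ennreal ((5 * norm x / 4) powr \<alpha>) * (\<integral>\<^sup>+y. epowr (g y * indicator (ball x (2 * r)) y) p \<partial>wm w)
      \<le> ennreal (A1 * N * (\<phi> x r * U x r))"
    using far_local by blast
  obtain B where B: "0 < B"
    "\<And>N g x r y. morrey_bound N g \<Longrightarrow> y \<in> ball x r \<Longrightarrow>
      hl g y \<le> hl (\<lambda>u. g u * indicator (ball x (2 * r)) u) y + ennreal ((B * N * \<phi> x r) powr (1 / p))"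
    using hl_pointwise by blast
  define A where "A = 2 powr p * (S * A1 + 2 powr \<alpha> * B)"
  have "(\<integral>\<^sup>+y\<in>ball x r. epowr (hl g y) p \<partial>wm v) \<le> ennreal (A * N * (\<phi> x r * U x r))"
    if mb: "morrey_bound N g" and r: "0 < r" "r \<le> norm x / 4" for N g x r
  proof -
    have g [measurable]: "g \<in> borel_measurable lebesgue" and N: "0 \<le> N"
      using mb by (auto simp: morrey_bound_def)
    have [measurable]: "ball x r \<in> sets (wm v)" by simp
    have ph: "0 < \<phi> x r" and Up: "0 < U x r" using phi_pos U_pos r by auto
    let ?m = "(5 * norm x / 4) powr \<alpha>"
    define h where "h u = g u * indicator (ball x (2 * r)) u" for u
    have [measurable]: "h \<in> borel_measurable lebesgue" unfolding h_def by measurable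
    let ?Q = "\<phi> x r * U x r"
    have "(\<integral>\<^sup>+y\<in>ball x r. epowr (hl g y) p \<partial>wm v) \<le>
        (\<integral>\<^sup>+y. ennreal (2 powr p) * (epowr (hl h y) p * indicator (ball x r) y + ennreal (B * N * \<phi> x r) * indicator (ball x r) y) \<partial>wm v)"
    proof (intro nn_integral_mono)
      fix y
      show "epowr (hl g y) p * indicator (ball x r) y \<le>
          ennreal (2 powr p) * (epowr (hl h y) p * indicator (ball x r) y + ennreal (B * N * \<phi> x r) * indicator (ball x r) y)"
      proof (cases "y \<in> ball x r")
        case True
        have "epowr (hl g y) p \<le> epowr (hl h y + ennreal ((B * N * \<phi> x r) powr (1 / p))) p"
          using B(2)[OF mb True] p unfolding h_def by (intro epowr_mono) auto
        also have "\<dots> \<le> ennreal (2 powr p) * (epowr (hl h y) p + epowr (ennreal ((B * N * \<phi> x r) powr (1 / p))) p)"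
          by (rule epowr_add_le[OF p])
        also have "epowr (ennreal ((B * N * \<phi> x r) powr (1 / p))) p = ennreal (B * N * \<phi> x r)"
          using p B(1) N ph by (simp add: epowr_ennreal powr_powr)
        finally show ?thesis using True by simp
      qed simp
    qed
    also have "\<dots> = ennreal (2 powr p) * ((\<integral>\<^sup>+y\<in>ball x r. epowr (hl h y) p \<partial>wm v) + ennreal (B * N * \<phi> x r) * emeasure (wm v) (ball x r))"
      by (simp add: nn_integral_cmult nn_integral_add)
    also have "\<dots> \<le> ennreal (2 powr p) * (ennreal (S * A1 * N * ?Q) + ennreal (2 powr \<alpha> * B * N * ?Q))"
    proof (intro mult_left_mono add_mono)
      show "ennreal (B * N * \<phi> x r) * emeasure (wm v) (ball x r) \<le> ennreal (2 powr \<alpha> * B * N * ?Q)"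
        using r B(1) N by (intro mass_v_phi) auto
      have "(\<integral>\<^sup>+y\<in>ball x r. epowr (hl h y) p \<partial>wm v) \<le> ennreal ?m * (\<integral>\<^sup>+y\<in>ball x r. epowr (hl h y) p \<partial>wm w)"
        using norm_le_far_ball[OF r(2)] by (intro v_upper) auto
      also have "\<dots> \<le> ennreal ?m * (\<integral>\<^sup>+y. epowr (hl h y) p \<partial>wm w)"
        by (intro mult_left_mono nn_integral_mono) (auto simp: indicator_def)
      also have "\<dots> \<le> ennreal ?m * (ennreal S * (\<integral>\<^sup>+y. epowr (h y) p \<partial>wm w))"
        by (intro mult_left_mono S(2)) auto
      also have "\<dots> = ennreal S * (ennreal ?m * (\<integral>\<^sup>+y. epowr (h y) p \<partial>wm w))"
        by (simp only: ac_simps)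
      also have "\<dots> \<le> ennreal S * ennreal (A1 * N * ?Q)"
        using A1(2)[OF mb r] unfolding h_def by (intro mult_left_mono) auto
      also have "\<dots> = ennreal (S * (A1 * N * ?Q))"
        using S(1) A1(1) N ph Up by (intro ennreal_mult[symmetric]) auto
      finally show "(\<integral>\<^sup>+y\<in>ball x r. epowr (hl h y) p \<partial>wm v) \<le> ennreal (S * A1 * N * ?Q)"
        by (simp add: mult.assoc)
    qed auto
    also have "\<dots> = ennreal (2 powr p * (S * A1 * N * ?Q + 2 powr \<alpha> * B * N * ?Q))"
      using S(1) A1(1) B(1) N ph Up by (simp add: ennreal_mult ennreal_plus)
    also have "2 powr p * (S * A1 * N * ?Q + 2 powr \<alpha> * B * N * ?Q) = A * N * ?Q"
      by (simp add: A_def algebra_simps)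
    finally show ?thesis .
  qed
  moreover have "0 < A" using S(1) A1(1) B(1) by (simp add: A_def add_pos_pos)
  ultimately show ?thesis using that by blast
qed

lemma far_weak:
  obtains A where "0 < A"
    "\<And>N g x r t. morrey_bound N g \<Longrightarrow> 0 < r \<Longrightarrow> r \<le> norm x / 4 \<Longrightarrow> 0 < t \<Longrightarrow>
      ennreal (t powr p) * emeasure (wm v) {y \<in> ball x r. ennreal t < hl g y} \<le> ennreal (A * N * (\<phi> x r * U x r))"
proof -
  have p: "0 < p" using D(2) by simp
  obtain A1 where A1: "0 < A1"
    "\<And>N g x r. morrey_bound N g \<Longrightarrow> 0 < r \<Longrightarrow> r \<le> norm x / 4 \<Longrightarrow>
      ennreal ((5 * norm x / 4) powr \<alpha>) * (\<integral>\<^sup>+y. epowr (g y * indicator (ball x (2 * r)) y) p \<partial>wm w)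
      \<le> ennreal (A1 * N * (\<phi> x r * U x r))"
    using far_local by blast
  obtain B where B: "0 < B"
    "\<And>N g x r y. morrey_bound N g \<Longrightarrow> y \<in> ball x r \<Longrightarrow>
      hl g y \<le> hl (\<lambda>u. g u * indicator (ball x (2 * r)) u) y + ennreal ((B * N * \<phi> x r) powr (1 / p))"
    using hl_pointwise by blast
  define S where "S = C * C * 5 powr (real DIM('a) * p)"
  have S: "0 < S" using D(3) by (simp add: S_def)
  define A where "A = 2 powr p * (S * A1 + 2 powr \<alpha> * B)"
  have "ennreal (t powr p) * emeasure (wm v) {y \<in> ball x r. ennreal t < hl g y} \<le> ennreal (A * N * (\<phi> x r * U x r))"
    if mb: "morrey_bound N g" and r: "0 < r" "r \<le> norm x / 4" and t: "0 < t" for N g x r t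
  proof -
    have g [measurable]: "g \<in> borel_measurable lebesgue" and N: "0 \<le> N"
      using mb by (auto simp: morrey_bound_def)
    have ph: "0 < \<phi> x r" and Up: "0 < U x r" using phi_pos U_pos r by auto
    let ?m = "(5 * norm x / 4) powr \<alpha>"
    define h where "h u = g u * indicator (ball x (2 * r)) u" for u
    have [measurable]: "h \<in> borel_measurable lebesgue" unfolding h_def by measurable
    let ?Q = "\<phi> x r * U x r" and ?b = "(B * N * \<phi> x r) powr (1 / p)"
    have Q: "0 < ?Q" using ph Up by simp
    have AQ: "A * N * ?Q = 2 powr p * S * (A1 * N * ?Q) + 2 powr p * (2 powr \<alpha> * B * N * ?Q)"
      by (simp add: A_def algebra_simps)
    let ?L = "{y \<in> ball x r. ennreal t < hl g y}"
    \<comment> \<open>\<open>?b\<close> bounds the contribution of distant balls. If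
      \<open>t \<le> 2 * ?b\<close>, the level set is estimated by the whole ball; otherwise
      \<open>hl g y > t\<close> forces the local part above \<open>t / 2\<close>, and the weak type
      for \<open>w\<close> applies.\<close>
    show ?thesis
    proof (cases "t \<le> 2 * ?b")
      case True
      have "t powr p \<le> (2 * ?b) powr p" using True t p by (intro powr_mono2) auto
      also have "\<dots> = 2 powr p * (B * N * \<phi> x r)"
        using p B(1) N ph by (simp only: powr_mult[of 2]) (simp add: powr_powr)
      finally have "ennreal (t powr p) * emeasure (wm v) ?L \<le> ennreal (2 powr p * (B * N * \<phi> x r)) * emeasure (wm v) (ball x r)"
        by (intro mult_mono emeasure_mono ennreal_leI) auto
      also have "\<dots> = ennreal (2 powr p) * (ennreal (B * N * \<phi> x r) * emeasure (wm v) (ball x r))"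
        using B(1) N ph by (subst ennreal_mult) (auto simp: mult.assoc)
      also have "\<dots> \<le> ennreal (2 powr p) * ennreal (2 powr \<alpha> * B * N * ?Q)"
        using r B(1) N by (intro mult_left_mono mass_v_phi) auto
      also have "\<dots> = ennreal (2 powr p * (2 powr \<alpha> * B * N * ?Q))"
        using B(1) N Q by (intro ennreal_mult[symmetric]) auto
      also have "\<dots> \<le> ennreal (A * N * ?Q)"
        unfolding AQ using S A1(1) N Q by (intro ennreal_leI) simp
      finally show ?thesis .
    next
      case False
      have sub: "?L \<subseteq> {y \<in> ball x r. ennreal (t / 2) < hl h y}"
      proof
        fix y assume "y \<in> ?L"
        then have y: "y \<in> ball x r" "ennreal t < hl g y" by auto
        have "ennreal (t / 2) < hl h y"
        proof (rule ccontr)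
          assume "\<not> ennreal (t / 2) < hl h y"
          then have "hl h y + ennreal ?b \<le> ennreal (t / 2) + ennreal (t / 2)"
            using False by (intro add_mono ennreal_leI) auto
          also have "\<dots> = ennreal t"
            using t by (simp flip: ennreal_plus)
          finally have "hl g y \<le> ennreal t"
            using B(2)[OF mb y(1)] unfolding h_def by (rule order_trans[rotated])
          then show False using y(2) by simp
        qed
        with y show "y \<in> {y \<in> ball x r. ennreal (t / 2) < hl h y}" by simp
      qed
      have ms: "{y \<in> ball x r. ennreal (t / 2) < hl h y} \<in> sets lebesgue" by measurable
      have "emeasure (wm v) ?L \<le> emeasure (wm v) {y \<in> ball x r. ennreal (t / 2) < hl h y}"
        using sub ms by (intro emeasure_mono) auto
      also have "\<dots> \<le> ennreal ?m * emeasure (wm w) {y \<in> ball x r. ennreal (t / 2) < hl h y}"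
        using norm_le_far_ball[OF r(2)] ms by (intro v_upper_emeasure) auto
      also have "\<dots> \<le> ennreal ?m * emeasure (wm w) {y. ennreal (t / 2) < hl h y}"
        using open_hl_greater[of "ennreal (t / 2)" h] by (intro mult_left_mono emeasure_mono) auto
      finally have "ennreal (t powr p) * emeasure (wm v) ?L \<le>
          ennreal (t powr p) * (ennreal ?m * emeasure (wm w) {y. ennreal (t / 2) < hl h y})"
        by (rule mult_left_mono) simp
      also have "ennreal (t powr p) * (ennreal ?m * emeasure (wm w) {y. ennreal (t / 2) < hl h y})
        = ennreal (2 powr p) * ennreal ?m * (ennreal ((t / 2) powr p) * emeasure (wm w) {y. ennreal (t / 2) < hl h y})"
      proof -
        have "ennreal (t powr p) = ennreal (2 powr p) * ennreal ((t / 2) powr p)"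
          using t by (simp add: powr_divide flip: ennreal_mult)
        then show ?thesis by (simp only: ac_simps)
      qed
      also have "\<dots> \<le> ennreal (2 powr p) * ennreal ?m * (ennreal S * (\<integral>\<^sup>+y. epowr (h y) p \<partial>wm w))"
        unfolding S_def using t by (intro mult_left_mono muckenhoupt_weak_type[OF mu]) auto
      also have "\<dots> = ennreal (2 powr p) * ennreal S * (ennreal ?m * (\<integral>\<^sup>+y. epowr (h y) p \<partial>wm w))"
        by (simp only: ac_simps)
      also have "\<dots> \<le> ennreal (2 powr p) * ennreal S * ennreal (A1 * N * ?Q)"
        using A1(2)[OF mb r] unfolding h_def by (intro mult_left_mono) auto
      also have "\<dots> = ennreal (2 powr p * S * (A1 * N * ?Q))"
        using S A1(1) N Q by (simp add: ennreal_mult)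
      also have "\<dots> \<le> ennreal (A * N * ?Q)"
        unfolding AQ using B(1) N Q by (intro ennreal_leI) (simp add: mult.assoc)
      finally show ?thesis .
    qed
  qed
  moreover have "0 < A" using S A1(1) B(1) by (simp add: A_def add_pos_pos)
  ultimately show ?thesis using that by blast
qed

section \<open>From far balls to all balls\<close>

text \<open>
  Balls centred at the origin are covered by dyadic annuli, and each annulus by a bounded
  number of far balls; the exponent \<open>lam1 + lam2 * (\<alpha> / n + \<theta>) > 0\<close> makes the series converge.
\<close>
lemma far_to_all_balls:
  obtains A where "0 < A"
    "\<And>\<Psi> N x r. sets \<Psi> = sets lebesgue \<Longrightarrow> emeasure \<Psi> {0} = 0 \<Longrightarrow> 0 \<le> N \<Longrightarrow>
      (\<And>x r. 0 < r \<Longrightarrow> r \<le> norm x / 4 \<Longrightarrow> emeasure \<Psi> (ball x r) \<le> ennreal (N * (\<phi> x r * U x r))) \<Longrightarrow>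
      0 < r \<Longrightarrow> emeasure \<Psi> (ball x r) \<le> ennreal (A * N * (\<phi> x r * U x r))"
proof -
  define n where "n = real DIM('a)"
  have n: "0 < n" by (simp add: n_def)
  define e where "e = lam2 / n"
  have e: "0 \<le> e" using lam2 n by (simp add: e_def)
  let ?d = "e * (\<alpha> + n * \<theta>)"
  have Q: "\<phi> x r * U x r = r powr lam1 * U x r powr e" if "0 < r" for x r
    using phi_mult_U[OF that] by (simp add: e_def n_def)
  define \<beta> where "\<beta> = lam1 + e * (\<alpha> + n * \<theta>)"
  have "\<beta> = (lam1 + lam2 * \<theta>) + e * \<alpha>"
    using n by (simp add: \<beta>_def e_def distrib_left)
  then have \<beta>: "0 < \<beta>" using theta e alpha by (simp add: add_pos_nonneg)
  define \<rho> where "\<rho> = 2 powr (- \<beta>)"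
  have \<rho>: "0 < \<rho>" "\<rho> < 1"
    using \<beta> powr_less_mono[of "- \<beta>" 0 2] by (auto simp: \<rho>_def)
  \<comment> \<open>A finite net of the unit annulus, rescaled by \<open>s k\<close>, covers each
    dyadic annulus with the same number of balls. The radius 1/8 is a quarter of the least norm 1/2
    of a centre, so the rescaled balls are far.\<close>
  have "compact (cball (0::'a) 1 - ball 0 (1 / 2))"
    by (simp add: compact_diff)
  then obtain F where F: "F \<subseteq> cball (0::'a) 1 - ball 0 (1 / 2)" "finite F"
    "cball (0::'a) 1 - ball 0 (1 / 2) \<subseteq> (\<Union>z\<in>F. ball z (1 / 8))"
    by (rule compactE_image[where f = "\<lambda>z. ball z (1 / 8)" and C = "cball (0::'a) 1 - ball 0 (1 / 2)"]) force+
  \<comment> \<open>\<open>decay\<close> compares only distinct radii; \<open>c' \<ge> 1\<close>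
    also covers the outermost annulus.\<close>
  define c' where "c' = max c 1"
  have c': "1 \<le> c'" "c \<le> c'" by (auto simp: c'_def)
  define B where "B = C * 2 powr (n * p)"
  have B: "0 < B" using D(3) by (simp add: B_def)
  define A1 where "A1 = real (card F) * (8 powr (- lam1) * (c' * B) powr e) * (1 / (1 - \<rho>))"
  have A1: "0 \<le> A1" using \<rho> by (simp add: A1_def)
  define B5 where "B5 = 5 powr \<alpha> * (C * 5 powr (n * p))"
  have B5: "0 < B5" using D(3) by (simp add: B5_def)
  define A where "A = A1 * (5 powr lam1 * B5 powr e) + 1"
  have A: "0 < A" using A1 by (simp add: A_def add_nonneg_pos)
  \<comment> \<open>\<Psi> will have as density with respect to \<open>v\<close> either
    \<open>(M f)\<^sup>p\<close> or \<open>t\<^sup>p\<close> times the indicator of a level set of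
    \<open>M f\<close>. The summation uses monotonicity, countable subadditivity and
    \<open>emeasure \<Psi> {0} = 0\<close>, so the strong and the weak estimate share it.\<close>
  have all: "emeasure \<Psi> (ball x r) \<le> ennreal (A * N * (\<phi> x r * U x r))"
    if sets: "sets \<Psi> = sets lebesgue" and z0: "emeasure \<Psi> {0} = 0" and N: "0 \<le> N"
      and far: "\<And>x r. 0 < r \<Longrightarrow> r \<le> norm x / 4 \<Longrightarrow> emeasure \<Psi> (ball x r) \<le> ennreal (N * (\<phi> x r * U x r))"
      and r: "0 < r" for \<Psi> N x r
  proof -
    have origin: "emeasure \<Psi> (ball 0 R) \<le> ennreal (A1 * N * (\<phi> 0 R * U 0 R))" if R: "0 < R" for R
    proof -
      define s where "s k = R * 2 powr (- real k)" for k :: nat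
      have s: "0 < s k" "s k \<le> R" for k
        using R powr_mono[of "- real k" 0 2] by (auto simp: s_def)
      have s_powr: "s k powr a = R powr a * 2 powr (- (real k * a))" for k a
        by (simp add: s_def powr_mult powr_powr)
      define E :: "nat \<Rightarrow> 'a set" where "E k = ball 0 (s k) - ball 0 (s k / 2)" for k
      define X where "X = N * (8 powr (- lam1) * (c' * B) powr e) * (R powr lam1 * U 0 R powr e)"
      have X: "0 \<le> X" using N by (simp add: X_def)
      have piece: "emeasure \<Psi> (ball (s k *\<^sub>R z) (s k / 8)) \<le> ennreal (X * \<rho> ^ k)" if z: "z \<in> F" for k z
      proof -
        have nz: "1 / 2 \<le> norm z" "norm z \<le> 1" using F(1) z by auto
        have nsz: "norm (s k *\<^sub>R z) = s k * norm z" using s[of k] by simp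
        have "s k / 8 \<le> norm (s k *\<^sub>R z) / 4"
          unfolding nsz using mult_left_mono[OF nz(1), of "s k"] s[of k] by simp
        then have "emeasure \<Psi> (ball (s k *\<^sub>R z) (s k / 8)) \<le>
            ennreal (N * (\<phi> (s k *\<^sub>R z) (s k / 8) * U (s k *\<^sub>R z) (s k / 8)))"
          using s[of k] by (intro far) auto
        also have "\<dots> \<le> ennreal (X * \<rho> ^ k)"
        proof (rule ennreal_leI)
          have le: "norm (s k *\<^sub>R z) \<le> s k"
            unfolding nsz using mult_left_mono[OF nz(2), of "s k"] s[of k] by simp
          have "dist (s k *\<^sub>R z) 0 + s k / 8 \<le> 2 * s k"
            unfolding dist_norm diff_zero using le s[of k] by linarith
          then have "ball (s k *\<^sub>R z) (s k / 8) \<subseteq> ball 0 (2 * s k)"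
            unfolding ball_subset_ball_iff by blast
          then have "mass w (s k *\<^sub>R z) (s k / 8) \<le> mass w 0 (2 * s k)"
            by (rule mass_mono[OF D(1)])
          \<comment> \<open>The small ball may stick out of \<open>ball 0 (s k)\<close>, hence the
            factor 2. \<open>decay\<close> compares \<open>2 * s k\<close> with
            \<open>2 * R\<close>, and doubling then returns to \<open>R\<close>.\<close>
          also have "\<dots> \<le> c' * 2 powr (- (real k * (n * \<theta>))) * mass w 0 (2 * R)"
          proof (cases "k = 0")
            case True
            then have "s k = R" by (simp add: s_def)
            then show ?thesis using c' True mult_right_mono[of 1 c' "mass w 0 (2 * R)"] by simp
          next
            case False
            then have "s k < R" using R powr_less_mono[of "- real k" 0 2] by (simp add: s_def)
            then have "mass w 0 (2 * s k) \<le> c * (2 * s k / (2 * R)) powr (n * \<theta>) * mass w 0 (2 * R)"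
              using decay[of "2 * s k" "2 * R"] s[of k] by (simp add: n_def)
            also have "2 * s k / (2 * R) = 2 powr (- real k)" using R by (simp add: s_def)
            also have "c * (2 powr (- real k)) powr (n * \<theta>) * mass w 0 (2 * R) \<le>
                c' * (2 powr (- real k)) powr (n * \<theta>) * mass w 0 (2 * R)"
              using c' by (intro mult_right_mono) auto
            finally show ?thesis by (simp add: powr_powr)
          qed
          also have "\<dots> \<le> c' * 2 powr (- (real k * (n * \<theta>))) * (B * mass w 0 R)"
            using muckenhoupt_doubling[OF mu, of 0 R 0 "2 * R"] R c'
            by (intro mult_left_mono) (auto simp: subset_ball B_def n_def)
          finally have "U (s k *\<^sub>R z) (s k / 8) \<le> s k powr \<alpha> * (c' * 2 powr (- (real k * (n * \<theta>))) * (B * mass w 0 R))"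
            unfolding U_def using le s[of k] alpha by (intro mult_mono powr_mono2) auto
          also have "\<dots> = c' * B * 2 powr (- (real k * (\<alpha> + n * \<theta>))) * U 0 R"
          proof -
            have "2 powr (- (real k * \<alpha>)) * 2 powr (- (real k * (n * \<theta>))) = 2 powr (- (real k * (\<alpha> + n * \<theta>)))"
              by (simp add: distrib_left powr_diff powr_minus divide_inverse powr_add)
            moreover have "max (norm (0::'a)) R = R" using R by simp
            ultimately show ?thesis
              unfolding s_powr U_def by (simp add: mult.assoc[symmetric])
          qed
          finally have "U (s k *\<^sub>R z) (s k / 8) powr e \<le> (c' * B * 2 powr (- (real k * (\<alpha> + n * \<theta>))) * U 0 R) powr e"
            using e U_pos[of "s k / 8" "s k *\<^sub>R z"] s[of k] by (intro powr_mono2) auto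
          also have "\<dots> = (c' * B) powr e * 2 powr (- (real k * ?d)) * U 0 R powr e"
          proof -
            have "(2 powr (- (real k * (\<alpha> + n * \<theta>)))) powr e = 2 powr (- (real k * ?d))"
              unfolding powr_powr by (rule arg_cong[where f = "(powr) 2"]) (simp only: ac_simps mult_minus_left)
            then show ?thesis by (simp only: powr_mult)
          qed
          finally have U8: "U (s k *\<^sub>R z) (s k / 8) powr e \<le>
              (c' * B) powr e * 2 powr (- (real k * ?d)) * U 0 R powr e" .
          have s8: "(s k / 8) powr lam1 = 8 powr (- lam1) * (R powr lam1 * 2 powr (- (real k * lam1)))"
            unfolding powr_divide s_powr powr_minus_divide[of 8 lam1] by (simp only: times_divide_eq_left mult_1)
          have "(s k / 8) powr lam1 * U (s k *\<^sub>R z) (s k / 8) powr e \<le>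
              (s k / 8) powr lam1 * ((c' * B) powr e * 2 powr (- (real k * ?d)) * U 0 R powr e)"
            using U8 by (rule mult_left_mono) simp
          also have "(s k / 8) powr lam1 *
              ((c' * B) powr e * 2 powr (- (real k * ?d)) * U 0 R powr e) =
              8 powr (- lam1) * (c' * B) powr e * (R powr lam1 * U 0 R powr e) *
              (2 powr (- (real k * lam1)) * 2 powr (- (real k * ?d)))"
            by (simp only: s8 ac_simps)
          also have "2 powr (- (real k * lam1)) * 2 powr (- (real k * ?d)) = \<rho> ^ k"
          proof -
            have "- (real k * lam1) + - (real k * ?d) = real k * - \<beta>"
              by (simp add: \<beta>_def algebra_simps)
            then show ?thesis by (simp only: powr_add[symmetric] \<rho>_def powr_power)
          qed
          finally have "N * ((s k / 8) powr lam1 * U (s k *\<^sub>R z) (s k / 8) powr e) \<le>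
             N * (8 powr (- lam1) * (c' * B) powr e * (R powr lam1 * U 0 R powr e) * \<rho> ^ k)"
            using N by (rule mult_left_mono)
          then show "N * (\<phi> (s k *\<^sub>R z) (s k / 8) * U (s k *\<^sub>R z) (s k / 8)) \<le> X * \<rho> ^ k"
            using s[of k] by (simp add: Q X_def mult.assoc)
        qed
        finally show ?thesis .
      qed
      have EF: "E k \<subseteq> (\<Union>z\<in>F. ball (s k *\<^sub>R z) (s k / 8))" for k
      proof
        fix y assume "y \<in> E k"
        then have y: "norm y < s k" "s k / 2 \<le> norm y" by (auto simp: E_def)
        then have "y /\<^sub>R s k \<in> cball (0::'a) 1 - ball 0 (1 / 2)"
          using s[of k] by (auto simp: field_simps)
        then have "y /\<^sub>R s k \<in> (\<Union>z\<in>F. ball z (1 / 8))" by (rule subsetD[OF F(3)])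
        then obtain z where z: "z \<in> F" "dist z (y /\<^sub>R s k) < 1 / 8" by (meson UN_E mem_ball)
        have "s k *\<^sub>R z - y = s k *\<^sub>R (z - y /\<^sub>R s k)"
          using s[of k] by (simp add: scaleR_diff_right)
        then have "dist (s k *\<^sub>R z) y = s k * dist z (y /\<^sub>R s k)"
          using s[of k] by (simp add: dist_norm)
        also have "\<dots> < s k / 8"
          using mult_strict_left_mono[OF z(2), of "s k"] s[of k] by simp
        finally show "y \<in> (\<Union>z\<in>F. ball (s k *\<^sub>R z) (s k / 8))" using z by auto
      qed
      have [measurable]: "E k \<in> sets \<Psi>" for k unfolding E_def sets by simp
      have ann: "emeasure \<Psi> (E k) \<le> ennreal (real (card F) * X * \<rho> ^ k)" for k
      proof -
        have "emeasure \<Psi> (E k) \<le> emeasure \<Psi> (\<Union>z\<in>F. ball (s k *\<^sub>R z) (s k / 8))"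
          using EF F(2) by (intro emeasure_mono) (auto simp: sets)
        also have "\<dots> \<le> (\<Sum>z\<in>F. emeasure \<Psi> (ball (s k *\<^sub>R z) (s k / 8)))"
          using F(2) by (intro emeasure_subadditive_finite) (auto simp: sets)
        also have "\<dots> \<le> (\<Sum>z\<in>F. ennreal (X * \<rho> ^ k))"
          by (intro sum_mono piece)
        also have "\<dots> = ennreal (\<Sum>z\<in>F. X * \<rho> ^ k)"
          using X \<rho> by (intro sum_ennreal) auto
        finally show ?thesis by (simp add: mult.assoc)
      qed
      have UE: "{0} \<in> sets \<Psi>" "(\<Union>k. E k) \<in> sets \<Psi>"
        by (simp add: sets, measurable)
      have "ball (0::'a) R \<subseteq> {0} \<union> (\<Union>k. E k)"
      proof
        fix y :: 'a assume y: "y \<in> ball 0 R"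
        show "y \<in> {0} \<union> (\<Union>k. E k)"
        proof (cases "y = 0")
          case False
          then obtain k where "s k / 2 \<le> norm y" "norm y < s k"
            using dyadic_annulus_cover[of y R] y unfolding s_def by auto
          then have "y \<in> E k" by (simp add: E_def)
          then show ?thesis by blast
        qed simp
      qed
      then have "emeasure \<Psi> (ball 0 R) \<le> emeasure \<Psi> ({0} \<union> (\<Union>k. E k))"
        using UE by (intro emeasure_mono sets.Un) auto
      also have "\<dots> \<le> emeasure \<Psi> {0} + emeasure \<Psi> (\<Union>k. E k)"
        using UE by (intro emeasure_subadditive) auto
      also have "\<dots> \<le> (\<Sum>k. emeasure \<Psi> (E k))"
        unfolding z0 by (simp, intro emeasure_subadditive_countably) auto
      also have "\<dots> \<le> (\<Sum>k. ennreal (real (card F) * X * \<rho> ^ k))"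
        by (intro suminf_le ann) auto
      also have "\<dots> = ennreal (\<Sum>k. real (card F) * X * \<rho> ^ k)"
        using \<rho> X by (intro suminf_ennreal2) (auto simp: summable_geometric intro!: summable_mult)
      also have "(\<Sum>k. real (card F) * X * \<rho> ^ k) = real (card F) * X * (1 / (1 - \<rho>))"
        using \<rho> by (simp add: suminf_mult suminf_geometric summable_geometric)
      also have "\<dots> = A1 * N * (\<phi> 0 R * U 0 R)"
        unfolding Q[OF R] by (simp add: X_def A1_def)
      finally show ?thesis .
    qed
    have Qp: "0 < \<phi> x r * U x r" using phi_pos[OF r] U_pos[OF r] by simp
    show ?thesis
    proof (cases "r \<le> norm x / 4")
      case True
      have "emeasure \<Psi> (ball x r) \<le> ennreal (N * (\<phi> x r * U x r))"
        using far r True by blast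
      also have "\<dots> \<le> ennreal (A * N * (\<phi> x r * U x r))"
      proof -
        have "1 \<le> A" using A1 by (simp add: A_def)
        then have "1 * (N * (\<phi> x r * U x r)) \<le> A * (N * (\<phi> x r * U x r))"
          using N Qp by (intro mult_right_mono) auto
        then show ?thesis by (simp add: mult.assoc ennreal_leI)
      qed
      finally show ?thesis .
    next
      case False
      \<comment> \<open>Now \<open>norm x < 4 * r\<close>, so the ball lies in a centred one of
        comparable size, on which \<open>U\<close> is comparable by doubling.\<close>
      have sub: "ball x r \<subseteq> ball 0 (5 * r)"
        using False by (subst ball_subset_ball_iff) auto
      then have "emeasure \<Psi> (ball x r) \<le> emeasure \<Psi> (ball 0 (5 * r))"
        by (intro emeasure_mono) (auto simp: sets)
      also have "\<dots> \<le> ennreal (A1 * N * (\<phi> 0 (5 * r) * U 0 (5 * r)))"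
        using r by (intro origin) auto
      also have "\<dots> \<le> ennreal (A * N * (\<phi> x r * U x r))"
      proof (rule ennreal_leI)
        have "mass w 0 (5 * r) \<le> C * 5 powr (n * p) * mass w x r"
          using muckenhoupt_doubling[OF mu sub] r by (simp add: n_def)
        then have "U 0 (5 * r) \<le> (5 * max (norm x) r) powr \<alpha> * (C * 5 powr (n * p) * mass w x r)"
          unfolding U_def using r alpha by (intro mult_mono powr_mono2) auto
        also have "\<dots> = B5 * U x r"
          using r by (simp add: B5_def U_def powr_mult)
        finally have "U 0 (5 * r) powr e \<le> (B5 * U x r) powr e"
          using e U_pos[of "5 * r" 0] r by (intro powr_mono2) auto
        also have "\<dots> = B5 powr e * U x r powr e"
          using B5 U_pos[OF r, of x] by (simp add: powr_mult)
        finally have "(5 * r) powr lam1 * U 0 (5 * r) powr e \<le> (5 * r) powr lam1 * (B5 powr e * U x r powr e)"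
          by (intro mult_left_mono) auto
        also have "\<dots> = 5 powr lam1 * B5 powr e * (\<phi> x r * U x r)"
          using r by (simp add: Q powr_mult)
        finally have "A1 * N * (\<phi> 0 (5 * r) * U 0 (5 * r)) \<le> A1 * N * (5 powr lam1 * B5 powr e * (\<phi> x r * U x r))"
          using A1 N r by (intro mult_left_mono) (auto simp: Q)
        also have "\<dots> \<le> A * N * (\<phi> x r * U x r)"
          using N Qp by (simp add: A_def algebra_simps)
        finally show "A1 * N * (\<phi> 0 (5 * r) * U 0 (5 * r)) \<le> A * N * (\<phi> x r * U x r)" .
      qed
      finally show ?thesis .
    qed
  qed
  show ?thesis by (rule that[OF A all])
qed

end

section \<open>Translation to Morrey norms and boundedness of the operator\<close>

lemma ennreal_divide_le_iff_real:
  assumes "0 < d" "0 \<le> a"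
  shows "x / ennreal d \<le> ennreal a \<longleftrightarrow> x \<le> ennreal (a * d)"
proof -
  have "x = x / ennreal d * ennreal d"
    using assms by (simp add: ennreal_divide_times ennreal_mult_divide_eq)
  moreover have "ennreal (a * d) / ennreal d = ennreal a"
    using assms by (simp add: divide_ennreal)
  moreover have "ennreal (a * d) = ennreal a * ennreal d"
    using assms by (simp add: ennreal_mult)
  ultimately show ?thesis
    by (metis divide_right_mono_ennreal mult_right_mono zero_le)
qed

context morrey_power_weight
begin

lemma p_pos: "0 < p"
  using D(2) by simp

text \<open>The denominators are positive and finite, so quotient and root can be cleared for each
  ball; what remains has the shape of \<open>morrey_bound\<close>.\<close>

lemma morrey_norm_le_iff:
  assumes [measurable]: "f \<in> borel_measurable lebesgue" and \<nu>: "0 \<le> \<nu>"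
  shows "morrey_norm p lam1 lam2 v f \<le> ennreal \<nu> \<longleftrightarrow>
    (\<forall>x r. 0 < r \<longrightarrow> (\<integral>\<^sup>+y\<in>ball x r. epowr (eabs (f y)) p \<partial>wm v) \<le>
      ennreal (\<nu> powr p * (r powr lam1 * mass v x r powr (lam2 / real DIM('a)))))"
proof -
  have "epowr ((\<integral>\<^sup>+y\<in>ball x r. epowr (eabs (f y)) p * ennreal (v y) \<partial>lebesgue) /
             (ennreal (r powr lam1) * epowr (wmeas v (ball x r)) (lam2 / real DIM('a)))) (1 / p) \<le> ennreal \<nu> \<longleftrightarrow>
      (\<integral>\<^sup>+y\<in>ball x r. epowr (eabs (f y)) p \<partial>wm v) \<le>
      ennreal (\<nu> powr p * (r powr lam1 * mass v x r powr (lam2 / real DIM('a))))" if r: "0 < r" for x r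
  proof -
    have M: "0 < mass v x r" by (rule mass_pos[OF weight_v r])
    have "(\<integral>\<^sup>+y\<in>ball x r. epowr (eabs (f y)) p \<partial>wm v) = (\<integral>\<^sup>+y\<in>ball x r. epowr (eabs (f y)) p * ennreal (v y) \<partial>lebesgue)"
      by (rule set_nn_integral_wm) measurable
    moreover have "ennreal (r powr lam1) * epowr (wmeas v (ball x r)) (lam2 / real DIM('a)) =
        ennreal (r powr lam1 * mass v x r powr (lam2 / real DIM('a)))"
      using M weight_v by (simp add: wmeas_eq emeasure_wm_ball epowr_ennreal_pos ennreal_mult)
    moreover have "0 < r powr lam1 * mass v x r powr (lam2 / real DIM('a))"
      using r M by simp
    ultimately show ?thesis
      using epowr_inverse_le_iff[OF p_pos \<nu>] ennreal_divide_le_iff_real by simp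
  qed
  then show ?thesis
    unfolding morrey_norm_def SUP_le_iff by (simp add: Ball_def)
qed

lemma weak_morrey_norm_le_iff:
  assumes [measurable]: "f \<in> borel_measurable lebesgue" and \<nu>: "0 \<le> \<nu>"
  shows "weak_morrey_norm p lam1 lam2 v f \<le> ennreal \<nu> \<longleftrightarrow>
    (\<forall>x r t. 0 < r \<longrightarrow> 0 < t \<longrightarrow>
      ennreal (t powr p) * emeasure (wm v) {y \<in> ball x r. ennreal t < eabs (f y)} \<le>
      ennreal (\<nu> powr p * ((unit_ball_vol (real DIM('a)) * r ^ DIM('a)) powr (lam1 / real DIM('a)) *
        mass v x r powr (lam2 / real DIM('a)))))"
proof -
  have "epowr ((ennreal (t powr p) * wmeas v {y \<in> ball x r. eabs (f y) > ennreal t}) /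
              (epowr (emeasure lebesgue (ball x r)) (lam1 / real DIM('a)) *
               epowr (wmeas v (ball x r)) (lam2 / real DIM('a)))) (1 / p) \<le> ennreal \<nu> \<longleftrightarrow>
      ennreal (t powr p) * emeasure (wm v) {y \<in> ball x r. ennreal t < eabs (f y)} \<le>
      ennreal (\<nu> powr p * ((unit_ball_vol (real DIM('a)) * r ^ DIM('a)) powr (lam1 / real DIM('a)) *
        mass v x r powr (lam2 / real DIM('a))))" if r: "0 < r" for x r t
  proof -
    have M: "0 < mass v x r" by (rule mass_pos[OF weight_v r])
    have V: "0 < unit_ball_vol (real DIM('a)) * r ^ DIM('a)" using r by simp
    have "{y \<in> ball x r. ennreal t < eabs (f y)} \<in> sets lebesgue" by measurable
    then have "wmeas v {y \<in> ball x r. ennreal t < eabs (f y)} = emeasure (wm v) {y \<in> ball x r. ennreal t < eabs (f y)}"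
      using v_measurable by (rule wmeas_eq[rotated])
    moreover have "epowr (emeasure lebesgue (ball x r)) (lam1 / real DIM('a)) * epowr (wmeas v (ball x r)) (lam2 / real DIM('a)) =
        ennreal ((unit_ball_vol (real DIM('a)) * r ^ DIM('a)) powr (lam1 / real DIM('a)) * mass v x r powr (lam2 / real DIM('a)))"
    proof -
      have "epowr (emeasure lebesgue (ball x r)) (lam1 / real DIM('a)) =
          ennreal ((unit_ball_vol (real DIM('a)) * r ^ DIM('a)) powr (lam1 / real DIM('a)))"
        using epowr_ennreal_pos[OF V] r by (simp add: emeasure_ball)
      then show ?thesis
        using M weight_v by (simp add: wmeas_eq emeasure_wm_ball epowr_ennreal_pos ennreal_mult)
    qed
    moreover have "0 < (unit_ball_vol (real DIM('a)) * r ^ DIM('a)) powr (lam1 / real DIM('a)) *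
        mass v x r powr (lam2 / real DIM('a))"
      using V M by (metis less_irrefl mult_pos_pos powr_gt_zero)
    ultimately show ?thesis
      using epowr_inverse_le_iff[OF p_pos \<nu>] ennreal_divide_le_iff_real by simp
  qed
  then show ?thesis
    unfolding weak_morrey_norm_def SUP_le_iff by auto
qed

lemma morrey_space_bound:
  assumes "f \<in> morrey_space p lam1 lam2 v"
  obtains \<nu> where "0 \<le> \<nu>" "morrey_norm p lam1 lam2 v f = ennreal \<nu>"
    "morrey_bound (\<nu> powr p) (\<lambda>y. eabs (f y))"
proof -
  have f [measurable]: "f \<in> borel_measurable lebesgue" and "morrey_norm p lam1 lam2 v f < top"
    using assms by (auto simp: morrey_space_def)
  then obtain \<nu> where \<nu>: "0 \<le> \<nu>" "morrey_norm p lam1 lam2 v f = ennreal \<nu>"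
    unfolding less_top_ennreal by blast
  have "morrey_bound (\<nu> powr p) (\<lambda>y. eabs (f y))"
    using morrey_norm_le_iff[OF f \<nu>(1)] \<nu>(2) by (simp add: morrey_bound_def)
  with \<nu> show ?thesis by (rule that)
qed

lemma phi_mult_U_le:
  assumes "0 < r"
  shows "\<phi> x r * U x r \<le> (C * 4 powr (real DIM('a) * p + \<alpha>)) powr (lam2 / real DIM('a)) *
    (r powr lam1 * mass v x r powr (lam2 / real DIM('a)))"
proof -
  have "U x r powr (lam2 / real DIM('a)) \<le> (C * 4 powr (real DIM('a) * p + \<alpha>) * mass v x r) powr (lam2 / real DIM('a))"
    using U_le_mass_v[OF assms, of x] U_pos[OF assms, of x] lam2 by (intro powr_mono2) auto
  then have "r powr lam1 * U x r powr (lam2 / real DIM('a)) \<le>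
      r powr lam1 * (C * 4 powr (real DIM('a) * p + \<alpha>) * mass v x r) powr (lam2 / real DIM('a))"
    by (rule mult_left_mono) simp
  then show ?thesis
    unfolding phi_mult_U[OF assms] powr_mult[of _ "mass v x r"] by (simp only: ac_simps)
qed

text \<open>The dyadic annuli omit the origin, so the measures fed to
  \<open>far_to_all_balls\<close> must not charge it.\<close>

lemma null_singleton:
  "h \<in> borel_measurable lebesgue \<Longrightarrow> emeasure (density (wm v) h) {0} = 0"
proof -
  assume h: "h \<in> borel_measurable lebesgue"
  have "emeasure lebesgue {0::'a} = 0"
    by simp
  then have "emeasure (wm v) {0} = 0"
    using weight_null_iff[OF weight_v, of "{0}"] by simp
  then have "AE y in wm v. y \<notin> {0}"
    by (intro AE_not_in) (auto simp: null_sets_def)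
  then have "(\<integral>\<^sup>+y\<in>{0}. h y \<partial>wm v) = (\<integral>\<^sup>+y. 0 \<partial>wm v)"
    by (intro nn_integral_cong_AE) (auto elim!: eventually_mono)
  then show ?thesis using h by (simp add: emeasure_density)
qed

lemma maximal_strong:
  assumes S: "0 < S" "\<And>g. g \<in> borel_measurable lebesgue \<Longrightarrow>
    (\<integral>\<^sup>+x. epowr (hl g x) p \<partial>wm w) \<le> ennreal S * (\<integral>\<^sup>+x. epowr (g x) p \<partial>wm w)"
  shows "bounded_operator maximal (morrey_space p lam1 lam2 v) (morrey_norm p lam1 lam2 v)
    (morrey_space p lam1 lam2 v) (morrey_norm p lam1 lam2 v)"
proof -
  obtain A where A: "0 < A" "\<And>N g x r. morrey_bound N g \<Longrightarrow> 0 < r \<Longrightarrow> r \<le> norm x / 4 \<Longrightarrow>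
      (\<integral>\<^sup>+y\<in>ball x r. epowr (hl g y) p \<partial>wm v) \<le> ennreal (A * N * (\<phi> x r * U x r))"
    using far_strong[OF S] by blast
  obtain B where B: "0 < B" "\<And>\<Psi> N x r. sets \<Psi> = sets lebesgue \<Longrightarrow> emeasure \<Psi> {0} = 0 \<Longrightarrow> 0 \<le> N \<Longrightarrow>
      (\<And>x r. 0 < r \<Longrightarrow> r \<le> norm x / 4 \<Longrightarrow> emeasure \<Psi> (ball x r) \<le> ennreal (N * (\<phi> x r * U x r))) \<Longrightarrow>
      0 < r \<Longrightarrow> emeasure \<Psi> (ball x r) \<le> ennreal (B * N * (\<phi> x r * U x r))"
    using far_to_all_balls by blast
  \<comment> \<open>The last factor is the cost of returning from \<open>U\<close> to
    \<open>mass v\<close>. The operator bound is the \<open>p\<close>-th root of \<open>K\<close>,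
    since \<open>morrey_bound\<close> measures \<open>p\<close>-th powers.\<close>
  define K where "K = B * A * (C * 4 powr (real DIM('a) * p + \<alpha>)) powr (lam2 / real DIM('a))"
  have K: "0 < K" using A(1) B(1) D(3) by (simp add: K_def)
  have "maximal f \<in> morrey_space p lam1 lam2 v \<and>
      morrey_norm p lam1 lam2 v (maximal f) \<le> ennreal (K powr (1 / p)) * morrey_norm p lam1 lam2 v f"
    if fm: "f \<in> morrey_space p lam1 lam2 v" for f
  proof -
    obtain \<nu> where \<nu>: "0 \<le> \<nu>" "morrey_norm p lam1 lam2 v f = ennreal \<nu>"
      and mb: "morrey_bound (\<nu> powr p) (\<lambda>y. eabs (f y))"
      using morrey_space_bound[OF fm] by blast
    let ?g = "\<lambda>y. eabs (f y)"
    have [measurable]: "(\<lambda>y. epowr (hl ?g y) p) \<in> borel_measurable lebesgue" by measurable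
    have em: "emeasure (density (wm v) (\<lambda>y. epowr (hl ?g y) p)) (ball x r) = (\<integral>\<^sup>+y\<in>ball x r. epowr (hl ?g y) p \<partial>wm v)" for x r
      by (rule emeasure_density) auto
    have bound: "(\<integral>\<^sup>+y\<in>ball x r. epowr (hl ?g y) p \<partial>wm v) \<le>
        ennreal ((K powr (1 / p) * \<nu>) powr p * (r powr lam1 * mass v x r powr (lam2 / real DIM('a))))" if r: "0 < r" for x r
    proof -
      have "(\<integral>\<^sup>+y\<in>ball x r. epowr (hl ?g y) p \<partial>wm v) \<le> ennreal (B * (A * \<nu> powr p) * (\<phi> x r * U x r))"
        unfolding em[symmetric] using A(1) A(2)[OF mb] r
        by (intro B(2)) (auto simp: em intro!: null_singleton)
      also have "\<dots> \<le> ennreal (B * (A * \<nu> powr p) * ((C * 4 powr (real DIM('a) * p + \<alpha>)) powr (lam2 / real DIM('a)) *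
          (r powr lam1 * mass v x r powr (lam2 / real DIM('a)))))"
        using phi_mult_U_le[OF r, of x] A(1) B(1) by (intro ennreal_leI mult_left_mono) auto
      also have "B * (A * \<nu> powr p) * ((C * 4 powr (real DIM('a) * p + \<alpha>)) powr (lam2 / real DIM('a)) *
          (r powr lam1 * mass v x r powr (lam2 / real DIM('a)))) = K * \<nu> powr p * (r powr lam1 * mass v x r powr (lam2 / real DIM('a)))"
        by (simp only: K_def ac_simps)
      also have "K * \<nu> powr p = (K powr (1 / p) * \<nu>) powr p"
        using K p_pos by (simp add: powr_mult powr_powr)
      finally show ?thesis .
    qed
    have "morrey_norm p lam1 lam2 v (maximal f) \<le> ennreal (K powr (1 / p) * \<nu>)"
      using bound \<nu>(1) by (subst morrey_norm_le_iff[OF maximal_measurable]) (auto simp: eabs_maximal)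
    moreover from this have "morrey_norm p lam1 lam2 v (maximal f) < top"
      by (rule le_less_trans) simp
    ultimately show ?thesis
      using \<nu> maximal_measurable[of f] by (simp add: morrey_space_def ennreal_mult)
  qed
  then show ?thesis unfolding bounded_operator_def by blast
qed

lemma maximal_weak:
  "bounded_operator maximal (morrey_space p lam1 lam2 v) (morrey_norm p lam1 lam2 v)
    (weak_morrey_space p lam1 lam2 v) (weak_morrey_norm p lam1 lam2 v)"
proof -
  obtain A where A: "0 < A" "\<And>N g x r t. morrey_bound N g \<Longrightarrow> 0 < r \<Longrightarrow> r \<le> norm x / 4 \<Longrightarrow> 0 < t \<Longrightarrow>
      ennreal (t powr p) * emeasure (wm v) {y \<in> ball x r. ennreal t < hl g y} \<le> ennreal (A * N * (\<phi> x r * U x r))"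
    using far_weak by blast
  obtain B where B: "0 < B" "\<And>\<Psi> N x r. sets \<Psi> = sets lebesgue \<Longrightarrow> emeasure \<Psi> {0} = 0 \<Longrightarrow> 0 \<le> N \<Longrightarrow>
      (\<And>x r. 0 < r \<Longrightarrow> r \<le> norm x / 4 \<Longrightarrow> emeasure \<Psi> (ball x r) \<le> ennreal (N * (\<phi> x r * U x r))) \<Longrightarrow>
      0 < r \<Longrightarrow> emeasure \<Psi> (ball x r) \<le> ennreal (B * N * (\<phi> x r * U x r))"
    using far_to_all_balls by blast
  \<comment> \<open>The weak norm has the volume to the power \<open>lam1 / n\<close> where the
    strong one has \<open>r powr lam1\<close>; they differ by this constant factor.\<close>
  let ?k = "unit_ball_vol (real DIM('a)) powr (lam1 / real DIM('a))"
  have k: "0 < ?k" using less_imp_neq[OF unit_ball_vol_pos, of "real DIM('a)"] by simp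
  define K0 where "K0 = B * A * (C * 4 powr (real DIM('a) * p + \<alpha>)) powr (lam2 / real DIM('a))"
  define K where "K = K0 / ?k"
  have K0: "0 < K0" using A(1) B(1) D(3) by (simp add: K0_def)
  then have K: "0 < K" using k by (simp add: K_def)
  have "maximal f \<in> weak_morrey_space p lam1 lam2 v \<and>
      weak_morrey_norm p lam1 lam2 v (maximal f) \<le> ennreal (K powr (1 / p)) * morrey_norm p lam1 lam2 v f"
    if fm: "f \<in> morrey_space p lam1 lam2 v" for f
  proof -
    obtain \<nu> where \<nu>: "0 \<le> \<nu>" "morrey_norm p lam1 lam2 v f = ennreal \<nu>"
      and mb: "morrey_bound (\<nu> powr p) (\<lambda>y. eabs (f y))"
      using morrey_space_bound[OF fm] by blast
    let ?g = "\<lambda>y. eabs (f y)"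
    have bound: "ennreal (t powr p) * emeasure (wm v) {y \<in> ball x r. ennreal t < hl ?g y} \<le>
        ennreal ((K powr (1 / p) * \<nu>) powr p * ((unit_ball_vol (real DIM('a)) * r ^ DIM('a)) powr (lam1 / real DIM('a)) *
          mass v x r powr (lam2 / real DIM('a))))" if r: "0 < r" and t: "0 < t" for x r t
    proof -
      \<comment> \<open>With the factor \<open>t powr p\<close> in the density, the bound on far
        balls, and hence the one on all balls, is uniform in \<open>t\<close>.\<close>
      define h where "h y = ennreal (t powr p) * indicator {y. ennreal t < hl ?g y} y" for y
      have h [measurable]: "h \<in> borel_measurable lebesgue" unfolding h_def by measurable
      have em: "emeasure (density (wm v) h) (ball x r) = ennreal (t powr p) * emeasure (wm v) {y \<in> ball x r. ennreal t < hl ?g y}" for x r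
      proof -
        have ms: "{y \<in> ball x r. ennreal t < hl ?g y} \<in> sets lebesgue" by measurable
        have "emeasure (density (wm v) h) (ball x r) = (\<integral>\<^sup>+y\<in>ball x r. h y \<partial>wm v)"
          by (rule emeasure_density) auto
        also have "\<dots> = (\<integral>\<^sup>+y. ennreal (t powr p) * indicator {y \<in> ball x r. ennreal t < hl ?g y} y \<partial>wm v)"
          by (intro nn_integral_cong) (auto simp: h_def indicator_def)
        also have "\<dots> = ennreal (t powr p) * emeasure (wm v) {y \<in> ball x r. ennreal t < hl ?g y}"
          using ms by (intro nn_integral_cmult_indicator) simp
        finally show ?thesis .
      qed
      have "emeasure (density (wm v) h) (ball x r) \<le> ennreal (B * (A * \<nu> powr p) * (\<phi> x r * U x r))"
      proof (rule B(2)[OF _ _ _ _ r])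
        show "emeasure (density (wm v) h) {0} = 0" by (rule null_singleton[OF h])
        show "emeasure (density (wm v) h) (ball x r) \<le> ennreal (A * \<nu> powr p * (\<phi> x r * U x r))"
          if "0 < r" "r \<le> norm x / 4" for x r
          unfolding em by (rule A(2)[OF mb that t])
      qed (use A(1) in auto)
      also have "\<dots> \<le> ennreal (B * (A * \<nu> powr p) * ((C * 4 powr (real DIM('a) * p + \<alpha>)) powr (lam2 / real DIM('a)) *
          (r powr lam1 * mass v x r powr (lam2 / real DIM('a)))))"
        using phi_mult_U_le[OF r, of x] A(1) B(1) by (intro ennreal_leI mult_left_mono) auto
      also have "B * (A * \<nu> powr p) * ((C * 4 powr (real DIM('a) * p + \<alpha>)) powr (lam2 / real DIM('a)) *
          (r powr lam1 * mass v x r powr (lam2 / real DIM('a)))) = K0 * \<nu> powr p * (r powr lam1 * mass v x r powr (lam2 / real DIM('a)))"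
        by (simp only: K0_def ac_simps)
      also have "\<dots> = K * \<nu> powr p * ((?k * r powr lam1) * mass v x r powr (lam2 / real DIM('a)))"
        using k by (simp add: K_def)
      also have "?k * r powr lam1 = (unit_ball_vol (real DIM('a)) * r ^ DIM('a)) powr (lam1 / real DIM('a))"
        using r by (simp add: powr_mult powr_powr flip: powr_realpow)
      also have "K * \<nu> powr p = (K powr (1 / p) * \<nu>) powr p"
        using K p_pos by (simp add: powr_mult powr_powr)
      finally show ?thesis unfolding em .
    qed
    have "weak_morrey_norm p lam1 lam2 v (maximal f) \<le> ennreal (K powr (1 / p) * \<nu>)"
      using bound \<nu>(1) by (subst weak_morrey_norm_le_iff[OF maximal_measurable]) (auto simp: eabs_maximal)
    moreover from this have "weak_morrey_norm p lam1 lam2 v (maximal f) < top"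
      by (rule le_less_trans) simp
    ultimately show ?thesis
      using \<nu> maximal_measurable[of f] by (simp add: weak_morrey_space_def ennreal_mult)
  qed
  then show ?thesis unfolding bounded_operator_def by blast
qed

end

section \<open>The growth condition from the reverse Hoelder index\<close>

text \<open>
  If no \<open>RH\<close> class contained \<open>w\<close>, \<open>rh_index_conj w\<close> would be the junk value \<open>conj_exp 0 = 0\<close>; hence the
  hypothesis on \<open>\<sigma>\<^sub>0\<close>.
\<close>
lemma RH_exponent_below_index:
  assumes "1 < \<sigma>\<^sub>0" "RH \<sigma>\<^sub>0 w" and q: "rh_index_conj w < q"
  obtains \<sigma> where "1 < \<sigma>" "RH \<sigma> w" "conj_exp \<sigma> < q"
proof (rule ccontr)
  assume "\<not> thesis"
  then have no: "q \<le> conj_exp \<sigma>" if "1 < \<sigma>" "RH \<sigma> w" for \<sigma>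
    using that \<open>\<And>\<sigma>. 1 < \<sigma> \<Longrightarrow> RH \<sigma> w \<Longrightarrow> conj_exp \<sigma> < q \<Longrightarrow> thesis\<close> by (meson not_le)
  have \<sigma>0: "ereal \<sigma>\<^sub>0 \<le> rh_index w"
    unfolding rh_index_def using assms(1,2) by (intro Sup_upper) auto
  \<comment> \<open>The index is above 1 or infinite, so its conjugate is at least 1. Above 1,
    \<open>conj_exp\<close> is a decreasing involution, which turns
    \<open>q \<le> conj_exp \<sigma>\<close> into \<open>\<sigma> \<le> conj_exp q\<close>; then the
    index is finite and its conjugate is at least \<open>q\<close>, a contradiction.\<close>
  have q1: "1 < q"
  proof (cases "rh_index w")
    case (real s)
    then have "1 < s" using \<sigma>0 assms(1) by simp
    then have "1 < rh_index_conj w" using real by (simp add: rh_index_conj_def conj_exp_def)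
    then show ?thesis using q by simp
  next
    case PInf
    then show ?thesis using q by (simp add: rh_index_conj_def)
  qed (use \<sigma>0 in auto)
  have "\<sigma> \<le> conj_exp q" if "1 < \<sigma>" "RH \<sigma> w" for \<sigma>
    using no[OF that] that(1) q1 by (simp add: conj_exp_def field_simps)
  then have le: "rh_index w \<le> ereal (conj_exp q)"
    unfolding rh_index_def by (intro Sup_least) auto
  then obtain s where s: "rh_index w = ereal s"
    using \<sigma>0 by (cases "rh_index w") auto
  then have "1 < s" "s \<le> conj_exp q" using \<sigma>0 assms(1) le by simp_all
  then have "q \<le> conj_exp s" using q1 by (simp add: conj_exp_def field_simps)
  then show False using q s by (simp add: rh_index_conj_def)
qed

text \<open>For \<open>lam1 \<le> 0\<close> both factors are at most 1. Otherwise the hypothesis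
  places the conjugate index below \<open>(n - lam2) / lam1\<close>, so a class
  \<open>RH \<sigma>\<close> containing \<open>w\<close> also has its conjugate exponent below this
  number; the mass decay of \<open>RH_mass_le\<close> then compensates
  \<open>(s / r) powr lam1\<close>.\<close>

lemma growth_from_RH:
  fixes w :: "'a::euclidean_space \<Rightarrow> real"
  assumes mu: "muckenhoupt p C w" and lam2: "0 \<le> lam2" "lam2 \<le> real DIM('a)"
    and lam: "lam1 * rh_index_conj w + lam2 < real DIM('a)"
  shows "\<exists>K>0. \<forall>x r s. 0 < r \<longrightarrow> r \<le> s \<longrightarrow>
      (s / r) powr lam1 * (mass w x r / mass w x s) powr (1 - lam2 / real DIM('a)) \<le> K"
proof -
  let ?n = "real DIM('a)"
  note w = muckenhouptD(1)[OF mu]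
  define \<kappa> where "\<kappa> = 1 - lam2 / ?n"
  have kappa: "0 \<le> \<kappa>" using lam2 by (simp add: \<kappa>_def field_simps)
  show ?thesis
  proof (cases "lam1 \<le> 0")
    case True
    have "(s / r) powr lam1 * (mass w x r / mass w x s) powr \<kappa> \<le> 1" if "0 < r" "r \<le> s" for x r s
    proof -
      have "(s / r) powr lam1 \<le> (s / r) powr 0"
        using True that by (intro powr_mono) auto
      moreover have "mass w x r \<le> mass w x s" "0 < mass w x s"
        using that mass_mono[OF w] mass_pos[OF w] by (auto simp: subset_ball)
      then have "(mass w x r / mass w x s) powr \<kappa> \<le> 1 powr \<kappa>"
        using kappa by (intro powr_mono2) auto
      ultimately have "(s / r) powr lam1 * (mass w x r / mass w x s) powr \<kappa> \<le> 1 * 1"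
        using that by (intro mult_mono) auto
      then show ?thesis by simp
    qed
    then show ?thesis unfolding \<kappa>_def[symmetric] by (intro exI[of _ 1]) auto
  next
    case False
    then have lam1: "0 < lam1" by simp
    define q where "q = (?n - lam2) / lam1"
    have "rh_index_conj w < q"
      using lam lam1 by (simp add: q_def field_simps)
    moreover obtain \<sigma>\<^sub>0 where "1 < \<sigma>\<^sub>0" "RH \<sigma>\<^sub>0 w"
      using muckenhoupt_RH[OF mu] by blast
    ultimately obtain \<sigma> where \<sigma>: "1 < \<sigma>" "RH \<sigma> w" "conj_exp \<sigma> < q"
      using RH_exponent_below_index by blast
    define e where "e = ?n * (1 - 1 / \<sigma>)"
    \<comment> \<open>\<open>e * \<kappa>\<close> equals \<open>n - lam2\<close> divided by the
      conjugate of \<sigma>, and that conjugate is below \<open>(n - lam2) / lam1\<close>.\<close>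
    have ek: "lam1 \<le> e * \<kappa>"
    proof -
      have "lam1 * conj_exp \<sigma> < ?n - lam2"
        using \<sigma>(3) lam1 by (simp add: q_def field_simps)
      then have "lam1 * conj_exp \<sigma> * (1 - 1 / \<sigma>) \<le> (?n - lam2) * (1 - 1 / \<sigma>)"
        using \<sigma>(1) by (intro mult_right_mono) auto
      moreover have "conj_exp \<sigma> * (1 - 1 / \<sigma>) = 1"
        using \<sigma>(1) by (simp add: conj_exp_def field_simps)
      moreover have "(?n - lam2) * (1 - 1 / \<sigma>) = e * \<kappa>"
      proof -
        have "?n * \<kappa> = ?n - lam2" by (simp add: \<kappa>_def right_diff_distrib)
        moreover have "e * \<kappa> = (?n * \<kappa>) * (1 - 1 / \<sigma>)" by (simp only: e_def ac_simps)
        ultimately show ?thesis by (simp only:)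
      qed
      ultimately show ?thesis by (simp add: mult.assoc)
    qed
    obtain K where K: "0 < K" "\<And>x y r s. 0 < r \<Longrightarrow> 0 < s \<Longrightarrow> ball x r \<subseteq> ball y s \<Longrightarrow>
        mass w x r \<le> K * (r / s) powr (?n * (1 - 1 / \<sigma>)) * mass w y s"
      using RH_mass_le[OF w \<sigma>(2,1)] by blast
    have "(s / r) powr lam1 * (mass w x r / mass w x s) powr \<kappa> \<le> K powr \<kappa>" if r: "0 < r" "r \<le> s" for x r s
    proof -
      have s: "0 < s" using r by simp
      have "mass w x r \<le> K * (r / s) powr e * mass w x s"
        using K(2)[of r s x x] r s by (simp add: subset_ball e_def)
      then have "mass w x r / mass w x s \<le> K * (r / s) powr e"
        using mass_pos[OF w s, of x] by (simp add: pos_divide_le_eq)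
      then have "(mass w x r / mass w x s) powr \<kappa> \<le> (K * (r / s) powr e) powr \<kappa>"
        using kappa by (intro powr_mono2) auto
      also have "\<dots> = K powr \<kappa> * (r / s) powr (e * \<kappa>)"
        unfolding powr_mult powr_powr ..
      finally have "(s / r) powr lam1 * (mass w x r / mass w x s) powr \<kappa> \<le>
          (s / r) powr (e * \<kappa>) * (K powr \<kappa> * (r / s) powr (e * \<kappa>))"
        using ek r s by (intro mult_mono powr_mono) auto
      also have "\<dots> = K powr \<kappa> * ((s / r) powr (e * \<kappa>) * (r / s) powr (e * \<kappa>))"
        by (simp only: ac_simps)
      also have "(s / r) powr (e * \<kappa>) * (r / s) powr (e * \<kappa>) = 1"
        using r s by (simp flip: powr_mult)
      finally show ?thesis by simp
    qed
    then show ?thesis unfolding \<kappa>_def[symmetric] using K(1) by (intro exI[of _ "K powr \<kappa>"]) auto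
  qed
qed

theorem theorem3p4:
  fixes w :: "'a::euclidean_space \<Rightarrow> real"
    and lam1 lam2 \<theta> \<alpha> c :: real
  assumes "0 \<le> lam2" and "lam2 \<le> real DIM('a)"
    and "lam1 * rh_index_conj w + lam2 > 0"
    and "lam1 * rh_index_conj w + lam2 < real DIM('a)"
    and "\<theta> \<ge> 0" and "lam1 + lam2 * \<theta> > 0"
    and "\<And>r R. 0 < r \<Longrightarrow> r < R \<Longrightarrow>
           wmeas w (ball 0 r) / wmeas w (ball 0 R) \<le> ennreal (c * (r / R) powr (real DIM('a) * \<theta>))"
    and "0 \<le> \<alpha>"
    and "lam2 < real DIM('a) \<Longrightarrow> \<alpha> < real DIM('a) / (real DIM('a) - lam2) * (lam1 + lam2 * \<theta>)"
  shows "(\<forall>p>1. Ap p w \<longrightarrow>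
            bounded_operator maximal
              (morrey_space p lam1 lam2 (power_weight \<alpha> w)) (morrey_norm p lam1 lam2 (power_weight \<alpha> w))
              (morrey_space p lam1 lam2 (power_weight \<alpha> w)) (morrey_norm p lam1 lam2 (power_weight \<alpha> w))) \<and>
         (A1 w \<longrightarrow>
            bounded_operator maximal
              (morrey_space 1 lam1 lam2 (power_weight \<alpha> w)) (morrey_norm 1 lam1 lam2 (power_weight \<alpha> w))
              (weak_morrey_space 1 lam1 lam2 (power_weight \<alpha> w)) (weak_morrey_norm 1 lam1 lam2 (power_weight \<alpha> w)))"
proof -
  let ?n = "real DIM('a)"
  have morrey: "morrey_power_weight w p C lam1 lam2 (1 - lam2 / ?n) \<theta> \<alpha> (max c 1)" if mu: "muckenhoupt p C w" for p C
  proof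
    note w = muckenhouptD(1)[OF mu]
    show "mass w 0 r \<le> max c 1 * (r / R) powr (?n * \<theta>) * mass w 0 R" if "0 < r" "r < R" for r R
    proof -
      have M: "0 < mass w 0 R" using that by (intro mass_pos[OF w]) simp
      have "ennreal (mass w 0 r / mass w 0 R) \<le> ennreal (c * (r / R) powr (?n * \<theta>))"
        using assms(7)[OF that] w M by (simp add: wmeas_eq emeasure_wm_ball divide_ennreal weight_measurable)
      also have "\<dots> \<le> ennreal (max c 1 * (r / R) powr (?n * \<theta>))"
        by (intro ennreal_leI mult_right_mono) auto
      finally have "mass w 0 r / mass w 0 R \<le> max c 1 * (r / R) powr (?n * \<theta>)"
        by (subst (asm) ennreal_le_iff) auto
      then show ?thesis using M by (simp add: pos_divide_le_eq)
    qed
    \<comment> \<open>For \<open>lam2 < n\<close> this is the given bound multiplied by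
      \<open>(n - lam2) / n\<close>; for \<open>lam2 = n\<close> the left side is 0.\<close>
    show "\<alpha> * (1 - lam2 / ?n) < lam1 + lam2 * \<theta>"
    proof (cases "lam2 < ?n")
      case True
      then have "\<alpha> * (1 - lam2 / ?n) < ?n / (?n - lam2) * (lam1 + lam2 * \<theta>) * (1 - lam2 / ?n)"
        using assms(9) by (intro mult_strict_right_mono) auto
      also have "\<dots> = (?n / (?n - lam2) * ((?n - lam2) / ?n)) * (lam1 + lam2 * \<theta>)"
        by (simp add: diff_divide_distrib)
      also have "\<dots> = lam1 + lam2 * \<theta>" using True by simp
      finally show ?thesis .
    next
      case False
      then have "lam2 = ?n" using assms(2) by simp
      then show ?thesis using assms(6) by simp
    qed
    show "\<exists>K>0. \<forall>x r s. 0 < r \<longrightarrow> r \<le> s \<longrightarrow>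
      (s / r) powr lam1 * (mass w x r / mass w x s) powr (1 - lam2 / ?n) \<le> K"
      by (rule growth_from_RH[OF mu assms(1,2,4)])
  qed (use assms mu in auto)
  show ?thesis
  proof (intro conjI allI impI)
    fix p :: real assume p: "1 < p" and Ap: "Ap p w"
    obtain C where C: "muckenhoupt p C w" using Ap_muckenhoupt[OF Ap p] by blast
    \<comment> \<open>The exponent \<open>p\<close> itself serves the averages and the locale; the
      smaller \<open>q\<close> serves only the interpolation behind the strong type
      estimate.\<close>
    obtain q C' where q: "q < p" "muckenhoupt q C' w" using Ap_muckenhoupt_open[OF Ap p] by blast
    obtain S where S: "0 < S" "\<And>g. g \<in> borel_measurable lebesgue \<Longrightarrow>
        (\<integral>\<^sup>+x. epowr (hl g x) p \<partial>wm w) \<le> ennreal S * (\<integral>\<^sup>+x. epowr (g x) p \<partial>wm w)"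
      using muckenhoupt_strong_type[OF q(2,1)] by blast
    show "bounded_operator maximal
        (morrey_space p lam1 lam2 (power_weight \<alpha> w)) (morrey_norm p lam1 lam2 (power_weight \<alpha> w))
        (morrey_space p lam1 lam2 (power_weight \<alpha> w)) (morrey_norm p lam1 lam2 (power_weight \<alpha> w))"
      by (rule morrey_power_weight.maximal_strong[OF morrey[OF C] S])
  next
    assume "A1 w"
    then obtain C where "muckenhoupt 1 C w" using A1_muckenhoupt by blast
    then show "bounded_operator maximal
        (morrey_space 1 lam1 lam2 (power_weight \<alpha> w)) (morrey_norm 1 lam1 lam2 (power_weight \<alpha> w))
        (weak_morrey_space 1 lam1 lam2 (power_weight \<alpha> w)) (weak_morrey_norm 1 lam1 lam2 (power_weight \<alpha> w))"
      by (rule morrey_power_weight.maximal_weak[OF morrey])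
  qed
qed

end
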